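(* Let $k$ be a field, and let $(\Sigma,w)$ be a $k$-balanced fan of dimension $d$ with vertex $v$. Suppose $H_q^{BM}(\Sigma,F_p^k)=0$ for all $q\ne d$ and all $p$. Then, for a given $p\in\{0,\dots,d\}$, the cap product $\frown[\Sigma,w]:H^q(\Sigma,F_k^p)\to H_{d-q}^{BM}(\Sigma,F_{d-p}^k)$ is an isomorphism for all $q$ if and only if $$(-1)^d\chi\big(C_\bullet^{BM}(\Sigma,F_{d-p}^k)\big)=\dim_kF_k^p(v).$$ Moreover, $(\Sigma,w)$ satisfies tropical Poincaré duality over $k$ if and only if this equality holds for all $p\in\{0,\dots,d\}$.
   Context: Below $R$ is a commutative ring; the claim uses $R=k$. $\chi$ of a bounded complex of finite-dimensional vector spaces is $\sum_q(-1)^q\dim_kC_q$. **Fans.** Let $N\cong\mathbb{Z}^n$ be a lattice, $N_{\mathbb{R}}=N\otimes\mathbb{R}$. A rational polyhedral cone is a strictly convex cone generated by finitely many vectors of $N$; for a cone $\sigma$, $L_{\mathbb{Z}}(\sigma)=N\cap\mathrm{span}(\sigma)$ and $\dim\sigma=\mathrm{rank}\,L_{\mathbb{Z}}(\sigma)$. A (rational polyhedral) fan $\Sigma$ is a finite nonempty collection of such cones, closed under taking faces, any two meeting in a common face; fans are assumed pure dimensional (all maximal cones have the same dimension $d=\dim\Sigma$). Cones are also called faces. $\Sigma^i$ is the set of $i$-dimensional cones, $\tau\preceq\sigma$ means $\tau$ is a face of $\sigma$, and $v=\{0\}\in\Sigma$ is the vertex, the only compact cone. Fix an orientation of each cone;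 for $\tau\prec\sigma$ with $\dim\tau=\dim\sigma-1$ let $\mathcal{O}(\tau,\sigma)=\pm1$ be the relative orientation sign. **Tropical (co)homology.** $F_p^{\mathbb{Z}}(\sigma)=\sum_{\gamma\succeq\sigma}\bigwedge^pL_{\mathbb{Z}}(\gamma)\subseteq\bigwedge^pN$ (with $F_0^{\mathbb{Z}}(\sigma)=\mathbb{Z}$), $F_p^R(\sigma)=F_p^{\mathbb{Z}}(\sigma)\otimes_{\mathbb{Z}}R$, and for $\tau\preceq\sigma$ the map $\iota_{\sigma,\tau}:F_p^R(\sigma)\to F_p^R(\tau)$ is induced by inclusion. $F^p_R(\sigma)=\mathrm{Hom}_R(F_p^R(\sigma),R)$ with $\rho_{\tau,\sigma}:F_R^p(\tau)\to F_R^p(\sigma)$ dual to $\iota_{\sigma,\tau}$. $C_q^{BM}(\Sigma,F_p^R)=\bigoplus_{\sigma\in\Sigma^q}F_p^R(\sigma)$, with boundary having components $\mathcal{O}(\tau,\sigma)\iota_{\sigma,\tau}$; its homology is $H_q^{BM}(\Sigma,F_p^R)$. $C^q(\Sigma,F_R^p)=\bigoplus F_R^p(\sigma)$ over compact $\sigma\in\Sigma^q$, with coboundary having components $\mathcal{O}(\tau,\sigma)\rho_{\tau,\sigma}$; its cohomology is $H^q(\Sigma,F_R^p)$ (so $C^0=F_R^p(v)$ and $C^q=0$ for $q>0$). **Balancing.** For $\alpha\in\Sigma^d$, $\Lambda_\alpha\in F_d^R(\alpha)=\bigwedge^dL_{\mathbb{Z}}(\alpha)\otimes R\cong R$ is the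 image of the generator of $\bigwedge^dL_{\mathbb{Z}}(\alpha)$ compatible with the orientation of $\alpha$. An $R$-weight function is $w:\Sigma^d\to R$ with no $w(\alpha)$ a zero-divisor. $(\Sigma,w)$ is $R$-balanced if the fundamental chain $\mathrm{Ch}(\Sigma,w)=(w(\alpha)\Lambda_\alpha)_\alpha\in C_d^{BM}(\Sigma,F_d^R)$ is a cycle; its class is the fundamental class $[\Sigma,w]\in H_d^{BM}(\Sigma,F_d^R)$. **Cap product and duality.** For $y=y_1\wedge\dots\wedge y_m$ in $\bigwedge^mM$ ($M$ free of finite rank) and $x=x_1\wedge\dots\wedge x_p\in\bigwedge^pM^*$, $p\le m$, the contraction is $x\lrcorner y=(-1)^{p(p-1)/2}\sum_a\mathrm{sign}(a)\left(\prod_{i=1}^px_i(y_{a(i)})\right)y_{a(p+1)}\wedge\dots\wedge y_{a(m)}\in\bigwedge^{m-p}M$, summing over permutations $a\in S_m$ increasing on $1,\dots,p$ and on $p+1,\dots,m$. The cap product $\frown[\Sigma,w]:H^q(\Sigma,F_R^p)\to H_{d-q}^{BM}(\Sigma,F_{d-p}^R)$ is induced by $(u_\gamma)_{\gamma\in\Sigma^q}\mapsto\left(\sum_{\alpha\in\Sigma^d,\ \gamma,\tau\preceq\alpha}w(\alpha)\,\iota_{\alpha,\tau}(\rho_{\gamma,\alpha}(u_\gamma)\lrcorner\Lambda_\alpha)\right)_{\tau\in\Sigma^{d-q}}$; for $q=0$ it is $u\mapsto(\rho_{v,\alpha}(u)\lrcorner w(\alpha)\Lambda_\alpha)_{\alpha\in\Sigma^d}$.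 An $R$-balanced $(\Sigma,w)$ satisfies tropical Poincaré duality (TPD) over $R$ if $\frown[\Sigma,w]:H^q(\Sigma,F_R^p)\to H_{d-q}^{BM}(\Sigma,F_{d-p}^R)$ is an isomorphism for all $p,q\in\{0,\dots,d\}$.
   Formalization: In the contraction defining the cap product, the product of the x_i(y_{a(i)}) over shuffles, which is not alternating in the x_i and so ill-defined for p≥2, is replaced by the determinant det(x_i(y_{a(j)})), the standard pairing. *)

theory Defs
  imports
    "HOL-Analysis.Analysis"
    "HOL-Library.Function_Algebras"
    "HOL-Library.Set_Algebras"
    "HOL-Computational_Algebra.Group_Closure"
begin

section \<open>Linear algebra in spaces of functions\<close>

text \<open>
  All vector spaces over a field \<open>'k\<close> below are subspaces of function spaces, with the pointwise
  operations: \<open>pscale\<close> is the scalar multiplication of \<open>'k\<close>-valued functions, and \<open>cscale\<close>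
  that of families of such functions (chains and cochains).
\<close>

definition pscale :: "'k::field \<Rightarrow> ('x \<Rightarrow> 'k) \<Rightarrow> 'x \<Rightarrow> 'k" where
  "pscale c f = (\<lambda>x. c * f x)"

definition cscale :: "'k::field \<Rightarrow> ('i \<Rightarrow> 'x \<Rightarrow> 'k) \<Rightarrow> 'i \<Rightarrow> 'x \<Rightarrow> 'k" where
  "cscale c f = (\<lambda>i. pscale c (f i))"

lemma vector_space_pscale: "vector_space pscale"
  by unfold_locales (auto simp: pscale_def fun_eq_iff algebra_simps)

lemma vector_space_cscale: "vector_space cscale"
  by unfold_locales (auto simp: cscale_def pscale_def fun_eq_iff algebra_simps)

text \<open>The dual of a subspace \<open>U\<close>. Functionals on \<open>U\<close> are extended by \<open>0\<close> (not linearly) outside \<open>U\<close>,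
  so that distinct elements of \<open>dual U\<close> are distinct functionals on \<open>U\<close>.\<close>

definition dual :: "('x \<Rightarrow> 'k::field) set \<Rightarrow> (('x \<Rightarrow> 'k) \<Rightarrow> 'k) set" where
  "dual U = {u. (\<forall>s\<in>U. \<forall>t\<in>U. u (s + t) = u s + u t) \<and>
                (\<forall>c. \<forall>t\<in>U. u (pscale c t) = c * u t) \<and>
                (\<forall>t. t \<notin> U \<longrightarrow> u t = 0)}"

text \<open>The quotient \<open>Z/B\<close> as a set of cosets. On it, the sum of two cosets is their Minkowski sum, the
  zero element is \<open>B\<close>, and the multiple of \<open>X\<close> by \<open>c\<close> is \<open>s c ` X + B\<close> (the summand \<open>B\<close> matters only
  if \<open>c = 0\<close>).\<close>

definition quotient_space :: "'v::ab_group_add set \<Rightarrow> 'v set \<Rightarrow> 'v set set" where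
  "quotient_space Z B = (\<lambda>z. z +o B) ` Z"

definition quotient_iso ::
  "('k::field \<Rightarrow> 'v::ab_group_add \<Rightarrow> 'v) \<Rightarrow> 'v set \<Rightarrow> 'v set \<Rightarrow>
   ('k \<Rightarrow> 'u::ab_group_add \<Rightarrow> 'u) \<Rightarrow> 'u set \<Rightarrow> 'u set \<Rightarrow> ('v set \<Rightarrow> 'u set) \<Rightarrow> bool" where
  "quotient_iso s Z B s' Z' B' h \<longleftrightarrow>
     bij_betw h (quotient_space Z B) (quotient_space Z' B') \<and>
     (\<forall>X\<in>quotient_space Z B. \<forall>Y\<in>quotient_space Z B. h (X + Y) = h X + h Y) \<and>
     (\<forall>c. \<forall>X\<in>quotient_space Z B. h (s c ` X + B) = s' c ` h X + B')"

text \<open>The map \<open>Z/B \<rightarrow> Z'/B'\<close> induced by \<open>f\<close>. If \<open>f\<close> does not respect the cosets, the value on some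
  coset is a union of several cosets.\<close>

definition induced_map :: "('v \<Rightarrow> 'u::ab_group_add) \<Rightarrow> 'u set \<Rightarrow> 'v set \<Rightarrow> 'u set" where
  "induced_map f B' X = (\<Union>x\<in>X. f x +o B')"

definition euler_char :: "('k::field \<Rightarrow> 'v::ab_group_add \<Rightarrow> 'v) \<Rightarrow> (nat \<Rightarrow> 'v set) \<Rightarrow> nat \<Rightarrow> int" where
  "euler_char s C d = (\<Sum>q\<le>d. (-1) ^ q * int (vector_space.dim s (C q)))"


section \<open>Extension of scalars from the integers to a field\<close>

text \<open>
  For an additive subgroup \<open>F\<close>, the tensor product of \<open>F\<close> and \<open>'k\<close> over the integers is the free
  vector space on \<open>F\<close> modulo the relations expressing additivity. The linear functionals on this
  quotient are the additive maps \<open>\<phi> : F \<rightarrow> 'k\<close>, and, \<open>'k\<close> being a field, they separate its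
  elements. The quotient is therefore realised as a space of functions of \<open>\<phi>\<close>, the tensor
  of \<open>x\<close> and \<open>c\<close> being \<open>\<phi> \<mapsto> c * \<phi> x\<close>. Lemma \<open>tensor_universal\<close> is its universal property.

  Note that \<open>F \<subseteq> F'\<close> need not make the induced map \<open>tensor_incl F'\<close> injective, so the tensor
  product of \<open>F\<close> is not regarded as a subspace of that of \<open>F'\<close>.
\<close>

definition additive_on :: "'e::plus set \<Rightarrow> ('e \<Rightarrow> 'k::plus) \<Rightarrow> bool" where
  "additive_on F \<phi> \<longleftrightarrow> (\<forall>x\<in>F. \<forall>y\<in>F. \<phi> (x + y) = \<phi> x + \<phi> y)"

definition tens :: "'e::ab_group_add set \<Rightarrow> 'e \<Rightarrow> 'k::field \<Rightarrow> ('e \<Rightarrow> 'k) \<Rightarrow> 'k" where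
  "tens F x c = (\<lambda>\<phi>. if additive_on F \<phi> then c * \<phi> x else 0)"

definition tensor :: "'e::ab_group_add set \<Rightarrow> (('e \<Rightarrow> 'k::field) \<Rightarrow> 'k) set" where
  "tensor F = module.span pscale {tens F x c |x c. x \<in> F}"

definition tensor_incl ::
  "'e::ab_group_add set \<Rightarrow> (('e \<Rightarrow> 'k::field) \<Rightarrow> 'k) \<Rightarrow> ('e \<Rightarrow> 'k) \<Rightarrow> 'k" where
  "tensor_incl F' t = (\<lambda>\<phi>. if additive_on F' \<phi> then t \<phi> else 0)"

lemma tensor_incl_tens:
  assumes "F \<subseteq> F'"
  shows "tensor_incl F' (tens F x c) = tens F' x c"
  using assms by (auto simp: tensor_incl_def tens_def additive_on_def fun_eq_iff)

lemma tensor_universal: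
  fixes F :: "'e::ab_group_add set" and s :: "'k::field \<Rightarrow> 'v::ab_group_add \<Rightarrow> 'v"
  assumes "vector_space s" and f: "additive_on F f"
  shows "\<exists>h. Vector_Spaces.linear pscale s h \<and> (\<forall>x\<in>F. \<forall>c. h (tens F x c) = s c (f x))"
    and "\<lbrakk>Vector_Spaces.linear pscale s h; Vector_Spaces.linear pscale s h';
          \<forall>x\<in>F. \<forall>c. h (tens F x c) = h' (tens F x c); t \<in> tensor F\<rbrakk> \<Longrightarrow> h t = h' t"
proof -
  interpret A: vector_space_pair pscale s
    using assms(1) vector_space_pscale by (simp add: vector_space_pair_def)
  interpret K: vector_space "(*) :: 'k \<Rightarrow> 'k \<Rightarrow> 'k"
    by unfold_locales (auto simp: algebra_simps)
  interpret VK: vector_space_pair s "(*) :: 'k \<Rightarrow> 'k \<Rightarrow> 'k" ..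
  interpret TK: vector_space_pair "pscale :: 'k \<Rightarrow> (('e \<Rightarrow> 'k) \<Rightarrow> 'k) \<Rightarrow> _" "(*) :: 'k \<Rightarrow> 'k \<Rightarrow> 'k" ..
  let ?G = "{tens F x c |x c. x \<in> F}"
  show "h t = h' t"
    if "Vector_Spaces.linear pscale s h" "Vector_Spaces.linear pscale s h'"
       "\<forall>x\<in>F. \<forall>c. h (tens F x c) = h' (tens F x c)" "t \<in> tensor F"
    using A.linear_eq_on[OF that(1,2), of t ?G] that(3,4) by (auto simp: tensor_def)
  obtain B where B: "B \<subseteq> ?G" "A.vs1.independent B" "?G \<subseteq> A.vs1.span B"
    using A.vs1.maximal_independent_subset[of ?G] by blast
  have "\<forall>b\<in>B. \<exists>y. fst y \<in> F \<and> b = tens F (fst y) (snd y)"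
    using B(1) by fastforce
  then obtain y where y: "\<And>b. b \<in> B \<Longrightarrow> fst (y b) \<in> F \<and> b = tens F (fst (y b)) (snd (y b))"
    by metis
  define h where "h = A.construct B (\<lambda>b. s (snd (y b)) (f (fst (y b))))"
  have h: "Vector_Spaces.linear pscale s h"
    unfolding h_def by (rule A.linear_construct[OF B(2)])
  have "h (tens F x c) = s c (f x)" if x: "x \<in> F" for x c
  proof (rule ccontr)
    define v where "v = h (tens F x c) - s c (f x)"
    assume "h (tens F x c) \<noteq> s c (f x)"
    then have "v \<noteq> 0" by (simp add: v_def)
    then have ind: "A.vs2.independent {v}" by simp
    define l where "l = VK.construct {v} (\<lambda>_. 1)"
    have l: "Vector_Spaces.linear s (*) l"
      unfolding l_def by (rule VK.linear_construct[OF ind])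
    have lv: "l v = 1"
      unfolding l_def by (rule VK.construct_basis[OF ind]) simp
    interpret l: Vector_Spaces.linear s "(*)" l by (rule l)
    define \<phi> where "\<phi> = l \<circ> f"
    have \<phi>: "additive_on F \<phi>"
      using f by (simp add: additive_on_def \<phi>_def l.add)
    have ev: "Vector_Spaces.linear pscale (*) (\<lambda>t. t \<phi>)"
      by unfold_locales (auto simp: pscale_def algebra_simps)
    have lh: "Vector_Spaces.linear pscale (*) (\<lambda>t. l (h t))"
      using Vector_Spaces.linear_compose[OF h l] by (simp add: o_def)
    have "l (h (tens F x c)) = tens F x c \<phi>"
    proof (rule TK.linear_eq_on[OF lh ev, of _ B])
      show "tens F x c \<in> A.vs1.span B" using B(3) x by blast
      fix b assume b: "b \<in> B"
      have "h b = s (snd (y b)) (f (fst (y b)))"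
        unfolding h_def by (rule A.construct_basis[OF B(2) b])
      moreover have "b \<phi> = snd (y b) * \<phi> (fst (y b))"
        using y[OF b] \<phi> by (metis tens_def)
      ultimately show "l (h b) = b \<phi>"
        by (simp add: l.scale \<phi>_def)
    qed
    then have "l v = 0"
      using \<phi> by (simp add: v_def l.diff l.scale tens_def \<phi>_def)
    with lv show False by simp
  qed
  with h show "\<exists>h. Vector_Spaces.linear pscale s h \<and> (\<forall>x\<in>F. \<forall>c. h (tens F x c) = s c (f x))"
    by blast
qed


section \<open>Exterior powers\<close>

text \<open>
  The exterior powers of a lattice in a Euclidean space embed into alternating functions of
  vectors: \<open>wedge [x\<^sub>1,\<dots>,x\<^sub>p]\<close> maps \<open>[y\<^sub>1,\<dots>,y\<^sub>p]\<close> to the determinant of the matrix of inner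
  products \<open>x\<^sub>i \<bullet> y\<^sub>j\<close>, and lists of any other length to \<open>0\<close>.
\<close>

type_synonym 'a mvec = "'a list \<Rightarrow> real"

definition wedge :: "'a::euclidean_space list \<Rightarrow> 'a mvec" where
  "wedge xs = (\<lambda>ys. if length ys = length xs
     then \<Sum>\<pi> | \<pi> permutes {..<length xs}.
            of_int (sign \<pi>) * (\<Prod>i<length xs. xs ! i \<bullet> ys ! \<pi> i)
     else 0)"

definition ext_power :: "nat \<Rightarrow> 'a::euclidean_space set \<Rightarrow> 'a mvec set" where
  "ext_power p M = group_closure {wedge xs |xs. set xs \<subseteq> M \<and> length xs = p}"


section \<open>Fans\<close>

text \<open>The lattice \<open>N\<close> may have any rank, including \<open>0\<close>, and \<open>N\<^sub>\<real>\<close> is its real span.\<close>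

definition is_lattice :: "'a::euclidean_space set \<Rightarrow> bool" where
  "is_lattice N \<longleftrightarrow> (\<exists>B. independent B \<and> N = group_closure B)"

definition rational_cone :: "'a::euclidean_space set \<Rightarrow> 'a set \<Rightarrow> bool" where
  "rational_cone N \<sigma> \<longleftrightarrow>
     (\<exists>S. finite S \<and> S \<subseteq> N \<and> \<sigma> = convex_cone hull S) \<and> \<sigma> \<inter> uminus ` \<sigma> = {0}"

text \<open>In the library, the empty set is a face of every convex set; it is not a face of a cone here.\<close>

definition fan :: "'a::euclidean_space set \<Rightarrow> 'a set set \<Rightarrow> bool" where
  "fan N \<Sigma> \<longleftrightarrow>
     finite \<Sigma> \<and> \<Sigma> \<noteq> {} \<and>
     (\<forall>\<sigma>\<in>\<Sigma>. rational_cone N \<sigma>) \<and>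
     (\<forall>\<sigma>\<in>\<Sigma>. \<forall>\<tau>. \<tau> face_of \<sigma> \<and> \<tau> \<noteq> {} \<longrightarrow> \<tau> \<in> \<Sigma>) \<and>
     (\<forall>\<sigma>\<in>\<Sigma>. \<forall>\<tau>\<in>\<Sigma>. \<sigma> \<inter> \<tau> face_of \<sigma> \<and> \<sigma> \<inter> \<tau> face_of \<tau>)"

definition pure_fan :: "'a::euclidean_space set \<Rightarrow> 'a set set \<Rightarrow> nat \<Rightarrow> bool" where
  "pure_fan N \<Sigma> d \<longleftrightarrow>
     fan N \<Sigma> \<and> (\<forall>\<sigma>\<in>\<Sigma>. (\<forall>\<gamma>\<in>\<Sigma>. \<sigma> face_of \<gamma> \<longrightarrow> \<gamma> = \<sigma>) \<longrightarrow> dim \<sigma> = d)"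

definition cones :: "'a::euclidean_space set set \<Rightarrow> nat \<Rightarrow> 'a set set" where
  "cones \<Sigma> i = {\<sigma>\<in>\<Sigma>. dim \<sigma> = i}"

definition cone_lattice :: "'a::euclidean_space set \<Rightarrow> 'a set \<Rightarrow> 'a set" where
  "cone_lattice N \<sigma> = N \<inter> span \<sigma>"

text \<open>
  The orientation of a cone \<open>\<sigma>\<close> is given by a positively oriented ordered lattice basis \<open>b \<sigma>\<close>; then
  \<open>wedge (b \<sigma>)\<close> is the generator of the top exterior power compatible with the orientation.
\<close>

definition orientation ::
  "'a::euclidean_space set \<Rightarrow> 'a set set \<Rightarrow> ('a set \<Rightarrow> 'a list) \<Rightarrow> bool" where
  "orientation N \<Sigma> b \<longleftrightarrow>
     (\<forall>\<sigma>\<in>\<Sigma>. distinct (b \<sigma>) \<and> independent (set (b \<sigma>)) \<and>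
            group_closure (set (b \<sigma>)) = cone_lattice N \<sigma>)"

text \<open>
  For a facet \<open>\<tau>\<close> of \<open>\<sigma>\<close> the sign is \<open>1\<close> iff an outward pointing vector followed by \<open>b \<tau>\<close> is a
  positively oriented basis of the span of \<open>\<sigma>\<close>. The vector \<open>- u\<close> points outward at \<open>\<tau>\<close>, for any
  \<open>u\<close> in \<open>\<sigma>\<close> not in \<open>\<tau>\<close>.
\<close>

definition rel_sign :: "('a::euclidean_space set \<Rightarrow> 'a list) \<Rightarrow> 'a set \<Rightarrow> 'a set \<Rightarrow> int" where
  "rel_sign b \<tau> \<sigma> =
     (if \<exists>u\<in>\<sigma> - \<tau>. \<exists>m>0. wedge ((- u) # b \<tau>) = pscale m (wedge (b \<sigma>)) then 1 else -1)"


section \<open>Tropical homology and cohomology\<close>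

type_synonym ('a, 'k) tvec = "('a mvec \<Rightarrow> 'k) \<Rightarrow> 'k"
type_synonym ('a, 'k) chain = "'a set \<Rightarrow> ('a, 'k) tvec"
type_synonym ('a, 'k) cochain = "'a set \<Rightarrow> ('a, 'k) tvec \<Rightarrow> 'k"

text \<open>\<open>FZ\<close>, \<open>Fk\<close> and \<open>Fk_dual\<close> are \<open>F\<^sub>p\<close> over the integers, \<open>F\<^sub>p\<close> over \<open>'k\<close>, and \<open>F\<^sup>p\<close> over \<open>'k\<close>.\<close>

definition FZ :: "'a::euclidean_space set \<Rightarrow> 'a set set \<Rightarrow> nat \<Rightarrow> 'a set \<Rightarrow> 'a mvec set" where
  "FZ N \<Sigma> p \<sigma> =
     group_closure (\<Union>\<gamma>\<in>{\<gamma>\<in>\<Sigma>. \<sigma> face_of \<gamma>}. ext_power p (cone_lattice N \<gamma>))"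

definition Fk ::
  "'a::euclidean_space set \<Rightarrow> 'a set set \<Rightarrow> nat \<Rightarrow> 'a set \<Rightarrow> ('a, 'k::field) tvec set" where
  "Fk N \<Sigma> p \<sigma> = tensor (FZ N \<Sigma> p \<sigma>)"

definition Fk_dual ::
  "'a::euclidean_space set \<Rightarrow> 'a set set \<Rightarrow> nat \<Rightarrow> 'a set \<Rightarrow> (('a, 'k::field) tvec \<Rightarrow> 'k) set" where
  "Fk_dual N \<Sigma> p \<sigma> = dual (Fk N \<Sigma> p \<sigma>)"

text \<open>The maps \<open>\<iota>\<^bsub>\<sigma>,\<tau>\<^esub>\<close> (which depends on \<open>\<tau>\<close> only through its codomain) and \<open>\<rho>\<^bsub>\<tau>,\<sigma>\<^esub>\<close>.\<close>

definition iota ::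
  "'a::euclidean_space set \<Rightarrow> 'a set set \<Rightarrow> nat \<Rightarrow> 'a set \<Rightarrow> ('a, 'k::field) tvec \<Rightarrow> ('a, 'k) tvec" where
  "iota N \<Sigma> p \<tau> t = tensor_incl (FZ N \<Sigma> p \<tau>) t"

definition rho ::
  "'a::euclidean_space set \<Rightarrow> 'a set set \<Rightarrow> nat \<Rightarrow> 'a set \<Rightarrow> 'a set \<Rightarrow>
   (('a, 'k::field) tvec \<Rightarrow> 'k) \<Rightarrow> ('a, 'k) tvec \<Rightarrow> 'k" where
  "rho N \<Sigma> p \<tau> \<sigma> u = (\<lambda>t. if t \<in> Fk N \<Sigma> p \<sigma> then u (iota N \<Sigma> p \<tau> t) else 0)"

definition BM_chains ::
  "'a::euclidean_space set \<Rightarrow> 'a set set \<Rightarrow> nat \<Rightarrow> nat \<Rightarrow> ('a, 'k::field) chain set" where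
  "BM_chains N \<Sigma> p q =
     {c. (\<forall>\<sigma>\<in>cones \<Sigma> q. c \<sigma> \<in> Fk N \<Sigma> p \<sigma>) \<and> (\<forall>\<sigma>. \<sigma> \<notin> cones \<Sigma> q \<longrightarrow> c \<sigma> = 0)}"

definition BM_boundary ::
  "'a::euclidean_space set \<Rightarrow> 'a set set \<Rightarrow> ('a set \<Rightarrow> 'a list) \<Rightarrow> nat \<Rightarrow>
   ('a, 'k::field) chain \<Rightarrow> ('a, 'k) chain" where
  "BM_boundary N \<Sigma> b p c = (\<lambda>\<tau>. if \<tau> \<in> \<Sigma>
     then \<Sum>\<sigma> | \<sigma> \<in> \<Sigma> \<and> \<tau> face_of \<sigma> \<and> dim \<sigma> = Suc (dim \<tau>).
            pscale (of_int (rel_sign b \<tau> \<sigma>)) (iota N \<Sigma> p \<tau> (c \<sigma>))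
     else 0)"

definition BM_cycles ::
  "'a::euclidean_space set \<Rightarrow> 'a set set \<Rightarrow> ('a set \<Rightarrow> 'a list) \<Rightarrow> nat \<Rightarrow> nat \<Rightarrow>
   ('a, 'k::field) chain set" where
  "BM_cycles N \<Sigma> b p q = {c \<in> BM_chains N \<Sigma> p q. BM_boundary N \<Sigma> b p c = 0}"

definition BM_boundaries ::
  "'a::euclidean_space set \<Rightarrow> 'a set set \<Rightarrow> ('a set \<Rightarrow> 'a list) \<Rightarrow> nat \<Rightarrow> nat \<Rightarrow>
   ('a, 'k::field) chain set" where
  "BM_boundaries N \<Sigma> b p q = BM_boundary N \<Sigma> b p ` BM_chains N \<Sigma> p (Suc q)"

definition BM_homology ::
  "'a::euclidean_space set \<Rightarrow> 'a set set \<Rightarrow> ('a set \<Rightarrow> 'a list) \<Rightarrow> nat \<Rightarrow> nat \<Rightarrow>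
   ('a, 'k::field) chain set set" where
  "BM_homology N \<Sigma> b p q = quotient_space (BM_cycles N \<Sigma> b p q) (BM_boundaries N \<Sigma> b p q)"

definition cochains ::
  "'a::euclidean_space set \<Rightarrow> 'a set set \<Rightarrow> nat \<Rightarrow> nat \<Rightarrow> ('a, 'k::field) cochain set" where
  "cochains N \<Sigma> p q =
     {c. (\<forall>\<sigma>. \<sigma> \<in> cones \<Sigma> q \<and> compact \<sigma> \<longrightarrow> c \<sigma> \<in> Fk_dual N \<Sigma> p \<sigma>) \<and>
         (\<forall>\<sigma>. \<not> (\<sigma> \<in> cones \<Sigma> q \<and> compact \<sigma>) \<longrightarrow> c \<sigma> = 0)}"

definition coboundary ::
  "'a::euclidean_space set \<Rightarrow> 'a set set \<Rightarrow> ('a set \<Rightarrow> 'a list) \<Rightarrow> nat \<Rightarrow>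
   ('a, 'k::field) cochain \<Rightarrow> ('a, 'k) cochain" where
  "coboundary N \<Sigma> b p c = (\<lambda>\<sigma>. if \<sigma> \<in> \<Sigma> \<and> compact \<sigma>
     then \<Sum>\<tau> | \<tau> \<in> \<Sigma> \<and> compact \<tau> \<and> \<tau> face_of \<sigma> \<and> dim \<sigma> = Suc (dim \<tau>).
            pscale (of_int (rel_sign b \<tau> \<sigma>)) (rho N \<Sigma> p \<tau> \<sigma> (c \<tau>))
     else 0)"

definition cocycles ::
  "'a::euclidean_space set \<Rightarrow> 'a set set \<Rightarrow> ('a set \<Rightarrow> 'a list) \<Rightarrow> nat \<Rightarrow> nat \<Rightarrow>
   ('a, 'k::field) cochain set" where
  "cocycles N \<Sigma> b p q = {c \<in> cochains N \<Sigma> p q. coboundary N \<Sigma> b p c = 0}"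

definition coboundaries ::
  "'a::euclidean_space set \<Rightarrow> 'a set set \<Rightarrow> ('a set \<Rightarrow> 'a list) \<Rightarrow> nat \<Rightarrow> nat \<Rightarrow>
   ('a, 'k::field) cochain set" where
  "coboundaries N \<Sigma> b p q =
     (case q of 0 \<Rightarrow> {0} | Suc r \<Rightarrow> coboundary N \<Sigma> b p ` cochains N \<Sigma> p r)"


section \<open>Balancing, cap product and Poincare duality\<close>

text \<open>In a field, the only element excluded as a value of a weight function is \<open>0\<close>.\<close>

definition weight_function :: "'a::euclidean_space set set \<Rightarrow> nat \<Rightarrow> ('a set \<Rightarrow> 'k::field) \<Rightarrow> bool" where
  "weight_function \<Sigma> d w \<longleftrightarrow> (\<forall>\<alpha>\<in>cones \<Sigma> d. w \<alpha> \<noteq> 0)"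

definition fundamental_chain ::
  "'a::euclidean_space set \<Rightarrow> 'a set set \<Rightarrow> ('a set \<Rightarrow> 'a list) \<Rightarrow> nat \<Rightarrow> ('a set \<Rightarrow> 'k::field) \<Rightarrow>
   ('a, 'k) chain" where
  "fundamental_chain N \<Sigma> b d w =
     (\<lambda>\<alpha>. if \<alpha> \<in> cones \<Sigma> d then pscale (w \<alpha>) (tens (FZ N \<Sigma> d \<alpha>) (wedge (b \<alpha>)) 1) else 0)"

definition balanced ::
  "'a::euclidean_space set \<Rightarrow> 'a set set \<Rightarrow> ('a set \<Rightarrow> 'a list) \<Rightarrow> nat \<Rightarrow> ('a set \<Rightarrow> 'k::field) \<Rightarrow>
   bool" where
  "balanced N \<Sigma> b d w \<longleftrightarrow>
     weight_function \<Sigma> d w \<and> fundamental_chain N \<Sigma> b d w \<in> BM_cycles N \<Sigma> b d d"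

text \<open>
  The contraction of \<open>y\<^sub>1 \<and> \<dots> \<and> y\<^sub>m\<close>, for \<open>ys = [y\<^sub>1,\<dots>,y\<^sub>m]\<close> in the lattice of a maximal cone \<open>\<alpha>\<close>, by
  an element \<open>u\<close> of \<open>F\<^sup>p(\<alpha>)\<close>. The dual of the exterior power is identified with the exterior power of
  the dual by the pairing \<open>\<langle>x\<^sub>1 \<and> \<dots> \<and> x\<^sub>p, z\<^sub>1 \<and> \<dots> \<and> z\<^sub>p\<rangle> = det (x\<^sub>i(z\<^sub>j))\<close>. The sum is over shuffles, so
  each subset of \<open>p\<close> of the \<open>y\<^sub>i\<close> occurs once and contributes the whole determinant, not only its
  diagonal product (which would not be alternating in the \<open>x\<^sub>i\<close>).
\<close>

definition contract ::
  "'a::euclidean_space set \<Rightarrow> 'a set set \<Rightarrow> nat \<Rightarrow> 'a set \<Rightarrow> (('a, 'k::field) tvec \<Rightarrow> 'k) \<Rightarrow>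
   'a list \<Rightarrow> ('a, 'k) tvec" where
  "contract N \<Sigma> p \<alpha> u ys = (let m = length ys in
     pscale ((-1) ^ (p * (p - 1) div 2))
       (\<Sum>a | a permutes {..<m} \<and> strict_mono_on {..<p} a \<and> strict_mono_on {p..<m} a.
          tens (FZ N \<Sigma> (m - p) \<alpha>) (wedge (map (\<lambda>i. ys ! a i) [p..<m]))
            (of_int (sign a) * u (tens (FZ N \<Sigma> p \<alpha>) (wedge (map (\<lambda>i. ys ! a i) [0..<p])) 1))))"

definition cap ::
  "'a::euclidean_space set \<Rightarrow> 'a set set \<Rightarrow> ('a set \<Rightarrow> 'a list) \<Rightarrow> nat \<Rightarrow> ('a set \<Rightarrow> 'k::field) \<Rightarrow>
   nat \<Rightarrow> nat \<Rightarrow> ('a, 'k) cochain \<Rightarrow> ('a, 'k) chain" where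
  "cap N \<Sigma> b d w p q u = (\<lambda>\<tau>. if \<tau> \<in> cones \<Sigma> (d - q)
     then \<Sum>\<gamma>\<in>cones \<Sigma> q. \<Sum>\<alpha> | \<alpha> \<in> cones \<Sigma> d \<and> \<gamma> face_of \<alpha> \<and> \<tau> face_of \<alpha>.
            pscale (w \<alpha>) (iota N \<Sigma> (d - p) \<tau> (contract N \<Sigma> p \<alpha> (rho N \<Sigma> p \<gamma> \<alpha> (u \<gamma>)) (b \<alpha>)))
     else 0)"

definition cap_iso ::
  "'a::euclidean_space set \<Rightarrow> 'a set set \<Rightarrow> ('a set \<Rightarrow> 'a list) \<Rightarrow> nat \<Rightarrow> ('a set \<Rightarrow> 'k::field) \<Rightarrow>
   nat \<Rightarrow> nat \<Rightarrow> bool" where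
  "cap_iso N \<Sigma> b d w p q \<longleftrightarrow>
     quotient_iso
       cscale (cocycles N \<Sigma> b p q) (coboundaries N \<Sigma> b p q)
       cscale (BM_cycles N \<Sigma> b (d - p) (d - q)) (BM_boundaries N \<Sigma> b (d - p) (d - q))
       (induced_map (cap N \<Sigma> b d w p q) (BM_boundaries N \<Sigma> b (d - p) (d - q)))"

definition tropical_Poincare_duality ::
  "'a::euclidean_space set \<Rightarrow> 'a set set \<Rightarrow> ('a set \<Rightarrow> 'a list) \<Rightarrow> nat \<Rightarrow> ('a set \<Rightarrow> 'k::field) \<Rightarrow>
   bool" where
  "tropical_Poincare_duality N \<Sigma> b d w \<longleftrightarrow> (\<forall>p\<le>d. \<forall>q\<le>d. cap_iso N \<Sigma> b d w p q)"

end

theory Submission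
  imports Defs
begin

text \<open>
  In positive degree \<open>q\<close> both sides of the cap product vanish: a nonzero cone is not compact, so
  \<open>C\<^sup>q = 0\<close>, and \<open>H\<^sub>d\<^sub>-\<^sub>q\<close> vanishes by hypothesis. Everything is therefore about the map
  from \<open>F\<^sup>p(v)\<close> to \<open>H\<^sub>d\<close> with coefficients in \<open>F\<^sub>d\<^sub>-\<^sub>p\<close> that sends \<open>u\<close> to the family of contractions of
  \<open>w(\<alpha>) \<Lambda>\<^sub>\<alpha>\<close> by \<open>u\<close>. Its target is the space of cycles of degree \<open>d\<close>, there being no chains of degree
  \<open>d + 1\<close>.

  This map is always injective (\<open>cap_0_injective\<close>). The contraction of the generator of the top
  exterior power of \<open>L(\<alpha>)\<close> determines \<open>u\<close> on the \<open>p\<close>-th exterior power of \<open>L(\<alpha>)\<close>, and the exterior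
  powers of the \<open>L(\<alpha>)\<close>, for \<open>\<alpha>\<close> maximal, generate \<open>F\<^sub>p(v)\<close>. So it is an isomorphism iff the two finite
  dimensions agree. As the complex is exact below degree \<open>d\<close>, its Euler characteristic is, up to the
  sign \<open>(-1)\<^sup>d\<close>, the dimension of the space of cycles of degree \<open>d\<close> (\<open>dim_top_cycles\<close>).

  Two facts about the complex need an argument. The first is that the boundary squares to zero,
  without which exactness would not relate the dimensions of cycles and boundaries. Between a cone and
  a face of codimension two there are exactly two faces (\<open>diamond_property\<close>), and their relative
  orientation signs cancel (\<open>rel_sign_cancel\<close>).

  The second is that the cap product maps into the cycles (\<open>cap_0_cycle\<close>). Balancing says that a
  combination of the \<open>\<Lambda>\<^sub>\<alpha>\<close> vanishes in \<open>F\<^sub>d(\<tau>) \<otimes> k\<close>, and contraction by \<open>u\<close> has to be well defined on that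
  space. It comes from the comultiplication of the exterior algebra, which is given on wedges by the
  Laplace expansion \<open>wedge_append\<close>. Since the subgroups \<open>F\<^sub>p(\<tau>)\<close> need not be saturated, functionals on
  \<open>F\<^sub>p(\<tau>) \<otimes> k\<close> need not extend to the exterior power of \<open>N\<close>; what is used instead is that the
  tensor product over the integers of \<open>F\<^sub>p(v)\<close> and \<open>F\<^sub>d\<^sub>-\<^sub>p(\<tau>)\<close> embeds into the functions of two lists of
  vectors (\<open>tensor_pairing_vanishes\<close>).
\<close>

section \<open>Wedge products as determinants\<close>

text \<open>A determinant does not change under transposition.\<close>

lemma wedge_commute:
  fixes xs ys :: "'a::euclidean_space list"
  assumes "length xs = length ys"
  shows "wedge xs ys = wedge ys xs"
proof -
  let ?n = "length ys"
  let ?P = "{\<pi>. \<pi> permutes {..<?n}}"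
  have "wedge xs ys = (\<Sum>\<pi>\<in>?P. of_int (sign \<pi>) * (\<Prod>i<?n. xs ! i \<bullet> ys ! \<pi> i))"
    using assms by (simp add: wedge_def)
  also have "\<dots> = (\<Sum>\<pi>\<in>?P. of_int (sign (inv \<pi>)) * (\<Prod>i<?n. xs ! i \<bullet> ys ! inv \<pi> i))"
    by (rule sum_permutations_inverse)
  also have "\<dots> = (\<Sum>\<pi>\<in>?P. of_int (sign \<pi>) * (\<Prod>i<?n. ys ! i \<bullet> xs ! \<pi> i))"
  proof (rule sum.cong[OF refl])
    fix \<pi> assume "\<pi> \<in> ?P"
    then have \<pi>: "\<pi> permutes {..<?n}" by simp
    have "(\<Prod>i<?n. xs ! i \<bullet> ys ! inv \<pi> i) = (\<Prod>i<?n. xs ! \<pi> i \<bullet> ys ! inv \<pi> (\<pi> i))"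
      using prod.permute[OF \<pi>, of "\<lambda>i. xs ! i \<bullet> ys ! inv \<pi> i"] by (simp add: o_def)
    also have "\<dots> = (\<Prod>i<?n. ys ! i \<bullet> xs ! \<pi> i)"
      using permutes_inverses[OF \<pi>] by (simp add: inner_commute)
    finally show "of_int (sign (inv \<pi>)) * (\<Prod>i<?n. xs ! i \<bullet> ys ! inv \<pi> i) =
        (of_int (sign \<pi>) * (\<Prod>i<?n. ys ! i \<bullet> xs ! \<pi> i) :: real)"
      using \<pi> by (simp add: sign_inverse permutes_imp_permutation[OF finite_lessThan])
  qed
  also have "\<dots> = wedge ys xs"
    using assms by (simp add: wedge_def)
  finally show ?thesis .
qed

lemma wedge_eq_0_if_length: "length ys \<noteq> length xs \<Longrightarrow> wedge xs ys = 0"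
  by (simp add: wedge_def)

lemma wedge_permute_list:
  assumes \<rho>: "\<rho> permutes {..<length xs}"
  shows "wedge (permute_list \<rho> xs) = pscale (of_int (sign \<rho>)) (wedge xs)"
proof
  fix ys :: "'a list"
  show "wedge (permute_list \<rho> xs) ys = pscale (of_int (sign \<rho>)) (wedge xs) ys"
  proof (cases "length ys = length xs")
    case True
    let ?n = "length xs"
    let ?P = "{\<pi>. \<pi> permutes {..<?n}}"
    have pr: "permutation \<rho>" using \<rho> permutes_imp_permutation by blast
    have "wedge (permute_list \<rho> xs) ys =
        (\<Sum>\<pi>\<in>?P. of_int (sign \<pi>) * (\<Prod>i<?n. permute_list \<rho> xs ! i \<bullet> ys ! \<pi> i))"
      using True by (simp add: wedge_def)
    also have "\<dots> = (\<Sum>\<pi>\<in>?P. of_int (sign (\<pi> \<circ> \<rho>)) * (\<Prod>i<?n. permute_list \<rho> xs ! i \<bullet> ys ! (\<pi> \<circ> \<rho>) i))"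
      by (rule sum_permutations_compose_right[OF \<rho>])
    also have "\<dots> = (\<Sum>\<pi>\<in>?P. of_int (sign \<rho>) * (of_int (sign \<pi>) * (\<Prod>i<?n. xs ! i \<bullet> ys ! \<pi> i)))"
    proof (rule sum.cong[OF refl])
      fix \<pi> assume "\<pi> \<in> ?P"
      then have \<pi>: "permutation \<pi>" using permutes_imp_permutation by blast
      have "(\<Prod>i<?n. permute_list \<rho> xs ! i \<bullet> ys ! (\<pi> \<circ> \<rho>) i) = (\<Prod>i<?n. xs ! \<rho> i \<bullet> ys ! \<pi> (\<rho> i))"
        by (rule prod.cong) (auto simp: permute_list_nth[OF \<rho>])
      also have "\<dots> = (\<Prod>i<?n. xs ! i \<bullet> ys ! \<pi> i)"
        using prod.permute[OF \<rho>, of "\<lambda>i. xs ! i \<bullet> ys ! \<pi> i"] by (simp add: o_def)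
      finally show "of_int (sign (\<pi> \<circ> \<rho>)) * (\<Prod>i<?n. permute_list \<rho> xs ! i \<bullet> ys ! (\<pi> \<circ> \<rho>) i) =
          of_int (sign \<rho>) * (of_int (sign \<pi>) * (\<Prod>i<?n. xs ! i \<bullet> ys ! \<pi> i))"
        by (simp add: sign_compose[OF \<pi> pr])
    qed
    also have "\<dots> = pscale (of_int (sign \<rho>)) (wedge xs) ys"
      using True by (simp add: wedge_def pscale_def sum_distrib_left)
    finally show ?thesis .
  qed (simp add: wedge_def pscale_def)
qed

lemma wedge_not_distinct:
  assumes "\<not> distinct xs"
  shows "wedge xs = 0"
proof -
  obtain i j where ij: "i < length xs" "j < length xs" "i \<noteq> j" "xs ! i = xs ! j"
    using assms by (auto simp: distinct_conv_nth)
  let ?t = "Transposition.transpose i j"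
  have t: "?t permutes {..<length xs}"
    using ij by (intro permutes_swap_id) auto
  have "permute_list ?t xs = xs"
    by (rule nth_equalityI) (use ij in \<open>auto simp: permute_list_nth[OF t] Transposition.transpose_def\<close>)
  then have "wedge xs = pscale (- 1) (wedge xs)"
    using wedge_permute_list[OF t] ij(3) by (simp add: sign_swap_id)
  then show ?thesis
    by (auto simp: fun_eq_iff pscale_def)
qed

lemma wedge_update:
  assumes "k < length xs" "length ys = length xs"
  shows "wedge (xs[k := u]) ys =
    u \<bullet> (\<Sum>\<pi> | \<pi> permutes {..<length xs}.
          (of_int (sign \<pi>) * (\<Prod>i\<in>{..<length xs} - {k}. xs ! i \<bullet> ys ! \<pi> i)) *\<^sub>R ys ! \<pi> k)"
proof -
  have "(\<Prod>i<length xs. xs[k := u] ! i \<bullet> ys ! \<pi> i) =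
      (u \<bullet> ys ! \<pi> k) * (\<Prod>i\<in>{..<length xs} - {k}. xs ! i \<bullet> ys ! \<pi> i)" for \<pi>
    by (subst prod.remove[of _ k]) (use assms in \<open>auto intro!: prod.cong\<close>)
  then show ?thesis
    using assms(2) by (simp add: wedge_def inner_sum_right algebra_simps)
qed

lemma wedge_update_linear:
  assumes "k < length xs"
  shows "linear (\<lambda>u. wedge (xs[k := u]) ys)"
proof (cases "length ys = length xs")
  case True
  then show ?thesis
    by (simp add: wedge_update[OF assms True] linearI inner_add_left)
qed (simp add: wedge_def linear_zero)

lemma wedge_Cons_linear: "linear (\<lambda>u. wedge (u # xs) ys)"
  using wedge_update_linear[of 0 "0 # xs" ys] by simp

text \<open>
  A property that is linear in each entry of a list passes from lists of elements of \<open>B\<close> to lists of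
  elements of its span, since the entries can be replaced one after the other.
\<close>

lemma multilinear_induct:
  fixes Q :: "'a::real_vector list \<Rightarrow> bool"
  assumes basis: "\<And>xs. length xs = p \<Longrightarrow> set xs \<subseteq> B \<Longrightarrow> Q xs"
    and slot: "\<And>xs k. length xs = p \<Longrightarrow> k < p \<Longrightarrow> subspace {u. Q (xs[k := u])}"
    and xs: "length xs = p" "set xs \<subseteq> span B"
  shows "Q xs"
proof -
  have "Q xs" if "k \<le> p" "length xs = p" "set (take k xs) \<subseteq> span B" "set (drop k xs) \<subseteq> B" for k xs
    using that
  proof (induction k arbitrary: xs)
    case 0
    then show ?case using basis by simp
  next
    case (Suc k)
    have k: "k < length xs" using Suc by simp
    have tk: "take (Suc k) xs = take k xs @ [xs ! k]"
      using k by (rule take_Suc_conv_app_nth)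
    have "Q (xs[k := u])" if "u \<in> B" for u
    proof (rule Suc.IH)
      show "set (drop k (xs[k := u])) \<subseteq> B"
        using Suc.prems k that by (simp add: Cons_nth_drop_Suc[symmetric])
      show "set (take k (xs[k := u])) \<subseteq> span B"
        using Suc.prems(3) tk by simp
    qed (use Suc in auto)
    then have "span B \<subseteq> {u. Q (xs[k := u])}"
      using slot[of xs k] Suc.prems by (intro span_minimal) auto
    moreover have "xs ! k \<in> span B" using Suc.prems tk by simp
    ultimately show ?case by fastforce
  qed
  from this[of p xs] xs show ?thesis by simp
qed

section \<open>Dual bases and shuffles\<close>

text \<open>
  Evaluating a multivector on the sublists of \<open>ds\<close> gives its coordinates with respect to the wedges of
  sublists of \<open>bs\<close>.
\<close>

definition dual_lists :: "'a::euclidean_space list \<Rightarrow> 'a list \<Rightarrow> bool" where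
  "dual_lists bs ds \<longleftrightarrow> length ds = length bs \<and>
     (\<forall>i<length bs. \<forall>j<length bs. bs ! i \<bullet> ds ! j = (if i = j then 1 else 0))"

lemma dual_lists_exist:
  fixes bs :: "'a::euclidean_space list"
  assumes "distinct bs" "independent (set bs)"
  obtains ds where "dual_lists bs ds"
proof -
  have "\<exists>d. \<forall>c\<in>set bs. c \<bullet> d = (if c = b then 1 else 0)" for b
  proof -
    obtain g :: "'a \<Rightarrow> real" where g: "linear g" "\<forall>c\<in>set bs. g c = (if c = b then 1 else 0)"
      using linear_independent_extend[OF assms(2), of "\<lambda>c. if c = b then 1 else 0"] by blast
    have "c \<bullet> adjoint g 1 = g c" for c
      using adjoint_works[OF g(1), of c 1] by (simp add: inner_commute)
    with g(2) show ?thesis by metis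
  qed
  then obtain d where d: "\<And>b c. c \<in> set bs \<Longrightarrow> c \<bullet> d b = (if c = b then 1 else 0)"
    by metis
  have "dual_lists bs (map d bs)"
    using assms(1) by (auto simp: dual_lists_def d nth_eq_iff_index_eq)
  then show ?thesis by (rule that)
qed

text \<open>
  These permutations index the terms of a contraction. Each stands for the \<open>p\<close>-element subset
  \<open>a ` {..<p}\<close> of \<open>{..<m}\<close>, by \<open>shuffle_perms_exists\<close> and \<open>shuffle_perms_unique\<close>.
\<close>

definition shuffle_perms :: "nat \<Rightarrow> nat \<Rightarrow> (nat \<Rightarrow> nat) set" where
  "shuffle_perms p m =
     {a. a permutes {..<m} \<and> strict_mono_on {..<p} a \<and> strict_mono_on {p..<m} a}"

lemma finite_shuffle_perms [simp]: "finite (shuffle_perms p m)"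
  by (rule finite_subset[OF _ finite_permutations[of "{..<m}"]]) (auto simp: shuffle_perms_def)

lemma shuffle_perms_exists:
  assumes A: "A \<subseteq> {..<m}" "card A = p"
  obtains a where "a \<in> shuffle_perms p m" "a ` {..<p} = A"
proof -
  let ?C = "{..<m} - A"
  have fin: "finite A" "finite ?C" using A finite_subset by auto
  have pm: "p \<le> m" using A card_mono[of "{..<m}" A] by simp
  have cC: "card ?C = m - p" using A fin by (simp add: card_Diff_subset)
  define xs where "xs = sorted_list_of_set A @ sorted_list_of_set ?C"
  have len: "length xs = m" and d: "distinct xs" and set: "set xs = {..<m}"
    using A fin pm cC by (auto simp: xs_def)
  define a where "a i = (if i < m then xs ! i else i)" for i
  have "bij_betw ((!) xs) {..<m} {..<m}"
    by (rule bij_betw_nth[OF d]) (simp_all add: len set)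
  moreover have "bij_betw a {..<m} {..<m} \<longleftrightarrow> bij_betw ((!) xs) {..<m} {..<m}"
    by (rule bij_betw_cong) (simp add: a_def)
  ultimately have "bij_betw a {..<m} {..<m}" by simp
  then have perm: "a permutes {..<m}"
    by (rule bij_imp_permutes) (simp add: a_def)
  have first: "a i = sorted_list_of_set A ! i" if "i < p" for i
    using that pm A by (simp add: a_def xs_def nth_append)
  have rest: "a i = sorted_list_of_set ?C ! (i - p)" if "p \<le> i" "i < m" for i
    using that A by (simp add: a_def xs_def nth_append)
  have m1: "strict_mono_on {..<p} a"
  proof (rule strict_mono_onI)
    fix r s assume "r \<in> {..<p}" "s \<in> {..<p}" "r < s"
    then show "a r < a s"
      using first A sorted_wrt_nth_less[OF strict_sorted_list_of_set[of A], of r s] by simp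
  qed
  have m2: "strict_mono_on {p..<m} a"
  proof (rule strict_mono_onI)
    fix r s assume "r \<in> {p..<m}" "s \<in> {p..<m}" "r < s"
    then show "a r < a s"
      using rest cC sorted_wrt_nth_less[OF strict_sorted_list_of_set[of ?C], of "r - p" "s - p"]
      by simp
  qed
  have "a ` {..<p} = set (sorted_list_of_set A)"
    using first A by (auto simp: in_set_conv_nth image_iff) 
  then have "a ` {..<p} = A" using fin by simp
  moreover have "a \<in> shuffle_perms p m"
    using perm m1 m2 by (simp add: shuffle_perms_def)
  ultimately show ?thesis using that by blast
qed

lemma strict_mono_on_image_eq:
  fixes f g :: "nat \<Rightarrow> nat"
  assumes "strict_mono_on {p..<m} f" "strict_mono_on {p..<m} g" "f ` {p..<m} = g ` {p..<m}"
    and "p \<le> i" "i < m"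
  shows "f i = g i"
proof -
  have s: "map f [p..<m] = sorted_list_of_set (f ` {p..<m})" if "strict_mono_on {p..<m} f" for f :: "nat \<Rightarrow> nat"
  proof -
    have "sorted_wrt (<) (map f [p..<m])"
      using strict_mono_onD[OF that] by (auto simp: sorted_wrt_iff_nth_less)
    from strict_sorted_equal[OF strict_sorted_list_of_set this] show ?thesis by simp
  qed
  have "map f [p..<m] ! (i - p) = map g [p..<m] ! (i - p)"
    using s[OF assms(1)] s[OF assms(2)] assms(3) by simp
  then show ?thesis using assms(4,5) by simp
qed

lemma shuffle_perms_unique:
  assumes "a \<in> shuffle_perms p m" "c \<in> shuffle_perms p m" "p \<le> m" "a ` {..<p} = c ` {..<p}"
  shows "a = c"
proof
  fix i
  have perm: "a permutes {..<m}" "c permutes {..<m}"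
    using assms by (auto simp: shuffle_perms_def)
  have e: "{p..<m} = {..<m} - {..<p}" by auto
  have "a ` {p..<m} = a ` {..<m} - a ` {..<p}" "c ` {p..<m} = c ` {..<m} - c ` {..<p}"
    using perm[THEN permutes_inj] by (simp_all only: e image_set_diff)
  then have "a ` {p..<m} = c ` {p..<m}"
    using assms(4) perm by (simp add: permutes_image)
  then have 1: "p \<le> i \<Longrightarrow> i < m \<Longrightarrow> a i = c i"
    using assms by (intro strict_mono_on_image_eq) (auto simp: shuffle_perms_def)
  have 2: "i < p \<Longrightarrow> a i = c i"
    using assms by (intro strict_mono_on_image_eq[of 0 p]) (auto simp: shuffle_perms_def lessThan_atLeast0)
  have 3: "\<not> i < m \<Longrightarrow> a i = c i"
    using perm by (simp add: permutes_not_in)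
  show "a i = c i" using 1 2 3 by force
qed

section \<open>The Laplace and Cauchy-Binet expansions\<close>

abbreviation sel :: "(nat \<Rightarrow> nat) \<Rightarrow> nat \<Rightarrow> nat \<Rightarrow> 'a list \<Rightarrow> 'a list" where
  "sel a l m ys \<equiv> map (\<lambda>i. ys ! a i) [l..<m]"

lemma map_permutation_shift:
  fixes l k :: nat
  defines "sh \<equiv> map_permutation {..<k} (\<lambda>i. l + i)"
  shows "bij_betw sh {\<rho>. \<rho> permutes {..<k}} {\<rho>. \<rho> permutes {l..<l + k}}"
    and "\<rho> permutes {..<k} \<Longrightarrow> sign (sh \<rho>) = sign \<rho>"
    and "i < k \<Longrightarrow> sh \<rho> (l + i) = l + \<rho> i"
proof -
  have b: "bij_betw (\<lambda>i. l + i) {..<k} {l..<l + k}"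
    by (rule bij_betw_byWitness[of _ "\<lambda>i. i - l"]) auto
  have e: "sh \<rho> = (\<lambda>x. if x \<in> {l..<l + k} then l + \<rho> (inv_into {..<k} (\<lambda>i. l + i) x) else x)" for \<rho>
    using b by (auto simp: sh_def map_permutation_def restrict_id_def bij_betw_def fun_eq_iff)
  show "bij_betw sh {\<rho>. \<rho> permutes {..<k}} {\<rho>. \<rho> permutes {l..<l + k}}"
    using bij_betw_permutations[OF b] unfolding e[abs_def] .
  show "\<rho> permutes {..<k} \<Longrightarrow> sign (sh \<rho>) = sign \<rho>"
    unfolding sh_def by (rule sign_map_permutation) auto
  show "i < k \<Longrightarrow> sh \<rho> (l + i) = l + \<rho> i"
    unfolding sh_def by (rule map_permutation_apply) auto
qed

lemma wedge_sel:
  assumes "length ys = k"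
  shows "wedge (sel a l (l + k) xs) ys =
    (\<Sum>\<rho> | \<rho> permutes {l..<l + k}. of_int (sign \<rho>) * (\<Prod>i<k. ys ! i \<bullet> xs ! a (\<rho> (l + i))))"
proof -
  let ?sh = "map_permutation {..<k} (\<lambda>i. l + i)"
  have "wedge (sel a l (l + k) xs) ys = wedge ys (sel a l (l + k) xs)"
    by (rule wedge_commute) (simp add: assms)
  also have "\<dots> = (\<Sum>\<rho> | \<rho> permutes {..<k}.
      of_int (sign (?sh \<rho>)) * (\<Prod>i<k. ys ! i \<bullet> xs ! a (?sh \<rho> (l + i))))"
  proof -
    have "(\<Prod>i<k. ys ! i \<bullet> sel a l (l + k) xs ! \<rho> i) = (\<Prod>i<k. ys ! i \<bullet> xs ! a (?sh \<rho> (l + i)))"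
      if "\<rho> permutes {..<k}" for \<rho>
      using permutes_in_image[OF that] by (intro prod.cong) (simp_all add: map_permutation_shift(3))
    then show ?thesis
      by (simp add: wedge_def assms map_permutation_shift(2))
  qed
  also have "\<dots> = (\<Sum>\<rho> | \<rho> permutes {l..<l + k}.
      of_int (sign \<rho>) * (\<Prod>i<k. ys ! i \<bullet> xs ! a (\<rho> (l + i))))"
    by (rule sum.reindex_bij_betw[OF map_permutation_shift(1)])
  finally show ?thesis .
qed

lemma permutes_compose_range:
  fixes p m :: nat
  assumes "\<rho> permutes {..<p}" "\<rho>' permutes {p..<m}" "p \<le> m"
  shows "(\<rho> \<circ> \<rho>') permutes {..<m}"
    and "i < p \<Longrightarrow> (\<rho> \<circ> \<rho>') i = \<rho> i" and "p \<le> i \<Longrightarrow> (\<rho> \<circ> \<rho>') i = \<rho>' i"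
    and "(\<rho> \<circ> \<rho>') ` {..<p} = {..<p}"
proof -
  show 1: "(\<rho> \<circ> \<rho>') i = \<rho> i" if "i < p" for i
  proof -
    have "\<rho>' i = i" using that by (intro permutes_not_in[OF assms(2)]) auto
    then show ?thesis by simp
  qed
  show "(\<rho> \<circ> \<rho>') i = \<rho>' i" if "p \<le> i"
  proof -
    have "p \<le> \<rho>' i"
      using that permutes_in_image[OF assms(2), of i] permutes_not_in[OF assms(2), of i]
      by (cases "i < m") auto
    then have "\<rho> (\<rho>' i) = \<rho>' i" by (intro permutes_not_in[OF assms(1)]) auto
    then show ?thesis by simp
  qed
  show "(\<rho> \<circ> \<rho>') permutes {..<m}"
  proof (rule permutes_compose)
    show "\<rho> permutes {..<m}" using assms(3) by (intro permutes_subset[OF assms(1)]) auto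
    show "\<rho>' permutes {..<m}" by (intro permutes_subset[OF assms(2)]) auto
  qed
  have "(\<rho> \<circ> \<rho>') ` {..<p} = \<rho> ` {..<p}"
    using 1 by (intro image_cong) auto
  then show "(\<rho> \<circ> \<rho>') ` {..<p} = {..<p}"
    using permutes_image[OF assms(1)] by simp
qed

text \<open>
  The shuffles represent the cosets of the subgroup of permutations preserving \<open>{..<p}\<close>, which is the
  product of the two symmetric groups.
\<close>

lemma shuffle_decomposition:
  assumes "p \<le> m"
  shows "bij_betw (\<lambda>(a, \<rho>, \<rho>'). a \<circ> (\<rho> \<circ> \<rho>'))
    (shuffle_perms p m \<times> {\<rho>. \<rho> permutes {..<p}} \<times> {\<rho>. \<rho> permutes {p..<m}})
    {\<pi>. \<pi> permutes {..<m}}" (is "bij_betw ?f ?D ?R")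
proof (rule bij_betwI')
  fix x y assume x: "x \<in> ?D" and y: "y \<in> ?D"
  obtain a \<rho> \<rho>' where xe: "x = (a, \<rho>, \<rho>')" by (cases x)
  obtain c \<sigma> \<sigma>' where ye: "y = (c, \<sigma>, \<sigma>')" by (cases y)
  note X = permutes_compose_range[of \<rho> p \<rho>' m, OF _ _ assms]
  note Y = permutes_compose_range[of \<sigma> p \<sigma>' m, OF _ _ assms]
  have xy: "a \<in> shuffle_perms p m" "\<rho> permutes {..<p}" "\<rho>' permutes {p..<m}"
    "c \<in> shuffle_perms p m" "\<sigma> permutes {..<p}" "\<sigma>' permutes {p..<m}"
    using x y xe ye by auto
  have "x = y" if eq: "a \<circ> (\<rho> \<circ> \<rho>') = c \<circ> (\<sigma> \<circ> \<sigma>')"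
  proof -
    have "a ` {..<p} = a ` (\<rho> \<circ> \<rho>') ` {..<p}" using X(4) xy by simp
    also have "\<dots> = c ` (\<sigma> \<circ> \<sigma>') ` {..<p}"
      using arg_cong[OF eq, of "\<lambda>f. f ` {..<p}"] by (simp only: image_comp)
    also have "\<dots> = c ` {..<p}" using Y(4) xy by simp
    finally have ac: "a = c" using shuffle_perms_unique xy assms by blast
    then have "inj a" using xy by (auto simp: shuffle_perms_def permutes_inj)
    then have e: "(\<rho> \<circ> \<rho>') i = (\<sigma> \<circ> \<sigma>') i" for i
      using fun_cong[OF eq, of i] ac by (simp add: inj_eq)
    have "\<rho> i = \<sigma> i" for i
      using e[of i] X(2)[of i] Y(2)[of i] xy permutes_not_in[of \<rho> "{..<p}" i] permutes_not_in[of \<sigma> "{..<p}" i]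
      by (cases "i < p") auto
    moreover have "\<rho>' i = \<sigma>' i" for i
      using e[of i] X(3)[of i] Y(3)[of i] xy permutes_not_in[of \<rho>' "{p..<m}" i] permutes_not_in[of \<sigma>' "{p..<m}" i]
      by (cases "p \<le> i") auto
    ultimately show ?thesis using ac xe ye by auto
  qed
  then show "(?f x = ?f y) = (x = y)" using xe ye by auto
next
  fix x assume x: "x \<in> ?D"
  obtain a \<rho> \<rho>' where xe: "x = (a, \<rho>, \<rho>')" by (cases x)
  then have "a permutes {..<m}" "(\<rho> \<circ> \<rho>') permutes {..<m}"
    using x permutes_compose_range(1)[of \<rho> p \<rho>' m, OF _ _ assms] by (auto simp: shuffle_perms_def)
  then show "?f x \<in> ?R" using xe by (auto intro: permutes_compose)
next
  fix \<pi> assume "\<pi> \<in> ?R"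
  then have \<pi>: "\<pi> permutes {..<m}" by simp
  have "\<pi> ` {..<p} \<subseteq> {..<m}" using permutes_image[OF \<pi>] assms by (metis image_mono lessThan_subset_iff)
  moreover have "card (\<pi> ` {..<p}) = p" using permutes_inj_on[OF \<pi>] by (simp add: card_image)
  ultimately obtain a where a: "a \<in> shuffle_perms p m" "a ` {..<p} = \<pi> ` {..<p}"
    by (rule shuffle_perms_exists)
  then have ap: "a permutes {..<m}" by (simp add: shuffle_perms_def)
  \<comment> \<open>\<open>a\<close> and \<open>\<pi>\<close> have the same image of \<open>{..<p}\<close>, so \<open>\<sigma>\<close> preserves \<open>{..<p}\<close> and its complement.\<close>
  define \<sigma> where "\<sigma> = inv a \<circ> \<pi>"
  have \<sigma>: "\<sigma> permutes {..<m}"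
    unfolding \<sigma>_def by (rule permutes_compose[OF \<pi> permutes_inv[OF ap]])
  have \<sigma>p: "\<sigma> ` {..<p} = {..<p}"
    using a(2) permutes_inj[OF ap] by (metis \<sigma>_def image_comp image_inv_f_f)
  have e: "{p..<m} = {..<m} - {..<p}" by auto
  have "\<sigma> ` {p..<m} = \<sigma> ` {..<m} - \<sigma> ` {..<p}"
    unfolding e by (rule image_set_diff) (rule permutes_inj[OF \<sigma>])
  then have \<sigma>q: "\<sigma> ` {p..<m} = {p..<m}"
    by (simp only: \<sigma>p permutes_image[OF \<sigma>] flip: e)
  define \<rho> where "\<rho> i = (if i < p then \<sigma> i else i)" for i
  define \<rho>' where "\<rho>' i = (if i < p then i else \<sigma> i)" for i
  have "\<rho> ` {..<p} = \<sigma> ` {..<p}" "\<rho>' ` {p..<m} = \<sigma> ` {p..<m}"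
    by (auto simp: \<rho>_def \<rho>'_def intro!: image_cong)
  moreover have "inj_on \<rho> {..<p}" "inj_on \<rho>' {p..<m}"
    using permutes_inj_on[OF \<sigma>, of "{..<p}"] permutes_inj_on[OF \<sigma>, of "{p..<m}"]
      inj_on_cong[of "{..<p}" \<rho> \<sigma>] inj_on_cong[of "{p..<m}" \<rho>' \<sigma>]
    by (auto simp: \<rho>_def \<rho>'_def)
  ultimately have b: "bij_betw \<rho> {..<p} {..<p}" "bij_betw \<rho>' {p..<m} {p..<m}"
    by (simp_all only: bij_betw_def \<sigma>p \<sigma>q simp_thms)
  have 1: "\<rho> permutes {..<p}"
    by (rule bij_imp_permutes[OF b(1)]) (simp add: \<rho>_def)
  have 2: "\<rho>' permutes {p..<m}"
  proof (rule bij_imp_permutes[OF b(2)])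
    fix x assume x: "x \<notin> {p..<m}"
    show "\<rho>' x = x"
    proof (cases "x < p")
      case False
      then have "\<sigma> x = x" using x by (intro permutes_not_in[OF \<sigma>]) auto
      then show ?thesis by (simp add: \<rho>'_def)
    qed (simp add: \<rho>'_def)
  qed
  note C = permutes_compose_range[OF 1 2 assms]
  have "\<rho> \<circ> \<rho>' = \<sigma>"
  proof
    fix i show "(\<rho> \<circ> \<rho>') i = \<sigma> i"
      using C(2,3)[of i] by (cases "i < p") (simp_all add: \<rho>_def \<rho>'_def)
  qed
  then have "\<pi> = a \<circ> (\<rho> \<circ> \<rho>')"
    using permutes_inverses[OF ap] by (auto simp: \<sigma>_def)
  then show "\<exists>x\<in>?D. \<pi> = ?f x"
    using a(1) 1 2 by (intro bexI[of _ "(a, \<rho>, \<rho>')"]) auto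
qed

text \<open>
  The Laplace expansion of a determinant along its first \<open>p\<close> columns, obtained by sorting the
  permutations according to \<open>shuffle_decomposition\<close>. As an identity between functions of \<open>ys\<close> and
  \<open>zs\<close> it describes the component of bidegree \<open>(p, m - p)\<close> of the comultiplication.
\<close>

lemma wedge_append:
  assumes "length xs = m" "length ys = p" "length zs = m - p" "p \<le> m"
  shows "wedge xs (ys @ zs) =
    (\<Sum>a\<in>shuffle_perms p m. of_int (sign a) * (wedge (sel a 0 p xs) ys * wedge (sel a p m xs) zs))"
proof -
  let ?P = "{\<rho>. \<rho> permutes {..<p}}" and ?Q = "{\<rho>. \<rho> permutes {p..<m}}"
  let ?s = "\<lambda>\<pi> :: nat \<Rightarrow> nat. of_int (sign \<pi>) :: real"
  define F where "F a \<rho> = (\<Prod>i<p. ys ! i \<bullet> xs ! a (\<rho> i))" for a \<rho> :: "nat \<Rightarrow> nat"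
  define G where "G a \<rho> = (\<Prod>i<m - p. zs ! i \<bullet> xs ! a (\<rho> (p + i)))" for a \<rho> :: "nat \<Rightarrow> nat"
  let ?t = "\<lambda>\<pi>. ?s \<pi> * (\<Prod>i<m. (ys @ zs) ! i \<bullet> xs ! \<pi> i)"
  have "wedge xs (ys @ zs) = wedge (ys @ zs) xs"
    using assms by (intro wedge_commute) simp
  also have "\<dots> = (\<Sum>\<pi> | \<pi> permutes {..<m}. ?t \<pi>)"
    using assms by (simp add: wedge_def)
  also have "\<dots> = (\<Sum>(a, \<rho>, \<rho>') \<in> shuffle_perms p m \<times> ?P \<times> ?Q. ?t (a \<circ> (\<rho> \<circ> \<rho>')))"
    using sum.reindex_bij_betw[OF shuffle_decomposition[OF assms(4)], of ?t, symmetric]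
    by (simp add: case_prod_unfold)
  also have "\<dots> = (\<Sum>(a, \<rho>, \<rho>') \<in> shuffle_perms p m \<times> ?P \<times> ?Q.
      ?s a * ((?s \<rho> * F a \<rho>) * (?s \<rho>' * G a \<rho>')))"
  proof (rule sum.cong[OF refl], clarsimp)
    fix a \<rho> \<rho>' assume a: "a \<in> shuffle_perms p m" and 1: "\<rho> permutes {..<p}" and 2: "\<rho>' permutes {p..<m}"
    note C = permutes_compose_range[OF 1 2 assms(4)]
    have pa: "permutation a" "permutation \<rho>" "permutation \<rho>'"
      using a 1 2 by (auto simp: shuffle_perms_def intro: permutes_imp_permutation[rotated])
    have "(\<Prod>i<m. (ys @ zs) ! i \<bullet> xs ! a (\<rho> (\<rho>' i))) =
        (\<Prod>i<p. (ys @ zs) ! i \<bullet> xs ! a (\<rho> (\<rho>' i))) * (\<Prod>i=p..<m. (ys @ zs) ! i \<bullet> xs ! a (\<rho> (\<rho>' i)))"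
      using prod.atLeastLessThan_concat[of 0 p m "\<lambda>i. (ys @ zs) ! i \<bullet> xs ! a (\<rho> (\<rho>' i))"] assms(4)
      by (simp add: lessThan_atLeast0)
    also have "(\<Prod>i<p. (ys @ zs) ! i \<bullet> xs ! a (\<rho> (\<rho>' i))) = F a \<rho>"
      unfolding F_def using C(2) assms by (intro prod.cong) (auto simp: nth_append)
    also have "(\<Prod>i=p..<m. (ys @ zs) ! i \<bullet> xs ! a (\<rho> (\<rho>' i))) =
        (\<Prod>i=0..<m - p. (ys @ zs) ! (i + p) \<bullet> xs ! a (\<rho> (\<rho>' (i + p))))"
      using prod.shift_bounds_nat_ivl[of _ 0 p "m - p"] assms(4) by simp
    also have "\<dots> = G a \<rho>'"
      unfolding G_def using C(3) assms
      by (intro prod.cong) (auto simp: nth_append add.commute)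
    finally show "?s (a \<circ> (\<rho> \<circ> \<rho>')) * (\<Prod>i<m. (ys @ zs) ! i \<bullet> xs ! a (\<rho> (\<rho>' i))) =
        ?s a * (?s \<rho> * F a \<rho> * (?s \<rho>' * G a \<rho>'))"
      using pa by (simp add: sign_compose permutation_compose)
  qed
  also have "\<dots> = (\<Sum>a\<in>shuffle_perms p m. ?s a * ((\<Sum>\<rho>\<in>?P. ?s \<rho> * F a \<rho>) * (\<Sum>\<rho>\<in>?Q. ?s \<rho> * G a \<rho>)))"
    by (simp only: sum.cartesian_product[symmetric] sum_product) (simp add: sum_distrib_left)
  also have "\<dots> = (\<Sum>a\<in>shuffle_perms p m. ?s a * (wedge (sel a 0 p xs) ys * wedge (sel a p m xs) zs))"
    using wedge_sel[where ys = ys and k = p and l = 0 and xs = xs] wedge_sel[where ys = zs and k = "m - p" and l = p and xs = xs] assms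
    by (simp add: F_def G_def lessThan_atLeast0)
  finally show ?thesis .
qed

lemma wedge_dual_same:
  assumes "dual_lists bs ds" "distinct ns" "set ns \<subseteq> {..<length bs}"
  shows "wedge (map ((!) bs) ns) (map ((!) ds) ns) = 1"
proof -
  let ?k = "length ns"
  have e: "map ((!) bs) ns ! i \<bullet> map ((!) ds) ns ! j = (if i = j then 1 else 0)" if "i < ?k" "j < ?k" for i j
  proof -
    have "ns ! i < length bs" "ns ! j < length bs" using that assms(3) nth_mem by blast+
    then show ?thesis
      using assms(1,2) that by (auto simp: dual_lists_def nth_eq_iff_index_eq)
  qed
  have "(\<Prod>i<?k. map ((!) bs) ns ! i \<bullet> map ((!) ds) ns ! \<pi> i) = (if \<pi> = id then 1 else 0)"
    if \<pi>: "\<pi> permutes {..<?k}" for \<pi>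
  proof (cases "\<pi> = id")
    case False
    then obtain i where i: "\<pi> i \<noteq> i" by (auto simp: fun_eq_iff)
    then have "i < ?k" using \<pi> permutes_not_in by fastforce
    then have "\<exists>i\<in>{..<?k}. map ((!) bs) ns ! i \<bullet> map ((!) ds) ns ! \<pi> i = 0"
      using i e[of i "\<pi> i"] permutes_in_image[OF \<pi>, of i] by (intro bexI[of _ i]) auto
    then show ?thesis using False by (simp add: prod_zero)
  qed (use e in simp)
  then have "wedge (map ((!) bs) ns) (map ((!) ds) ns) =
      (\<Sum>\<pi> | \<pi> permutes {..<?k}. of_int (sign \<pi>) * (if \<pi> = id then 1 else 0))"
    by (simp add: wedge_def)
  also have "\<dots> = (\<Sum>\<pi> | \<pi> permutes {..<?k}. if \<pi> = id then 1 else 0)"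
    by (intro sum.cong) auto
  also have "\<dots> = 1"
    by (simp add: finite_permutations)
  finally show ?thesis .
qed

lemma wedge_dual_diff:
  assumes "dual_lists bs ds" "set ns \<subseteq> {..<length bs}" "set ms \<subseteq> {..<length bs}" "set ns \<noteq> set ms"
  shows "wedge (map ((!) bs) ns) (map ((!) ds) ms) = 0"
proof (cases "length ms = length ns")
  case True
  let ?k = "length ns"
  have "\<exists>i\<in>{..<?k}. map ((!) bs) ns ! i \<bullet> map ((!) ds) ms ! \<pi> i = 0" if \<pi>: "\<pi> permutes {..<?k}" for \<pi>
  proof (rule ccontr)
    assume a: "\<not> ?thesis"
    have "ns ! i = ms ! \<pi> i" if "i < ?k" for i
    proof (rule ccontr)
      assume "ns ! i \<noteq> ms ! \<pi> i"
      moreover have "\<pi> i < ?k" using that permutes_in_image[OF \<pi>] by simp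
      moreover have "ns ! i < length bs" "ms ! \<pi> i < length bs"
        using that assms(2,3) True \<open>\<pi> i < ?k\<close> by (metis lessThan_iff nth_mem subsetD)+
      ultimately have "map ((!) bs) ns ! i \<bullet> map ((!) ds) ms ! \<pi> i = 0"
        using that assms(1) True by (simp add: dual_lists_def)
      then show False using a that by blast
    qed
    then have "(!) ns ` {..<?k} = (!) ms ` \<pi> ` {..<?k}" by (auto simp: image_iff)
    then have "(!) ns ` {..<?k} = (!) ms ` {..<?k}" by (simp only: permutes_image[OF \<pi>])
    then have "set ns = set ms"
      using True by (metis lessThan_atLeast0 list.set_map map_nth set_upt)
    with assms(4) show False by simp
  qed
  then show ?thesis using True by (auto simp: wedge_def prod_zero intro!: sum.neutral)
qed (simp add: wedge_def)

lemma sel_conv_map: "sel a l m ys = map ((!) ys) (map a [l..<m])"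
  by simp

lemma shuffle_index_list:
  assumes "a \<in> shuffle_perms p m" "l \<le> k" "k \<le> m"
  shows "distinct (map a [l..<k])" "set (map a [l..<k]) \<subseteq> {..<m}"
proof -
  have a: "a permutes {..<m}" using assms by (simp add: shuffle_perms_def)
  show "distinct (map a [l..<k])" using permutes_inj_on[OF a] by (simp add: distinct_map)
  show "set (map a [l..<k]) \<subseteq> {..<m}"
  proof
    fix x assume "x \<in> set (map a [l..<k])"
    then obtain i where "i < k" "x = a i" by auto
    then show "x \<in> {..<m}" using permutes_in_image[OF a, of i] assms(3) by simp
  qed
qed

lemma shuffle_index_set_diff:
  assumes "a \<in> shuffle_perms p m" "c \<in> shuffle_perms p m" "p \<le> m" "a \<noteq> c"
  shows "set (map a [0..<p]) \<noteq> set (map c [0..<p])" "set (map a [p..<m]) \<noteq> set (map c [p..<m])"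
proof -
  have e: "{..<p} = {..<m} - {p..<m}" using assms(3) by auto
  have perm: "a permutes {..<m}" "c permutes {..<m}" using assms by (auto simp: shuffle_perms_def)
  have ne: "a ` {..<p} \<noteq> c ` {..<p}" using shuffle_perms_unique[OF assms(1-3)] assms(4) by blast
  then show "set (map a [0..<p]) \<noteq> set (map c [0..<p])" by (simp add: lessThan_atLeast0)
  have "a ` {..<p} = {..<m} - a ` {p..<m}" "c ` {..<p} = {..<m} - c ` {p..<m}"
    using perm[THEN permutes_inj] perm[THEN permutes_image] by (simp_all only: e image_set_diff)
  with ne show "set (map a [p..<m]) \<noteq> set (map c [p..<m])" by auto
qed

lemma wedge_dual_shuffles:
  assumes "dual_lists bs ds" "length bs = m" "p \<le> m"
    and "a \<in> shuffle_perms p m" "c \<in> shuffle_perms p m"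
  shows "wedge (sel a 0 p bs) (sel c 0 p ds) = (if a = c then 1 else 0)"
    and "wedge (sel a p m bs) (sel c p m ds) = (if a = c then 1 else 0)"
proof -
  note I = shuffle_index_list[OF assms(4)] and J = shuffle_index_list[OF assms(5)]
  show "wedge (sel a 0 p bs) (sel c 0 p ds) = (if a = c then 1 else 0)"
    unfolding sel_conv_map
    using wedge_dual_same[OF assms(1) I(1)[of 0 p]] I(2)[of 0 p] J(2)[of 0 p] assms
      wedge_dual_diff[OF assms(1) _ _ shuffle_index_set_diff(1)[OF assms(4,5,3)]] by auto
  show "wedge (sel a p m bs) (sel c p m ds) = (if a = c then 1 else 0)"
    unfolding sel_conv_map
    using wedge_dual_same[OF assms(1) I(1)[of p m]] I(2)[of p m] J(2)[of p m] assms
      wedge_dual_diff[OF assms(1) _ _ shuffle_index_set_diff(2)[OF assms(4,5,3)]] by auto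
qed

lemma sum_fun_apply: "(\<Sum>a\<in>A. f a) x = (\<Sum>a\<in>A. f a x)"
  by (induction A rule: infinite_finite_induct) auto

lemma subspace_linear_eq:
  assumes "linear f" "linear g"
  shows "subspace {u. f u = g u}"
  using linear_0[OF assms(1)] linear_0[OF assms(2)]
  by (auto simp: subspace_def linear_add[OF assms(1)] linear_add[OF assms(2)]
      linear_scale[OF assms(1)] linear_scale[OF assms(2)])

text \<open>
  The Cauchy-Binet formula. Both sides are multilinear in \<open>xs\<close>, so the entries may be taken from \<open>bs\<close>.
  If one is repeated, both sides vanish; otherwise \<open>xs\<close> is a rearrangement of the sublist of \<open>bs\<close>
  given by one shuffle, and that shuffle contributes the only nonzero term.
\<close>

lemma wedge_expansion:
  assumes dual: "dual_lists bs ds" and n: "length bs = n" "p \<le> n"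
    and xs: "length xs = p" "set xs \<subseteq> span (set bs)"
  shows "wedge xs = (\<Sum>a\<in>shuffle_perms p n. pscale (wedge xs (sel a 0 p ds)) (wedge (sel a 0 p bs)))"
proof
  fix zs :: "'a list"
  let ?R = "\<lambda>xs. \<Sum>a\<in>shuffle_perms p n. wedge xs (sel a 0 p ds) * wedge (sel a 0 p bs) zs"
  have "wedge xs zs = ?R xs"
  proof (rule multilinear_induct[where B = "set bs" and p = p and Q = "\<lambda>xs. wedge xs zs = ?R xs", OF _ _ xs])
    fix xs :: "'a list" and k
    assume k: "length xs = p" "k < p"
    have L: "linear (\<lambda>u. wedge (xs[k := u]) ys)" for ys by (rule wedge_update_linear) (use k in simp)
    have "linear (\<lambda>u. ?R (xs[k := u]))"
      by (rule linearI)
        (simp_all add: linear_add[OF L] linear_scale[OF L] distrib_right sum.distrib sum_distrib_left mult.assoc)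
    then show "subspace {u. wedge (xs[k := u]) zs = ?R (xs[k := u])}"
      by (rule subspace_linear_eq[OF L])
  next
    fix xs :: "'a list" assume l: "length xs = p" and sb: "set xs \<subseteq> set bs"
    show "wedge xs zs = ?R xs"
    proof (cases "distinct xs")
      case False
      then show ?thesis by (simp add: wedge_not_distinct)
    next
      case True
      have "\<exists>i<n. x = bs ! i" if "x \<in> set xs" for x using that sb n by (metis in_set_conv_nth subsetD)
      then obtain f where f: "\<And>x. x \<in> set xs \<Longrightarrow> f x < n \<and> x = bs ! f x" by metis
      let ?ns = "map f xs"
      have xe: "xs = map ((!) bs) ?ns" using f by (simp add: map_idI)
      have dn: "distinct ?ns" using True f unfolding distinct_map by (metis inj_onI)
      have "set ?ns \<subseteq> {..<n}" "card (set ?ns) = p" using f l distinct_card[OF dn] by auto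
      then obtain a where a: "a \<in> shuffle_perms p n" "a ` {..<p} = set ?ns"
        by (rule shuffle_perms_exists)
      let ?as = "map a [0..<p]"
      have "set ?ns = set ?as" using a(2) by (simp add: lessThan_atLeast0)
      then have "mset ?ns = mset ?as"
        using dn shuffle_index_list(1)[OF a(1), of 0 p] n set_eq_iff_mset_eq_distinct by blast
      then obtain \<rho> where \<rho>: "\<rho> permutes {..<length ?as}" "permute_list \<rho> ?as = ?ns"
        by (rule mset_eq_permutation)
      have xp: "xs = permute_list \<rho> (sel a 0 p bs)"
        using xe \<rho> permute_list_map[OF \<rho>(1), of "(!) bs"] by (simp add: o_def)
      have w: "wedge xs = pscale (of_int (sign \<rho>)) (wedge (sel a 0 p bs))"
        unfolding xp by (rule wedge_permute_list) (use \<rho> in simp)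
      have "?R xs = (\<Sum>c\<in>shuffle_perms p n. if c = a then wedge xs zs else 0)"
        using wedge_dual_shuffles(1)[OF dual n a(1)] by (intro sum.cong) (auto simp: w pscale_def)
      also have "\<dots> = wedge xs zs" using a(1) by simp
      finally show ?thesis by simp
    qed
  qed
  then show "wedge xs zs = (\<Sum>a\<in>shuffle_perms p n. pscale (wedge xs (sel a 0 p ds)) (wedge (sel a 0 p bs))) zs"
    by (simp add: sum_fun_apply pscale_def)
qed


text \<open>The only shuffle with \<open>p = n\<close> is the identity: the top exterior power is a line.\<close>

lemma wedge_eq_scale:
  assumes "dual_lists bs ds" "length xs = length bs" "set xs \<subseteq> span (set bs)"
  shows "wedge xs = pscale (wedge xs ds) (wedge bs)"
proof -
  let ?n = "length bs"
  have id: "id \<in> shuffle_perms ?n ?n"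
    by (auto simp: shuffle_perms_def strict_mono_on_def permutes_id)
  have "a = id" if "a \<in> shuffle_perms ?n ?n" for a
    using that id permutes_image[of a "{..<?n}"]
    by (intro shuffle_perms_unique[OF that id]) (auto simp: shuffle_perms_def)
  then have "shuffle_perms ?n ?n = {id}" using id by blast
  moreover have "sel id 0 ?n ds = ds" "sel id 0 ?n bs = bs"
    using assms(1) by (auto simp: dual_lists_def intro: nth_equalityI)
  ultimately show ?thesis
    using wedge_expansion[OF assms(1) refl order_refl assms(2,3)] by simp
qed

lemma wedge_dual_lists:
  assumes "dual_lists bs ds"
  shows "wedge bs ds = 1"
proof -
  have "map ((!) bs) [0..<length bs] = bs" "map ((!) ds) [0..<length bs] = ds"
    using assms by (auto simp: dual_lists_def intro: nth_equalityI)
  then show ?thesis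
    using wedge_dual_same[OF assms, of "[0..<length bs]"] by (auto simp: lessThan_atLeast0)
qed

lemma wedge_nonzero:
  assumes "distinct bs" "independent (set bs)"
  shows "wedge bs \<noteq> 0"
proof -
  obtain ds where "dual_lists bs ds" using dual_lists_exist[OF assms] .
  then have "wedge bs ds = 1" by (rule wedge_dual_lists)
  then show ?thesis by auto
qed

text \<open>Expanding along the row \<open>x\<close>, the remaining rows enter only through their wedge.\<close>

lemma wedge_Cons_scale:
  assumes "length xs = length ys" "wedge xs = pscale m (wedge ys)"
  shows "wedge (x # xs) = pscale m (wedge (x # ys))"
proof
  fix zs :: "'a list"
  show "wedge (x # xs) zs = pscale m (wedge (x # ys)) zs"
  proof (cases "length zs = Suc (length ys)")
    case True
    let ?T = "\<lambda>us. \<Sum>a\<in>shuffle_perms 1 (length zs).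
      of_int (sign a) * (wedge (sel a 0 1 zs) [x] * wedge us (sel a 1 (length zs) zs))"
    have e: "wedge (x # us) zs = ?T us" if us: "length us = length ys" for us
    proof -
      have "wedge (x # us) zs = wedge zs ([x] @ us)"
        using True us by (subst wedge_commute) auto
      also have "\<dots> = (\<Sum>a\<in>shuffle_perms 1 (length zs).
          of_int (sign a) * (wedge (sel a 0 1 zs) [x] * wedge (sel a 1 (length zs) zs) us))"
        using True us by (intro wedge_append) auto
      also have "\<dots> = ?T us"
        using True us by (intro sum.cong refl arg_cong2[where f = "(*)"] wedge_commute)
          (auto simp: Suc_le_eq)
      finally show ?thesis .
    qed
    show ?thesis
      by (simp add: e[OF assms(1)] e[OF refl] assms(2) pscale_def sum_distrib_left algebra_simps)
  qed (use assms(1) in \<open>simp add: wedge_def pscale_def\<close>)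
qed

lemma wedge_Cons_swap: "wedge (x # y # zs) = - wedge (y # x # zs)"
proof -
  let ?t = "Transposition.transpose 0 (Suc 0)"
  have t: "?t permutes {..<length (y # x # zs)}"
    by (intro permutes_swap_id) auto
  have "permute_list ?t (y # x # zs) = x # y # zs"
    by (rule nth_equalityI)
      (auto simp: permute_list_nth[OF t] Transposition.transpose_def nth_Cons split: nat.splits)
  then show ?thesis
    using wedge_permute_list[OF t] by (auto simp: sign_swap_id pscale_def fun_eq_iff)
qed

lemma wedge_Cons_in_span:
  assumes "u \<in> span (set bs)"
  shows "wedge (u # bs) = 0"
proof
  fix ys
  have "wedge (u # bs) ys = 0"
    by (rule linear_eq_0_on_span[OF wedge_Cons_linear _ assms]) (simp add: wedge_not_distinct)
  then show "wedge (u # bs) ys = 0 ys" by simp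
qed

section \<open>Faces of polyhedral cones\<close>

lemma face_eq_if_dim_eq:
  fixes \<sigma> :: "'a::euclidean_space set"
  assumes "convex \<sigma>" "\<tau> face_of \<sigma>" "0 \<in> \<tau>" "dim \<sigma> \<le> dim \<tau>"
  shows "\<tau> = \<sigma>"
proof (rule ccontr)
  assume "\<tau> \<noteq> \<sigma>"
  then have "aff_dim \<tau> < aff_dim \<sigma>"
    using face_of_aff_dim_lt assms by blast
  moreover have "0 \<in> \<sigma>" using assms face_of_imp_subset by blast
  ultimately show False
    using assms by (simp add: aff_dim_zero hull_inc)
qed

text \<open>Faces of polyhedra are exposed; the supporting hyperplane passes through the origin because \<open>\<tau>\<close> does.\<close>

lemma face_supporting_functional:
  fixes \<sigma> :: "'a::euclidean_space set"
  assumes "polyhedron \<sigma>" "\<tau> face_of \<sigma>" "0 \<in> \<tau>"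
  obtains h where "\<And>x. x \<in> \<tau> \<Longrightarrow> h \<bullet> x = 0" "\<And>x. x \<in> \<sigma> - \<tau> \<Longrightarrow> h \<bullet> x > 0"
proof -
  have "\<tau> exposed_face_of \<sigma>" using assms exposed_face_of_polyhedron by blast
  then obtain a c where ac: "\<sigma> \<subseteq> {x. a \<bullet> x \<le> c}" "\<tau> = \<sigma> \<inter> {x. a \<bullet> x = c}"
    unfolding exposed_face_of_def by blast
  then have "c = 0" using assms(3) by auto
  show ?thesis
  proof (rule that[of "- a"])
    show "- a \<bullet> x = 0" if "x \<in> \<tau>" for x using that ac \<open>c = 0\<close> by auto
    show "- a \<bullet> x > 0" if "x \<in> \<sigma> - \<tau>" for x
      using that ac \<open>c = 0\<close> by (auto simp: less_le)
  qed
qed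

lemma functional_zero_span:
  fixes h :: "'a::euclidean_space"
  assumes "\<And>x. x \<in> S \<Longrightarrow> h \<bullet> x = 0" "x \<in> span S"
  shows "h \<bullet> x = 0"
  using linear_eq_0_on_span[OF bounded_linear.linear[OF bounded_linear_inner_right] assms] .

lemma intermediate_faces_Int:
  fixes \<sigma> :: "'a::euclidean_space set"
  assumes "convex \<sigma>" "\<rho> face_of \<sigma>" "0 \<in> \<rho>"
    and "\<tau> face_of \<sigma>" "\<rho> \<subseteq> \<tau>" "dim \<tau> = Suc (dim \<rho>)"
    and "\<tau>' face_of \<sigma>" "\<rho> \<subseteq> \<tau>'" "dim \<tau>' = Suc (dim \<rho>)" "\<tau> \<noteq> \<tau>'"
  shows "\<tau> \<inter> \<tau>' = \<rho>"
proof -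
  have f: "\<tau> \<inter> \<tau>' face_of \<sigma>" using assms by (intro face_of_Int)
  have sub: "\<tau> \<subseteq> \<sigma>" "\<tau>' \<subseteq> \<sigma>" using assms face_of_imp_subset by blast+
  have f1: "\<tau> \<inter> \<tau>' face_of \<tau>" using face_of_subset[OF f] sub by blast
  have c: "convex \<tau>" "convex \<tau>'" "convex (\<tau> \<inter> \<tau>')" using assms f face_of_imp_convex by blast+
  have ne: "\<tau> \<inter> \<tau>' \<noteq> \<tau>"
  proof
    assume "\<tau> \<inter> \<tau>' = \<tau>"
    then have s: "\<tau> \<subseteq> \<tau>'" by blast
    then have "\<tau> face_of \<tau>'" using assms(4) face_of_subset sub by blast
    moreover have "0 \<in> \<tau>" using assms(3,5) by blast
    ultimately have "\<tau> = \<tau>'" using face_eq_if_dim_eq[OF c(2)] assms(6,9) by simp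
    with assms show False by simp
  qed
  have "\<not> dim \<tau> \<le> dim (\<tau> \<inter> \<tau>')"
    using face_eq_if_dim_eq[OF c(1) f1] ne assms by blast
  then have d: "dim (\<tau> \<inter> \<tau>') \<le> dim \<rho>" using assms by simp
  have "\<rho> face_of \<tau> \<inter> \<tau>'"
    using face_of_subset[OF assms(2), of "\<tau> \<inter> \<tau>'"] assms sub by blast
  then show ?thesis using face_eq_if_dim_eq[OF c(3) _ assms(3) d] by simp
qed

text \<open>
  Modulo the span of \<open>\<rho>\<close>, the cone \<open>\<sigma>\<close> is a pointed cone in a plane, and such a cone has two rays. There
  are at least two intermediate faces because \<open>\<rho>\<close> is the intersection of the facets of \<open>\<sigma>\<close> that contain
  it. If there were three, choose a vector in each outside \<open>\<rho>\<close>. In the plane, the third is a positive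
  combination of the first two, by the supporting functionals of their faces, whereas the supporting
  functional of the third face is positive on the first two vectors and zero on the third.
\<close>

lemma diamond_property:
  fixes \<sigma> :: "'a::euclidean_space set"
  assumes poly: "polyhedron \<sigma>" and \<rho>: "\<rho> face_of \<sigma>" "0 \<in> \<rho>" and dim: "dim \<sigma> = Suc (Suc (dim \<rho>))"
  obtains \<tau>\<^sub>1 \<tau>\<^sub>2 where "\<tau>\<^sub>1 \<noteq> \<tau>\<^sub>2"
    "{\<tau>. \<tau> face_of \<sigma> \<and> \<rho> face_of \<tau> \<and> dim \<tau> = Suc (dim \<rho>)} = {\<tau>\<^sub>1, \<tau>\<^sub>2}"
proof -
  have conv: "convex \<sigma>" using poly by (rule polyhedron_imp_convex)
  have 0: "0 \<in> \<sigma>" using \<rho> face_of_imp_subset by blast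
  define I where "I = {\<tau>. \<tau> face_of \<sigma> \<and> \<rho> face_of \<tau> \<and> dim \<tau> = Suc (dim \<rho>)}"
  have facet: "F \<in> I" if "F facet_of \<sigma>" "\<rho> \<subseteq> F" for F
  proof -
    have "0 \<in> F" using that \<rho> by blast
    then have "dim F = Suc (dim \<rho>)"
      using that(1) 0 dim by (simp add: facet_of_def aff_dim_zero hull_inc)
    moreover have "\<rho> face_of F"
      using face_of_subset[OF \<rho>(1) that(2)] facet_of_imp_subset[OF that(1)] by blast
    ultimately show ?thesis using that(1) facet_of_imp_face_of by (auto simp: I_def)
  qed
  have I: "\<tau> face_of \<sigma>" "\<rho> face_of \<tau>" "\<rho> \<subseteq> \<tau>" "0 \<in> \<tau>" "dim \<tau> = Suc (dim \<rho>)" if "\<tau> \<in> I" for \<tau>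
    using that \<rho>(2) face_of_imp_subset[of \<rho> \<tau>] by (auto simp: I_def)
  have Int: "\<tau> \<inter> \<tau>' = \<rho>" if "\<tau> \<in> I" "\<tau>' \<in> I" "\<tau> \<noteq> \<tau>'" for \<tau> \<tau>'
    by (rule intermediate_faces_Int[OF conv \<rho> I(1)[OF that(1)] I(3)[OF that(1)] I(5)[OF that(1)]
          I(1)[OF that(2)] I(3)[OF that(2)] I(5)[OF that(2)] that(3)])
  have ne: "\<rho> \<noteq> {}" "\<rho> \<noteq> \<sigma>" using \<rho>(2) dim by auto
  have eq: "\<rho> = \<Inter>{F. F facet_of \<sigma> \<and> \<rho> \<subseteq> F}"
    by (rule face_of_polyhedron[OF poly \<rho>(1) ne])
  obtain F1 where F1: "F1 facet_of \<sigma>" "\<rho> \<subseteq> F1"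
    by (rule face_of_polyhedron_subset_facet[OF poly \<rho>(1) ne])
  have "\<not> F1 \<subseteq> \<rho>" using I(5)[OF facet[OF F1]] dim_subset[of F1 \<rho>] by auto
  then obtain F2 where F2: "F2 facet_of \<sigma>" "\<rho> \<subseteq> F2" "\<not> F1 \<subseteq> F2" using eq by blast
  have F: "F1 \<in> I" "F2 \<in> I" "F1 \<noteq> F2" using facet F1 F2 by auto
  have "F3 = F1 \<or> F3 = F2" if F3: "F3 \<in> I" for F3
  proof (rule ccontr)
    assume "\<not> ?thesis"
    then have ne: "F1 \<noteq> F2" "F1 \<noteq> F3" "F2 \<noteq> F3" using F by auto
    have "\<exists>u. u \<in> \<tau> - \<rho>" if "\<tau> \<in> I" for \<tau>
      using I[OF that] dim_subset[of \<tau> \<rho>] by fastforce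
    then obtain u where u: "\<And>\<tau>. \<tau> \<in> I \<Longrightarrow> u \<tau> \<in> \<tau> - \<rho>" by metis
    have "\<exists>h. (\<forall>x\<in>\<tau>. h \<bullet> x = 0) \<and> (\<forall>x\<in>\<sigma> - \<tau>. h \<bullet> x > 0)" if "\<tau> \<in> I" for \<tau>
      using face_supporting_functional[OF poly I(1)[OF that] I(4)[OF that]] by metis
    then obtain h where h: "\<And>\<tau> x. \<tau> \<in> I \<Longrightarrow> x \<in> \<tau> \<Longrightarrow> h \<tau> \<bullet> x = 0"
      "\<And>\<tau> x. \<tau> \<in> I \<Longrightarrow> x \<in> \<sigma> - \<tau> \<Longrightarrow> h \<tau> \<bullet> x > 0" by metis
    have hu0: "h \<tau> \<bullet> u \<tau> = 0" if "\<tau> \<in> I" for \<tau> using h(1)[OF that] u[OF that] by blast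
    have hu: "h \<tau> \<bullet> u \<tau>' > 0" if "\<tau> \<in> I" "\<tau>' \<in> I" "\<tau> \<noteq> \<tau>'" for \<tau> \<tau>'
    proof -
      have "u \<tau>' \<in> \<sigma> - \<tau>"
        using u[OF that(2)] Int[OF that] face_of_imp_subset[OF I(1)[OF that(2)]] by blast
      then show ?thesis using h(2) that by blast
    qed
    have h\<rho>: "h \<tau> \<bullet> x = 0" if "\<tau> \<in> I" "x \<in> span \<rho>" for \<tau> x
      using functional_zero_span[OF _ that(2)] h(1)[OF that(1)] I(3)[OF that(1)] by blast
    have "u F1 \<notin> span \<rho>" using h\<rho>[of F2] hu[of F2 F1] F by force
    moreover have "u F2 \<notin> span (insert (u F1) \<rho>)"
    proof
      assume "u F2 \<in> span (insert (u F1) \<rho>)"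
      then have "h F1 \<bullet> u F2 = 0"
        using functional_zero_span[of "insert (u F1) \<rho>" "h F1"] hu0 F h(1) I(3) by blast
      then show False using hu[of F1 F2] F by simp
    qed
    ultimately have "dim (insert (u F2) (insert (u F1) \<rho>)) = dim \<sigma>"
      using dim by (simp add: dim_insert)
    moreover have "insert (u F2) (insert (u F1) \<rho>) \<subseteq> \<sigma>"
      using u[OF F(1)] u[OF F(2)] face_of_imp_subset \<rho>(1) I(1)[OF F(1)] I(1)[OF F(2)] by blast
    ultimately have "span (insert (u F2) (insert (u F1) \<rho>)) = span \<sigma>"
      by (intro dim_eq_span) auto
    moreover have "u F3 \<in> \<sigma>" using u[OF F3] I(1)[OF F3] face_of_imp_subset by blast
    ultimately have "u F3 \<in> span (insert (u F2) (insert (u F1) \<rho>))" by (simp add: span_base)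
    then obtain s t where st: "u F3 - s *\<^sub>R u F2 - t *\<^sub>R u F1 \<in> span \<rho>"
      by (auto simp: span_insert)
    have e: "h \<tau> \<bullet> u F3 = s * (h \<tau> \<bullet> u F2) + t * (h \<tau> \<bullet> u F1)" if "\<tau> \<in> I" for \<tau>
      using h\<rho>[OF that st] by (simp add: inner_diff_right)
    \<comment> \<open>\<open>u F3 = s u F2 + t u F1\<close> modulo the span of \<open>\<rho>\<close>, and \<open>h F1\<close>, \<open>h F2\<close> show that \<open>s\<close> and \<open>t\<close> are positive.\<close>
    have "s * (h F1 \<bullet> u F2) > 0" using e[OF F(1)] hu0[OF F(1)] hu[OF F(1) F3] ne by simp
    then have s: "s > 0" using hu[OF F(1,2)] ne by (simp add: zero_less_mult_iff)
    have "t * (h F2 \<bullet> u F1) > 0" using e[OF F(2)] hu0[OF F(2)] hu[OF F(2) F3] ne by simp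
    then have t: "t > 0" using hu[OF F(2,1)] ne by (simp add: zero_less_mult_iff)
    have "s * (h F3 \<bullet> u F2) + t * (h F3 \<bullet> u F1) > 0"
      using s t hu[OF F3 F(1)] hu[OF F3 F(2)] ne by (intro add_pos_pos mult_pos_pos) auto
    then show False using e[OF F3] hu0[OF F3] by simp
  qed
  then have "I = {F1, F2}" using F by blast
  then show ?thesis using that[OF F(3)] by (simp add: I_def)
qed

section \<open>Orientations and relative signs\<close>

lemma span_group_closure: "span (group_closure B) = span (B :: 'a::real_vector set)"
proof
  have "x \<in> span B" if "x \<in> group_closure B" for x
    using that by induction (auto intro: span_base span_0 span_diff)
  then show "span (group_closure B) \<subseteq> span B" by (intro span_minimal) auto
  show "span B \<subseteq> span (group_closure B)"
    by (intro span_mono) (auto intro: group_closure.base)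
qed

lemma rational_cone_facts:
  assumes "rational_cone N \<sigma>"
  shows "polyhedron \<sigma>" "convex_cone \<sigma>" "0 \<in> \<sigma>" "convex \<sigma>" "span (cone_lattice N \<sigma>) = span \<sigma>"
proof -
  obtain S where S: "finite S" "S \<subseteq> N" "\<sigma> = convex_cone hull S"
    using assms by (auto simp: rational_cone_def)
  show "polyhedron \<sigma>" using S polyhedron_convex_cone_hull by blast
  then show "convex \<sigma>" by (rule polyhedron_imp_convex)
  show "convex_cone \<sigma>" using S convex_cone_convex_cone_hull by simp
  then show "0 \<in> \<sigma>" by (rule convex_cone_contains_0)
  have "S \<subseteq> cone_lattice N \<sigma>"
    using S hull_subset[of S convex_cone] by (auto simp: cone_lattice_def intro: span_base)
  moreover have "\<sigma> \<subseteq> span S"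
    unfolding S(3) by (intro hull_minimal span_superset convex_cone_span)
  ultimately have "span \<sigma> \<subseteq> span (cone_lattice N \<sigma>)"
    by (meson span_minimal span_mono subset_trans subspace_span)
  moreover have "span (cone_lattice N \<sigma>) \<subseteq> span \<sigma>"
    by (intro span_minimal) (auto simp: cone_lattice_def)
  ultimately show "span (cone_lattice N \<sigma>) = span \<sigma>" by blast
qed

lemma orientation_basis:
  assumes "fan N \<Sigma>" "orientation N \<Sigma> b" "\<sigma> \<in> \<Sigma>"
  shows "distinct (b \<sigma>)" "independent (set (b \<sigma>))" "span (set (b \<sigma>)) = span \<sigma>"
    "length (b \<sigma>) = dim \<sigma>"
proof -
  show d: "distinct (b \<sigma>)" and i: "independent (set (b \<sigma>))"
    using assms by (auto simp: orientation_def)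
  have "group_closure (set (b \<sigma>)) = cone_lattice N \<sigma>" "rational_cone N \<sigma>"
    using assms by (auto simp: orientation_def fan_def)
  then show s: "span (set (b \<sigma>)) = span \<sigma>"
    using rational_cone_facts(5) span_group_closure by metis
  have "dim \<sigma> = dim (set (b \<sigma>))" using s by (metis dim_span)
  then show "length (b \<sigma>) = dim \<sigma>"
    using dim_eq_card_independent[OF i] distinct_card[OF d] by simp
qed

text \<open>
  The sign is defined through the existence of a suitable \<open>u\<close>, but every \<open>u\<close> in \<open>\<sigma>\<close> outside \<open>\<tau>\<close> detects
  it: modulo the span of \<open>\<tau>\<close> any two of them differ by a positive factor, since the supporting
  functional of \<open>\<tau>\<close> is positive on both.
\<close>

lemma rel_sign_eq:
  assumes "fan N \<Sigma>" "orientation N \<Sigma> b" "\<tau> \<in> \<Sigma>" "\<sigma> \<in> \<Sigma>"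
    and face: "\<tau> face_of \<sigma>" "dim \<sigma> = Suc (dim \<tau>)" and u: "u \<in> \<sigma> - \<tau>"
  obtains m where "m \<noteq> 0" "wedge ((- u) # b \<tau>) = pscale m (wedge (b \<sigma>))"
    "rel_sign b \<tau> \<sigma> = (if m > 0 then 1 else - 1)"
proof -
  note B = orientation_basis[OF assms(1,2)]
  have rc: "rational_cone N \<sigma>" "rational_cone N \<tau>" using assms by (auto simp: fan_def)
  have sub: "\<tau> \<subseteq> \<sigma>" using face face_of_imp_subset by blast
  obtain h where h: "\<And>x. x \<in> \<tau> \<Longrightarrow> h \<bullet> x = 0" "\<And>x. x \<in> \<sigma> - \<tau> \<Longrightarrow> h \<bullet> x > 0"
    by (rule face_supporting_functional[OF rational_cone_facts(1)[OF rc(1)] face(1) rational_cone_facts(3)[OF rc(2)]]) blast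
  have hs: "h \<bullet> x = 0" if "x \<in> span \<tau>" for x using functional_zero_span[OF h(1) that] .
  have u\<tau>: "u \<notin> span \<tau>" using h(2)[OF u] hs by force
  obtain ds where ds: "dual_lists (b \<sigma>) ds" using dual_lists_exist B(1,2) assms(4) by metis
  define m where "m = wedge ((- u) # b \<tau>) ds"
  have "set ((- u) # b \<tau>) \<subseteq> span \<sigma>"
    using u sub B(3)[OF assms(3)] span_mono[OF sub] span_superset[of "set (b \<tau>)"]
    by (auto intro: span_base span_neg)
  then have w: "wedge ((- u) # b \<tau>) = pscale m (wedge (b \<sigma>))"
    unfolding m_def using B(3,4) assms(3,4) face(2) by (intro wedge_eq_scale ds) auto
  have "distinct ((- u) # b \<tau>)"
    using B(1,3)[OF assms(3)] u\<tau> span_base[of "- u" "set (b \<tau>)"] span_neg[of "- u" \<tau>] by auto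
  moreover have "- u \<notin> span (set (b \<tau>))"
    using u\<tau> B(3)[OF assms(3)] span_neg[of "- u" \<tau>] by auto
  then have "independent (set ((- u) # b \<tau>))"
    using B(2)[OF assms(3)] by (simp add: independent_insert)
  ultimately have "wedge ((- u) # b \<tau>) \<noteq> 0" by (rule wedge_nonzero)
  then have m0: "m \<noteq> 0" using w by (auto simp: pscale_def fun_eq_iff)
  have dim: "dim (insert u \<tau>) = dim \<sigma>" using face(2) u\<tau> by (simp add: dim_insert)
  then have span: "span (insert u \<tau>) = span \<sigma>"
    using u sub by (intro dim_eq_span) auto
  \<comment> \<open>If some \<open>u'\<close> shows that the sign is positive, then so does \<open>u\<close>.\<close>
  have pos: "m > 0" if u': "u' \<in> \<sigma> - \<tau>" and m': "m' > 0" "wedge ((- u') # b \<tau>) = pscale m' (wedge (b \<sigma>))" for u' m'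
  proof -
    have "u' \<in> span (insert u \<tau>)" using u' span by (simp add: span_base)
    then obtain t where t: "u' - t *\<^sub>R u \<in> span \<tau>" by (auto simp: span_insert)
    have "h \<bullet> u' = t * (h \<bullet> u)" using hs[OF t] by (simp add: inner_diff_right)
    then have "t > 0" using h(2)[OF u] h(2)[OF u'] by (simp add: zero_less_mult_iff)
    have "wedge ((- u') # b \<tau>) ds = t * m"
    proof -
      have L: "linear (\<lambda>u. wedge (u # b \<tau>) ds)" by (rule wedge_Cons_linear)
      have "- u' = t *\<^sub>R (- u) - (u' - t *\<^sub>R u)" by simp
      then have "wedge ((- u') # b \<tau>) ds = t * m - wedge ((u' - t *\<^sub>R u) # b \<tau>) ds"
        unfolding m_def using linear_diff[OF L] linear_scale[OF L] by (metis real_scaleR_def)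
      also have "wedge ((u' - t *\<^sub>R u) # b \<tau>) = 0"
        using t B(3)[OF assms(3)] by (intro wedge_Cons_in_span) simp
      finally show ?thesis by simp
    qed
    moreover have "wedge ((- u') # b \<tau>) ds = m'"
      using m'(2) wedge_dual_lists[OF ds] by (simp add: pscale_def)
    ultimately show ?thesis using \<open>t > 0\<close> m'(1) by (simp add: zero_less_mult_iff)
  qed
  have "rel_sign b \<tau> \<sigma> = (if m > 0 then 1 else - 1)"
    unfolding rel_sign_def using pos w u by auto
  then show ?thesis using that m0 w by blast
qed

text \<open>
  Choose \<open>u1\<close> in \<open>\<tau>\<^sub>1\<close> and \<open>u2\<close> in \<open>\<tau>\<^sub>2\<close>, both outside \<open>\<rho>\<close>. One product of signs compares \<open>b \<sigma>\<close> with the basis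
  \<open>- u2, - u1, b \<rho>\<close>, the other with \<open>- u1, - u2, b \<rho>\<close>, and a transposition reverses the orientation.
\<close>

lemma rel_sign_cancel:
  assumes "fan N \<Sigma>" "orientation N \<Sigma> b" "\<rho> \<in> \<Sigma>" "\<tau>\<^sub>1 \<in> \<Sigma>" "\<tau>\<^sub>2 \<in> \<Sigma>" "\<sigma> \<in> \<Sigma>"
    and "\<rho> face_of \<tau>\<^sub>1" "\<tau>\<^sub>1 face_of \<sigma>" "\<rho> face_of \<tau>\<^sub>2" "\<tau>\<^sub>2 face_of \<sigma>" "\<tau>\<^sub>1 \<noteq> \<tau>\<^sub>2"
    and dim: "dim \<tau>\<^sub>1 = Suc (dim \<rho>)" "dim \<tau>\<^sub>2 = Suc (dim \<rho>)" "dim \<sigma> = Suc (Suc (dim \<rho>))"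
  shows "rel_sign b \<rho> \<tau>\<^sub>1 * rel_sign b \<tau>\<^sub>1 \<sigma> + rel_sign b \<rho> \<tau>\<^sub>2 * rel_sign b \<tau>\<^sub>2 \<sigma> = 0"
proof -
  note B = orientation_basis[OF assms(1,2)]
  have rc: "rational_cone N \<sigma>" "rational_cone N \<rho>" using assms by (auto simp: fan_def)
  have Int: "\<tau>\<^sub>1 \<inter> \<tau>\<^sub>2 = \<rho>"
    by (rule intermediate_faces_Int[OF rational_cone_facts(4)[OF rc(1)]
          face_of_trans[OF assms(7,8)] rational_cone_facts(3)[OF rc(2)] assms(8)
          face_of_imp_subset[OF assms(7)] dim(1) assms(10) face_of_imp_subset[OF assms(9)] dim(2) assms(11)])
  have "\<not> \<tau>\<^sub>1 \<subseteq> \<rho>" "\<not> \<tau>\<^sub>2 \<subseteq> \<rho>"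
    using dim dim_subset[of \<tau>\<^sub>1 \<rho>] dim_subset[of \<tau>\<^sub>2 \<rho>] by auto
  then obtain u1 u2 where u: "u1 \<in> \<tau>\<^sub>1 - \<rho>" "u2 \<in> \<tau>\<^sub>2 - \<rho>" by blast
  have u': "u2 \<in> \<sigma> - \<tau>\<^sub>1" "u1 \<in> \<sigma> - \<tau>\<^sub>2"
    using u Int face_of_imp_subset assms(8,10) by blast+
  obtain m1 where m1: "m1 \<noteq> 0" "wedge ((- u1) # b \<rho>) = pscale m1 (wedge (b \<tau>\<^sub>1))"
    "rel_sign b \<rho> \<tau>\<^sub>1 = (if m1 > 0 then 1 else - 1)"
    using rel_sign_eq[OF assms(1,2,3,4,7) dim(1) u(1)] .
  obtain m2 where m2: "m2 \<noteq> 0" "wedge ((- u2) # b \<rho>) = pscale m2 (wedge (b \<tau>\<^sub>2))"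
    "rel_sign b \<rho> \<tau>\<^sub>2 = (if m2 > 0 then 1 else - 1)"
    using rel_sign_eq[OF assms(1,2,3,5,9) dim(2) u(2)] .
  obtain n1 where n1: "n1 \<noteq> 0" "wedge ((- u2) # b \<tau>\<^sub>1) = pscale n1 (wedge (b \<sigma>))"
    "rel_sign b \<tau>\<^sub>1 \<sigma> = (if n1 > 0 then 1 else - 1)"
    using rel_sign_eq[OF assms(1,2,4,6,8) _ u'(1)] dim by auto
  obtain n2 where n2: "n2 \<noteq> 0" "wedge ((- u1) # b \<tau>\<^sub>2) = pscale n2 (wedge (b \<sigma>))"
    "rel_sign b \<tau>\<^sub>2 \<sigma> = (if n2 > 0 then 1 else - 1)"
    using rel_sign_eq[OF assms(1,2,5,6,10) _ u'(2)] dim by auto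
  have w1: "wedge ((- u2) # (- u1) # b \<rho>) = pscale (m1 * n1) (wedge (b \<sigma>))"
    using wedge_Cons_scale[OF _ m1(2), of "- u2"] n1(2) B(4) assms(3,4) dim
    by (simp add: pscale_def mult.assoc)
  have w2: "wedge ((- u1) # (- u2) # b \<rho>) = pscale (m2 * n2) (wedge (b \<sigma>))"
    using wedge_Cons_scale[OF _ m2(2), of "- u1"] n2(2) B(4) assms(3,5) dim
    by (simp add: pscale_def mult.assoc)
  obtain ys where "wedge (b \<sigma>) ys \<noteq> 0"
    using wedge_nonzero[OF B(1,2)] assms(6) by (auto simp: fun_eq_iff)
  moreover have "m1 * n1 * wedge (b \<sigma>) ys = - (m2 * n2 * wedge (b \<sigma>) ys)"
    using wedge_Cons_swap[of "- u2" "- u1" "b \<rho>"] w1 w2 by (simp add: pscale_def fun_eq_iff)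
  ultimately have e: "m1 * n1 = - (m2 * n2)"
    by (metis minus_mult_left mult_right_cancel)
  then have "m1 * n1 > 0 \<longleftrightarrow> m2 * n2 < 0" by linarith
  then show ?thesis
    unfolding m1(3) m2(3) n1(3) n2(3) using m1(1) m2(1) n1(1) n2(1)
    by (auto simp: zero_less_mult_iff mult_less_0_iff split: if_splits)
qed

section \<open>Dimension counts\<close>

text \<open>
  Spaces of functions may be infinite dimensional, so the finiteness of a subspace is expressed by a
  finite set whose span contains it.
\<close>

context vector_space
begin

lemma subspace_dim_eq:
  assumes "subspace V" "V \<subseteq> W" "W \<subseteq> span F" "finite F" "dim W \<le> dim V"
  shows "V = W"
proof -
  obtain B where B: "B \<subseteq> V" "independent B" "V \<subseteq> span B" "card B = dim V"
    by (rule basis_exists)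
  obtain C where C: "B \<subseteq> C" "C \<subseteq> W" "independent C" "W \<subseteq> span C"
    by (rule maximal_independent_subset_extend[OF _ B(2), of W]) (use B(1) assms(2) in auto)
  have "finite C"
    using independent_span_bound[OF assms(4) C(3)] C(2) assms(3) by blast
  moreover have "card C = dim W" by (rule basis_card_eq_dim[OF C(2,4,3)])
  ultimately have "B = C" using C(1) B(4) assms(5) by (metis card_seteq)
  then have "W \<subseteq> span V" using C(4) B(1) span_mono by blast
  then show ?thesis using assms(1,2) span_eq_iff by blast
qed

end

lemma dim_image_injective:
  assumes f: "Vector_Spaces.linear s1 s2 f" and V: "module.subspace s1 V" and inj: "inj_on f V"
  shows "vector_space.dim s2 (f ` V) = vector_space.dim s1 V"
proof -
  interpret vector_space_pair s1 s2
    using f by (simp add: Vector_Spaces.linear_def vector_space_pair_def)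
  interpret f: Vector_Spaces.linear s1 s2 f by (rule f)
  obtain B where B: "B \<subseteq> V" "vs1.independent B" "V \<subseteq> vs1.span B" "card B = vs1.dim V"
    by (rule vs1.basis_exists)
  have sp: "vs1.span B = V" using B(1,3) V vs1.span_minimal by blast
  have "vs2.independent (f ` B)"
    using f.independent_injective_image[OF B(2)] inj sp by simp
  moreover have "f ` V = vs2.span (f ` B)" using f.span_image[of B] sp by simp
  moreover have "card (f ` B) = vs1.dim V"
    using B(1,4) inj inj_on_subset card_image by metis
  ultimately show ?thesis using vs2.dim_span_eq_card_independent[of "f ` B"] by metis
qed

text \<open>
  The part of a basis of \<open>U\<close> outside a basis of the kernel spans a subspace that meets the kernel in \<open>0\<close>,
  hence is mapped injectively.
\<close>

lemma rank_nullity_subspace: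
  assumes f: "Vector_Spaces.linear s1 s2 f"
    and U: "module.subspace s1 U" "U \<subseteq> module.span s1 F" "finite F"
  shows "vector_space.dim s1 U = vector_space.dim s1 {x \<in> U. f x = 0} + vector_space.dim s2 (f ` U)"
proof -
  interpret vector_space_pair s1 s2
    using f by (simp add: Vector_Spaces.linear_def vector_space_pair_def)
  interpret f: Vector_Spaces.linear s1 s2 f by (rule f)
  let ?K = "{x \<in> U. f x = 0}"
  obtain B where B: "B \<subseteq> ?K" "vs1.independent B" "?K \<subseteq> vs1.span B" "card B = vs1.dim ?K"
    by (rule vs1.basis_exists)
  obtain C where C: "B \<subseteq> C" "C \<subseteq> U" "vs1.independent C" "U \<subseteq> vs1.span C"
    by (rule vs1.maximal_independent_subset_extend[OF _ B(2), of U]) (use B(1) in auto)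
  have fin: "finite C"
    using vs1.independent_span_bound[OF U(3) C(3)] C(2) U(2) by blast
  have dimU: "card C = vs1.dim U" by (rule vs1.basis_card_eq_dim[OF C(2,4,3)])
  define D where "D = C - B"
  have D: "D \<subseteq> C" "vs1.independent D"
    using C(3) vs1.independent_mono by (auto simp: D_def)
  \<comment> \<open>\<open>x\<close> lies in the spans of the disjoint subsets \<open>B\<close> and \<open>D\<close> of a basis.\<close>
  have "x = 0" if x: "x \<in> vs1.span D" "f x = 0" for x
  proof -
    have "x \<in> U" using x(1) D(1) C(2) U(1) vs1.span_minimal by blast
    then have "x \<in> vs1.span B" using B(3) x(2) by blast
    then have "vs1.representation D x = vs1.representation B x"
      using vs1.representation_extend[OF C(3)] x(1) C(1) D(1) by metis
    then have "vs1.representation D x c = 0" for c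
      using vs1.representation_ne_zero[of D x c] vs1.representation_ne_zero[of B x c]
      by (auto simp: D_def)
    then show ?thesis using vs1.sum_nonzero_representation_eq[OF D(2) x(1)] by simp
  qed
  then have inj: "inj_on f (vs1.span D)"
    using f.inj_on_iff_eq_0[of "vs1.span D"] by auto
  then have ind: "vs2.independent (f ` D)" by (rule f.independent_injective_image[OF D(2)])
  have "f ` C \<subseteq> vs2.span (f ` D)"
  proof
    fix y assume "y \<in> f ` C"
    then obtain c where c: "c \<in> C" "y = f c" by blast
    show "y \<in> vs2.span (f ` D)"
    proof (cases "c \<in> B")
      case True
      then have "y = 0" using B(1) c by auto
      then show ?thesis by (simp add: vs2.span_zero)
    qed (use c in \<open>auto simp: D_def intro: vs2.span_base\<close>)
  qed
  then have "vs2.span (f ` C) \<subseteq> vs2.span (f ` D)" by (intro vs2.span_minimal) auto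
  moreover have "f ` U \<subseteq> vs2.span (f ` C)" using f.span_image[of C] C(4) by auto
  ultimately have "vs2.dim (f ` U) = card (f ` D)"
    using ind D(1) C(2) by (intro vs2.dim_unique[of "f ` D"]) auto
  also have "\<dots> = card D" using inj by (intro card_image inj_on_subset[OF inj] vs1.span_superset)
  finally show ?thesis
    using dimU B(4) fin C(1) finite_subset[OF C(1)] card_mono[OF fin C(1)] by (simp add: D_def card_Diff_subset)
qed

section \<open>Isomorphisms of quotients\<close>

lemma singleton_coset [simp]: "(z::'v::ab_group_add) +o {0} = {z}"
  by (auto simp: elt_set_plus_def)

lemma quotient_space_zero: "quotient_space Z {0} = (\<lambda>z. {z}) ` Z"
  by (simp add: quotient_space_def)

lemma quotient_iso_trivial_boundaries:
  assumes "vector_space s" "vector_space s'" "Vector_Spaces.linear s s' f"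
  shows "quotient_iso s Z {0} s' Z' {0} (induced_map f {0}) \<longleftrightarrow> bij_betw f Z Z'"
proof -
  interpret f: Vector_Spaces.linear s s' f by fact
  have h: "induced_map f {0} {z} = {f z}" for z by (simp add: induced_map_def)
  have "bij_betw (induced_map f {0}) (quotient_space Z {0}) (quotient_space Z' {0}) \<longleftrightarrow> bij_betw f Z Z'"
  proof -
    have "inj_on (induced_map f {0}) ((\<lambda>z. {z}) ` Z) \<longleftrightarrow> inj_on f Z"
      by (auto simp: inj_on_def h)
    moreover have "induced_map f {0} ` (\<lambda>z. {z}) ` Z = (\<lambda>z. {z}) ` f ` Z"
      by (auto simp: h image_iff)
    moreover have "(\<lambda>z. {z}) ` f ` Z = (\<lambda>z. {z}) ` Z' \<longleftrightarrow> f ` Z = Z'"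
      by (rule inj_image_eq_iff) (simp add: inj_def)
    ultimately show ?thesis by (simp add: quotient_space_zero bij_betw_def)
  qed
  then show ?thesis
    unfolding quotient_iso_def quotient_space_zero
    by (auto simp: h set_plus_def f.add f.scale)
qed

lemma quotient_iso_one_coset:
  assumes Z: "quotient_space Z B = {B}" and Z': "quotient_space Z' B' = {B'}"
    and B: "vector_space s" "module.subspace s B" and B': "vector_space s'" "module.subspace s' B'"
    and h: "h B = B'"
  shows "quotient_iso s Z B s' Z' B' h"
proof -
  have sum: "B + B = B" if "vector_space s" "module.subspace s B" for s :: "'k::field \<Rightarrow> 'v::ab_group_add \<Rightarrow> 'v" and B
  proof -
    interpret vector_space s by fact
    show ?thesis
      using that(2) subspace_0[of B] by (force simp: set_plus_def subspace_add)
  qed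
  have mult: "s c ` B + B = B" if "vector_space s" "module.subspace s B" for s :: "'k::field \<Rightarrow> 'v::ab_group_add \<Rightarrow> 'v" and B c
  proof -
    interpret vector_space s by fact
    have "0 \<in> s c ` B" using subspace_0[OF that(2)] scale_zero_right by (metis imageI)
    then show ?thesis
      using that(2) by (force simp: set_plus_def subspace_add subspace_scale)
  qed
  show ?thesis
    using Z Z' h sum[OF B] sum[OF B'] mult[OF B] mult[OF B']
    by (simp add: quotient_iso_def bij_betw_def)
qed

section \<open>Subgroups and additive maps\<close>

definition subgroup_on :: "'e::ab_group_add set \<Rightarrow> bool" where
  "subgroup_on F \<longleftrightarrow> 0 \<in> F \<and> (\<forall>x\<in>F. \<forall>y\<in>F. x - y \<in> F)"

lemma subgroup_on_group_closure [simp]: "subgroup_on (group_closure S)"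
  by (auto simp: subgroup_on_def intro: group_closure.diff)

lemma subgroup_onD:
  assumes "subgroup_on F"
  shows "0 \<in> F" "x \<in> F \<Longrightarrow> y \<in> F \<Longrightarrow> x - y \<in> F" "x \<in> F \<Longrightarrow> - x \<in> F" "x \<in> F \<Longrightarrow> y \<in> F \<Longrightarrow> x + y \<in> F"
proof -
  show 0: "0 \<in> F" and d: "x \<in> F \<Longrightarrow> y \<in> F \<Longrightarrow> x - y \<in> F" for x y
    using assms by (auto simp: subgroup_on_def)
  show m: "x \<in> F \<Longrightarrow> - x \<in> F" for x using d[OF 0] by force
  show "x \<in> F \<Longrightarrow> y \<in> F \<Longrightarrow> x + y \<in> F" using d[OF _ m] by force
qed

lemma group_closure_minimal:
  assumes "S \<subseteq> F" "subgroup_on F"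
  shows "group_closure S \<subseteq> F"
proof
  fix x assume "x \<in> group_closure S"
  then show "x \<in> F"
    by induction (use assms subgroup_onD[OF assms(2)] in auto)
qed

lemma group_closure_superset: "S \<subseteq> group_closure S"
  by (auto intro: group_closure.base)

lemma group_closure_Union: "group_closure (\<Union>i\<in>I. group_closure (S i)) = group_closure (\<Union>i\<in>I. S i)"
proof
  show "group_closure (\<Union>i\<in>I. group_closure (S i)) \<subseteq> group_closure (\<Union>i\<in>I. S i)"
    by (intro group_closure_minimal UN_least) (auto intro: group_closure.base)
  show "group_closure (\<Union>i\<in>I. S i) \<subseteq> group_closure (\<Union>i\<in>I. group_closure (S i))"
    by (intro group_closure_minimal UN_least) (auto intro!: group_closure.base)
qed

lemma subgroup_sum:
  assumes "subgroup_on F" "\<And>i. i \<in> A \<Longrightarrow> f i \<in> F"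
  shows "(\<Sum>i\<in>A. f i) \<in> F"
  using assms(2) by (induction A rule: infinite_finite_induct) (auto simp: subgroup_onD[OF assms(1)])

lemma subgroup_int_mult:
  fixes F :: "('s \<Rightarrow> real) set"
  assumes F: "subgroup_on F" and x: "x \<in> F"
  shows "pscale (of_int n) x \<in> F"
proof -
  have nat: "pscale (of_nat m) x \<in> F" for m
  proof (induction m)
    case (Suc m)
    have eq: "pscale (of_nat (Suc m)) x = x + pscale (of_nat m) x"
      by (auto simp: pscale_def fun_eq_iff algebra_simps)
    show ?case unfolding eq by (rule subgroup_onD(4)[OF F x Suc])
  qed (use subgroup_onD(1)[OF F] in \<open>simp add: pscale_def flip: zero_fun_def\<close>)
  show ?thesis
  proof (cases n)
    case (neg m)
    have "pscale (of_int n) x = - pscale (of_nat (Suc m)) x"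
      by (simp add: neg pscale_def fun_eq_iff del: of_nat_Suc)
    then show ?thesis using subgroup_onD(3)[OF F nat[of "Suc m"]] by (simp only:)
  qed (use nat in auto)
qed

context
  fixes F :: "'e::ab_group_add set" and \<phi> :: "'e \<Rightarrow> 'k::ab_group_add"
  assumes F: "subgroup_on F" and \<phi>: "additive_on F \<phi>"
begin

lemma additive_on_add: "x \<in> F \<Longrightarrow> y \<in> F \<Longrightarrow> \<phi> (x + y) = \<phi> x + \<phi> y"
  using \<phi> by (simp add: additive_on_def)

lemma additive_on_zero: "\<phi> 0 = 0"
  using additive_on_add[of 0 0] subgroup_onD(1)[OF F] by simp

lemma additive_on_diff: "x \<in> F \<Longrightarrow> y \<in> F \<Longrightarrow> \<phi> (x - y) = \<phi> x - \<phi> y"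
  using additive_on_add[of "x - y" y] subgroup_onD(2)[OF F] by simp

lemma additive_on_minus: "x \<in> F \<Longrightarrow> \<phi> (- x) = - \<phi> x"
  using additive_on_diff[of 0 x] additive_on_zero subgroup_onD(1)[OF F] by simp

end

lemma additive_on_int_mult:
  fixes F :: "('s \<Rightarrow> real) set" and \<phi> :: "('s \<Rightarrow> real) \<Rightarrow> 'k::ring_1"
  assumes F: "subgroup_on F" and \<phi>: "additive_on F \<phi>" and x: "x \<in> F"
  shows "\<phi> (pscale (of_int n) x) = of_int n * \<phi> x"
proof -
  have mem: "pscale (of_nat m) x \<in> F" for m using subgroup_int_mult[OF F x, of "int m"] by simp
  have nat: "\<phi> (pscale (of_nat m) x) = of_nat m * \<phi> x" for m
  proof (induction m)
    case (Suc m)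
    have eq: "pscale (of_nat (Suc m)) x = x + pscale (of_nat m) x"
      by (auto simp: pscale_def fun_eq_iff algebra_simps)
    show ?case unfolding eq additive_on_add[OF F \<phi> x mem] Suc by (simp add: algebra_simps)
  qed (use additive_on_zero[OF F \<phi>] in \<open>simp add: pscale_def flip: zero_fun_def\<close>)
  show ?thesis
  proof (cases n)
    case (neg m)
    have "pscale (of_int n) x = - pscale (of_nat (Suc m)) x"
      by (simp add: neg pscale_def fun_eq_iff del: of_nat_Suc)
    then have "\<phi> (pscale (of_int n) x) = - (of_nat (Suc m) * \<phi> x)"
      by (simp only: additive_on_minus[OF F \<phi> mem] nat)
    then show ?thesis by (simp add: neg algebra_simps)
  qed (use nat in auto)
qed

lemma additive_on_zero_group_closure:
  assumes "additive_on (group_closure S) \<phi>" "\<And>x. x \<in> S \<Longrightarrow> \<phi> x = (0::'k::ab_group_add)" "x \<in> group_closure S"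
  shows "\<phi> x = 0"
  using assms(3)
proof induction
  case (base s)
  then show ?case using assms(2) additive_on_zero[OF subgroup_on_group_closure assms(1)] by blast
next
  case (diff s t)
  then show ?case using additive_on_diff[OF subgroup_on_group_closure assms(1)] by simp
qed

lemma additive_on_mono: "additive_on F' \<phi> \<Longrightarrow> F \<subseteq> F' \<Longrightarrow> additive_on F \<phi>"
  by (auto simp: additive_on_def)

text \<open>Subgroups of the integers are cyclic.\<close>

lemma int_subgroup_multiples:
  assumes "subgroup_on (V :: int set)"
  obtains g where "g \<in> V" "\<And>v. v \<in> V \<Longrightarrow> g dvd v"
proof -
  have "group_closure V = V"
    using group_closure_minimal[OF order_refl assms] group_closure_superset by blast
  then have "V = range (times (Gcd V))" using group_closure_eq by metis
  then have "Gcd V \<in> V" by (metis mult.right_neutral rangeI)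
  then show ?thesis using that Gcd_dvd by blast
qed

text \<open>
  If \<open>\<Sum> x\<^sub>j \<otimes> y\<^sub>j\<close> is zero as a function of two variables, it is zero in the tensor product of \<open>F\<close> and \<open>G\<close>
  over the integers, so \<open>u \<otimes> \<phi>\<close> vanishes on it. Integrality is essential: \<open>1 \<otimes> \<surd>2 - \<surd>2 \<otimes> 1\<close> is zero as
  a product of real numbers. The induction over \<open>X\<close> splits off a cyclic summand of \<open>F\<close> at each
  step: a function \<open>f0\<close> in \<open>F\<close> whose value at the point \<open>s0\<close> generates all values at \<open>s0\<close> of functions
  in \<open>F\<close>, the complement being the functions that vanish at \<open>s0\<close>. Evaluating at \<open>s0\<close> shows that \<open>f0\<close> is
  paired with \<open>0\<close>.
\<close>

lemma tensor_pairing_vanishes: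
  fixes F :: "('s \<Rightarrow> real) set" and G :: "('t \<Rightarrow> real) set"
    and u :: "('s \<Rightarrow> real) \<Rightarrow> 'k::comm_ring_1" and \<phi> :: "('t \<Rightarrow> real) \<Rightarrow> 'k"
  assumes "finite X" "subgroup_on F" and G: "subgroup_on G" "additive_on G \<phi>"
    and "\<And>x s. x \<in> F \<Longrightarrow> s \<in> X \<Longrightarrow> x s \<in> \<int>"
    and "\<And>x. x \<in> F \<Longrightarrow> (\<And>s. s \<in> X \<Longrightarrow> x s = 0) \<Longrightarrow> x = 0"
    and "additive_on F u" "set l \<subseteq> F \<times> G"
    and "\<And>s t. (\<Sum>(x, y)\<leftarrow>l. x s * y t) = 0"
  shows "(\<Sum>(x, y)\<leftarrow>l. u x * \<phi> y) = 0"
  using assms(1,2,5-)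
proof (induction X arbitrary: F l rule: finite_induct)
  case empty
  have "u x * \<phi> y = 0" if "(x, y) \<in> set l" for x y
  proof -
    have "x = 0" using empty(3,5) that by blast
    then show ?thesis using additive_on_zero[OF empty(1,4)] by (simp only: mult_zero_left)
  qed
  then have "(\<Sum>(x, y)\<leftarrow>l. u x * \<phi> y) = (\<Sum>p\<leftarrow>l. 0)"
    by (intro arg_cong[of _ _ sum_list] map_cong) auto
  then show ?case by simp
next
  case (insert s0 X)
  note F = insert.prems(1) and ints = insert.prems(2) and det = insert.prems(3) and u = insert.prems(4)
    and l = insert.prems(5) and zero = insert.prems(6)
  have "subgroup_on {v. \<exists>x\<in>F. x s0 = of_int v}"
  proof -
    have "\<exists>x\<in>F. x s0 = of_int (v - w)" if "x \<in> F" "y \<in> F" "x s0 = of_int v" "y s0 = of_int w" for x y v w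
      using that subgroup_onD(2)[OF F that(1,2)] by (intro bexI[of _ "x - y"]) auto
    then show ?thesis
      using subgroup_onD(1)[OF F] by (force simp: subgroup_on_def)
  qed
  then obtain g where g: "\<exists>x\<in>F. x s0 = of_int g" "\<And>x v. x \<in> F \<Longrightarrow> x s0 = of_int v \<Longrightarrow> g dvd v"
    by (rule int_subgroup_multiples) blast
  then obtain f0 where f0: "f0 \<in> F" "f0 s0 = of_int g" by blast
  have "\<exists>n::int. x s0 = of_int n * f0 s0 \<and> (g = 0 \<longrightarrow> n = 0)" if x: "x \<in> F" for x
  proof -
    have "x s0 \<in> \<int>" using ints[OF x, of s0] by simp
    then obtain v where v: "x s0 = of_int v" by (rule Ints_cases)
    then have "g dvd v" by (rule g(2)[OF x])
    then obtain n where "v = g * n" by (rule dvdE)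
    then show ?thesis using v f0 by (intro exI[of _ "if g = 0 then 0 else n"]) auto
  qed
  then obtain n where n: "\<And>x. x \<in> F \<Longrightarrow> x s0 = of_int (n x) * f0 s0"
    "\<And>x. x \<in> F \<Longrightarrow> g = 0 \<Longrightarrow> n x = (0::int)" by metis
  \<comment> \<open>\<open>r\<close> projects \<open>F\<close> onto the functions vanishing at \<open>s0\<close>, along \<open>f0\<close>.\<close>
  define r where "r x = x - pscale (of_int (n x)) f0" for x
  let ?F = "{x \<in> F. x s0 = 0}"
  have r: "r x \<in> ?F" "u x = u (r x) + of_int (n x) * u f0" if "x \<in> F" for x
  proof -
    have m: "pscale (of_int (n x)) f0 \<in> F" by (rule subgroup_int_mult[OF F f0(1)])
    show "r x \<in> ?F"
      using subgroup_onD(2)[OF F that m] n(1)[OF that] by (simp add: r_def pscale_def)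
    show "u x = u (r x) + of_int (n x) * u f0"
      unfolding r_def additive_on_diff[OF F u that m] additive_on_int_mult[OF F u f0(1)] by simp
  qed
  \<comment> \<open>\<open>Y\<close> is the function paired with \<open>f0\<close>.\<close>
  define Y where "Y = (\<Sum>(x, y)\<leftarrow>l. pscale (of_int (n x)) y)"
  have Y: "Y t = (\<Sum>(x, y)\<leftarrow>l. of_int (n x) * y t)" for t
    unfolding Y_def by (induction l) (auto simp: pscale_def)
  have "Y t = 0" for t
  proof (cases "g = 0")
    case True
    then have "of_int (n x) * y t = 0" if "(x, y) \<in> set l" for x y using n(2) l that by auto
    then have "(\<Sum>(x, y)\<leftarrow>l. of_int (n x) * y t) = (\<Sum>p\<leftarrow>l. 0)"
      by (intro arg_cong[of _ _ sum_list] map_cong) auto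
    then show ?thesis by (simp add: Y)
  next
    case False
    have "0 = (\<Sum>(x, y)\<leftarrow>l. x s0 * y t)" using zero by simp
    also have "\<dots> = (\<Sum>(x, y)\<leftarrow>l. f0 s0 * (of_int (n x) * y t))"
      using l n(1) by (intro arg_cong[of _ _ sum_list] map_cong) (auto simp: mult_ac)
    also have "\<dots> = f0 s0 * Y t"
      unfolding Y by (simp add: sum_list_const_mult case_prod_unfold)
    finally show ?thesis using False f0(2) by simp
  qed
  then have Y0: "Y = 0" by auto
  have "\<phi> Y = (\<Sum>(x, y)\<leftarrow>l. of_int (n x) * \<phi> y) \<and> Y \<in> G"
    unfolding Y_def using l
  proof (induction l)
    case Nil
    show ?case
      unfolding list.map sum_list.Nil using additive_on_zero[OF G] subgroup_onD(1)[OF G(1)] by blast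
  next
    case (Cons p l)
    obtain x y where p: "p = (x, y)" by (cases p)
    let ?S = "\<Sum>(x, y)\<leftarrow>l. pscale (of_int (n x)) y"
    have y: "y \<in> G" and IH: "\<phi> ?S = (\<Sum>(x, y)\<leftarrow>l. of_int (n x) * \<phi> y)" "?S \<in> G"
      using Cons p by auto
    have m: "pscale (of_int (n x)) y \<in> G" by (rule subgroup_int_mult[OF G(1) y])
    have e: "(\<Sum>(x, y)\<leftarrow>p # l. pscale (of_int (n x)) y) = pscale (of_int (n x)) y + ?S"
      by (simp only: p list.map sum_list.Cons case_prod_conv)
    show ?case
      unfolding e additive_on_add[OF G m IH(2)] additive_on_int_mult[OF G y] IH(1)
      using subgroup_onD(4)[OF G(1) m IH(2)] by (simp only: p list.map sum_list.Cons case_prod_conv simp_thms)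
  qed
  then have \<phi>Y: "(\<Sum>(x, y)\<leftarrow>l. of_int (n x) * \<phi> y) = 0"
    using Y0 additive_on_zero[OF G] by simp
  let ?l = "map (\<lambda>(x, y). (r x, y)) l"
  have "(\<Sum>(x, y)\<leftarrow>?l. u x * \<phi> y) = 0"
  proof (rule insert.IH)
    show "subgroup_on ?F" using F by (auto simp: subgroup_on_def)
    show "x s \<in> \<int>" if "x \<in> ?F" "s \<in> X" for x s using ints that by auto
    show "x = 0" if "x \<in> ?F" "\<And>s. s \<in> X \<Longrightarrow> x s = 0" for x
      using that by (intro det) auto
    show "additive_on ?F u" using u by (rule additive_on_mono) auto
    show "set ?l \<subseteq> ?F \<times> G" using l r(1) by auto
    show "(\<Sum>(x, y)\<leftarrow>?l. x s * y t) = 0" for s t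
    proof -
      have "(\<Sum>(x, y)\<leftarrow>?l. x s * y t) = (\<Sum>(x, y)\<leftarrow>l. x s * y t) - f0 s * Y t"
        unfolding Y by (induction l) (auto simp: r_def pscale_def algebra_simps)
      then show ?thesis using zero Y0 by simp
    qed
  qed
  moreover have "(\<Sum>(x, y)\<leftarrow>l. u x * \<phi> y) =
      (\<Sum>(x, y)\<leftarrow>?l. u x * \<phi> y) + u f0 * (\<Sum>(x, y)\<leftarrow>l. of_int (n x) * \<phi> y)"
    using l by (induction l) (auto simp: r(2) algebra_simps)
  ultimately show ?case using \<phi>Y by simp
qed

section \<open>Tensor products with a field\<close>

interpretation ps: vector_space "pscale :: 'k::field \<Rightarrow> ('x \<Rightarrow> 'k) \<Rightarrow> 'x \<Rightarrow> 'k"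
  by (rule vector_space_pscale)

interpretation cs: vector_space "cscale :: 'k::field \<Rightarrow> ('i \<Rightarrow> 'x \<Rightarrow> 'k) \<Rightarrow> 'i \<Rightarrow> 'x \<Rightarrow> 'k"
  by (rule vector_space_cscale)

lemma subspace_tensor: "ps.subspace (tensor F)"
  by (simp add: tensor_def)

lemma tens_in_tensor: "x \<in> F \<Longrightarrow> tens F x c \<in> tensor F"
  unfolding tensor_def by (rule ps.span_base) blast

lemma tens_scale: "pscale c (tens F x a) = tens F x (c * a)"
  by (auto simp: pscale_def tens_def fun_eq_iff)

text \<open>Tensors are additive in the first factor, so generators of the group suffice.\<close>

lemma tensor_finite_span:
  assumes F: "F = group_closure G"
  shows "tensor F \<subseteq> ps.span ((\<lambda>g. tens F g (1::'k::field)) ` G)" (is "_ \<subseteq> ?S")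
proof -
  have SF: "subgroup_on F" using F by simp
  have "tens F x c \<in> ?S" if "x \<in> group_closure G" for x and c :: 'k
    using that
  proof (induction)
    case (base s)
    show ?case
    proof (cases "s \<in> G")
      case True
      have "tens F s c = pscale c (tens F s 1)" by (simp add: tens_scale)
      then show ?thesis using True by (metis imageI ps.span_base ps.span_scale)
    next
      case False
      then have "tens F s c = 0"
        using base additive_on_zero[OF SF] by (auto simp: tens_def fun_eq_iff)
      then show ?thesis by (simp only: ps.span_zero)
    qed
  next
    case (diff s t)
    have "tens F (s - t) c \<phi> = tens F s c \<phi> - tens F t c \<phi>" for \<phi>
    proof (cases "additive_on F \<phi>")
      case True
      have "\<phi> (s - t) = \<phi> s - \<phi> t"
        by (rule additive_on_diff[OF SF True]) (use diff F in auto)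
      then show ?thesis by (simp only: tens_def True if_True right_diff_distrib)
    qed (simp add: tens_def)
    then have "tens F (s - t) c = tens F s c - tens F t c" by auto
    then show ?case using diff ps.span_diff by metis
  qed
  then show ?thesis
    unfolding tensor_def F by (intro ps.span_minimal) auto
qed

lemma linear_tensor_incl: "Vector_Spaces.linear pscale pscale (tensor_incl F)"
  by unfold_locales (auto simp: tensor_incl_def pscale_def fun_eq_iff algebra_simps)

lemma tensor_incl_in_tensor:
  fixes t :: "('e::ab_group_add \<Rightarrow> 'k::field) \<Rightarrow> 'k"
  assumes "F \<subseteq> F'" "t \<in> tensor F"
  shows "tensor_incl F' t \<in> tensor F'"
proof -
  interpret i: Vector_Spaces.linear pscale pscale "tensor_incl F' :: (('e \<Rightarrow> 'k) \<Rightarrow> 'k) \<Rightarrow> ('e \<Rightarrow> 'k) \<Rightarrow> 'k"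
    by (rule linear_tensor_incl)
  have "tensor_incl F' ` (tensor F :: (('e \<Rightarrow> 'k) \<Rightarrow> 'k) set) = ps.span (tensor_incl F' ` {tens F x c |x c. x \<in> F})"
    unfolding tensor_def by (rule i.span_image[symmetric])
  also have "\<dots> \<subseteq> tensor F'"
    unfolding tensor_def
    using assms(1) by (intro ps.span_mono) (force simp: tensor_incl_tens)
  finally have "tensor_incl F' ` (tensor F :: (('e \<Rightarrow> 'k) \<Rightarrow> 'k) set) \<subseteq> tensor F'" .
  then show ?thesis using assms(2) by blast
qed

lemma tensor_incl_self:
  assumes "t \<in> tensor F"
  shows "tensor_incl F t = t"
proof -
  have "tensor F \<subseteq> {t. tensor_incl F t = t}"
    unfolding tensor_def
    by (rule ps.span_minimal)
      (auto simp: tens_def tensor_incl_def ps.subspace_def pscale_def fun_eq_iff)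
  then show ?thesis using assms by blast
qed

lemma dual_subspace: "ps.subspace (dual U)"
  by (auto simp: ps.subspace_def dual_def pscale_def algebra_simps)

text \<open>The tensors with coefficient \<open>1\<close> span.\<close>

lemma dual_tensor_eq_0:
  fixes v :: "(('e::ab_group_add \<Rightarrow> 'k::field) \<Rightarrow> 'k) \<Rightarrow> 'k"
  assumes v: "v \<in> dual (tensor F)" and 0: "\<And>x. x \<in> F \<Longrightarrow> v (tens F x 1) = 0"
  shows "v = 0"
proof -
  have add: "v (s + t) = v s + v t" if "s \<in> tensor F" "t \<in> tensor F" for s t
    using v that by (auto simp: dual_def)
  have scale: "v (pscale c t) = c * v t" if "t \<in> tensor F" for c t
    using v that by (auto simp: dual_def)
  have "tensor F \<subseteq> {t \<in> tensor F. v t = 0}"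
    unfolding tensor_def[of F]
  proof (rule ps.span_minimal)
    show "{tens F x c |x c. x \<in> F} \<subseteq> {t \<in> ps.span {tens F x c |x c. x \<in> F}. v t = 0}"
    proof clarify
      fix x and c :: 'k assume x: "x \<in> F"
      have "v (tens F x c) = c * v (tens F x 1)"
        using scale[OF tens_in_tensor[OF x], of c 1] by (simp add: tens_scale)
      then show "tens F x c \<in> ps.span {tens F x c |x c. x \<in> F} \<and> v (tens F x c) = 0"
        using 0[OF x] tens_in_tensor[OF x, of c] by (simp add: tensor_def)
    qed
    show "ps.subspace {t \<in> ps.span {tens F x c |x c. x \<in> F}. v t = 0}"
      using add scale subspace_tensor[of F] scale[of 0 0]
      unfolding tensor_def[of F, symmetric] by (auto simp: ps.subspace_def)
  qed
  then have "v t = 0" for t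
    using v by (cases "t \<in> tensor F") (auto simp: dual_def)
  then show ?thesis by auto
qed

lemma dual_tens_additive:
  fixes v :: "(('e::ab_group_add \<Rightarrow> 'k::field) \<Rightarrow> 'k) \<Rightarrow> 'k"
  assumes v: "v \<in> dual (tensor F)"
  shows "additive_on F (\<lambda>x. v (tens F x 1))"
proof -
  have "tens F (x + y) (1::'k) = tens F x 1 + tens F y 1" if "x \<in> F" "y \<in> F" for x y
    using that by (auto simp: tens_def fun_eq_iff additive_on_def)
  moreover have "v (s + t) = v s + v t" if "s \<in> tensor F" "t \<in> tensor F" for s t
    using v that by (auto simp: dual_def)
  ultimately show ?thesis by (simp add: additive_on_def tens_in_tensor)
qed

section \<open>Lattice elements of exterior powers\<close>

lemma wedge_Ints:
  assumes "\<And>x y. x \<in> set xs \<Longrightarrow> y \<in> set ys \<Longrightarrow> x \<bullet> y \<in> \<int>"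
  shows "wedge xs ys \<in> \<int>"
proof (cases "length ys = length xs")
  case True
  have "(\<Prod>i<length xs. xs ! i \<bullet> ys ! \<pi> i) \<in> \<int>" if \<pi>: "\<pi> permutes {..<length xs}" for \<pi>
  proof (rule Ints_prod)
    fix i assume i: "i \<in> {..<length xs}"
    then have "\<pi> i < length ys" using permutes_in_image[OF \<pi>, of i] True by simp
    then show "xs ! i \<bullet> ys ! \<pi> i \<in> \<int>" using i by (intro assms nth_mem) auto
  qed
  then show ?thesis using True by (auto simp: wedge_def intro!: Ints_sum Ints_mult)
qed (simp add: wedge_def)

lemma dual_lists_Ints:
  assumes "dual_lists bs ds" "x \<in> group_closure (set bs)" "y \<in> set ds"
  shows "x \<bullet> y \<in> \<int>"
  using assms(2)
proof induction
  case (base s)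
  have "s \<bullet> y \<in> {0, 1}" if "s \<in> set bs"
    using that assms(1,3) by (auto simp: dual_lists_def in_set_conv_nth)
  then show ?case using base by auto
next
  case (diff s t)
  then show ?case by (simp add: inner_diff_left)
qed

lemma set_sel_subset:
  assumes "a permutes {..<length ys}" "k \<le> length ys"
  shows "set (sel a l k ys) \<subseteq> set ys"
  using permutes_in_image[OF assms(1)] assms(2) by (force intro!: nth_mem)

lemma shuffle_permutes: "a \<in> shuffle_perms p m \<Longrightarrow> a permutes {..<m}"
  by (simp add: shuffle_perms_def)

text \<open>The coordinates in the Cauchy-Binet expansion are minors of integer matrices.\<close>

lemma lattice_wedge:
  assumes dual: "dual_lists bs ds" and n: "length bs = n" "p \<le> n"
    and xs: "length xs = p" "set xs \<subseteq> group_closure (set bs)"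
  shows "a \<in> shuffle_perms p n \<Longrightarrow> wedge xs (sel a 0 p ds) \<in> \<int>"
    and "wedge xs \<in> group_closure ((\<lambda>a. wedge (sel a 0 p bs)) ` shuffle_perms p n)"
    and "wedge xs = (\<Sum>a\<in>shuffle_perms p n. pscale (wedge xs (sel a 0 p ds)) (wedge (sel a 0 p bs)))"
proof -
  show int: "wedge xs (sel a 0 p ds) \<in> \<int>" if "a \<in> shuffle_perms p n" for a
  proof (rule wedge_Ints)
    fix x y assume x: "x \<in> set xs" and "y \<in> set (sel a 0 p ds)"
    then have "y \<in> set ds"
      using set_sel_subset[of a ds p 0] shuffle_permutes[OF that] dual n by (auto simp: dual_lists_def)
    then show "x \<bullet> y \<in> \<int>" using dual_lists_Ints[OF dual] x xs(2) by blast
  qed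
  have "set xs \<subseteq> span (set bs)"
    using xs(2) span_superset[of "group_closure (set bs)"] by (simp add: span_group_closure)
  then show e: "wedge xs = (\<Sum>a\<in>shuffle_perms p n. pscale (wedge xs (sel a 0 p ds)) (wedge (sel a 0 p bs)))"
    by (rule wedge_expansion[OF dual n xs(1)])
  show "wedge xs \<in> group_closure ((\<lambda>a. wedge (sel a 0 p bs)) ` shuffle_perms p n)"
  proof (subst e, rule subgroup_sum)
    fix a assume a: "a \<in> shuffle_perms p n"
    then obtain k where "wedge xs (sel a 0 p ds) = of_int k" using int Ints_cases by metis
    then show "pscale (wedge xs (sel a 0 p ds)) (wedge (sel a 0 p bs))
        \<in> group_closure ((\<lambda>a. wedge (sel a 0 p bs)) ` shuffle_perms p n)"
      using a by (simp only:) (intro subgroup_int_mult group_closure.base, auto)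
  qed simp
qed

lemma lattice_mvec:
  assumes dual: "dual_lists bs ds" and n: "length bs = n" "p \<le> n"
    and x: "x \<in> group_closure (wedge ` {xs. length xs = p \<and> set xs \<subseteq> group_closure (set bs)})"
  shows "a \<in> shuffle_perms p n \<Longrightarrow> x (sel a 0 p ds) \<in> \<int>"
    and "x s = (\<Sum>a\<in>shuffle_perms p n. x (sel a 0 p ds) * wedge (sel a 0 p bs) s)"
proof -
  note L = lattice_wedge[OF dual n]
  have z: "0 s = (\<Sum>a\<in>shuffle_perms p n. 0 (sel a 0 p ds) * wedge (sel a 0 p bs) s)" by simp
  show "a \<in> shuffle_perms p n \<Longrightarrow> x (sel a 0 p ds) \<in> \<int>"
    using x by induction (use L(1) in auto)
  show "x s = (\<Sum>a\<in>shuffle_perms p n. x (sel a 0 p ds) * wedge (sel a 0 p bs) s)"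
    using x
  proof induction
    case (base y)
    show ?case
    proof (cases "y = 0")
      case False
      then obtain xs where xs: "y = wedge xs" "length xs = p" "set xs \<subseteq> group_closure (set bs)"
        using base by auto
      show ?thesis using fun_cong[OF L(3)[OF xs(2,3)], of s] by (simp add: xs(1) sum_fun_apply pscale_def)
    qed (simp only: z)
  next
    case (diff y z)
    then show ?case by (simp add: left_diff_distrib sum_subtractf)
  qed
qed

text \<open>
  On wedges, \<open>\<psi>\<close> is \<open>u \<otimes> \<phi>\<close> composed with the comultiplication. It is well defined because the Laplace
  expansion expresses \<open>z (s @ t)\<close>, for a combination \<open>z\<close> of wedges, as a sum of products \<open>x s * y t\<close>, and
  \<open>u \<otimes> \<phi>\<close> takes the same value on all such sums by \<open>tensor_pairing_vanishes\<close>.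
\<close>

lemma comultiplication_functional:
  fixes u \<phi> :: "('a::euclidean_space list \<Rightarrow> real) \<Rightarrow> 'k::comm_ring_1"
  assumes dual: "dual_lists bs ds" "p \<le> length bs"
    and F: "subgroup_on F" "additive_on F u"
      "F \<subseteq> group_closure (wedge ` {xs. length xs = p \<and> set xs \<subseteq> group_closure (set bs)})"
    and G: "subgroup_on G" "additive_on G \<phi>"
    and S: "\<And>xs. xs \<in> S \<Longrightarrow> length xs = m"
      "\<And>xs a. xs \<in> S \<Longrightarrow> a \<in> shuffle_perms p m \<Longrightarrow> wedge (sel a 0 p xs) \<in> F"
      "\<And>xs a. xs \<in> S \<Longrightarrow> a \<in> shuffle_perms p m \<Longrightarrow> wedge (sel a p m xs) \<in> G"
    and pm: "p \<le> m"
  obtains \<psi> where "additive_on (group_closure (wedge ` S)) \<psi>"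
    "\<And>xs. xs \<in> S \<Longrightarrow> \<psi> (wedge xs) =
      (\<Sum>a\<in>shuffle_perms p m. of_int (sign a) * (u (wedge (sel a 0 p xs)) * \<phi> (wedge (sel a p m xs))))"
proof -
  let ?n = "length bs"
  \<comment> \<open>A function \<open>z\<close> of lists becomes a function of two lists. It is cut off where the first list
    has the wrong length, as all elements of \<open>F\<close> vanish there.\<close>
  define split where "split z s t = (if length s = p then z (s @ t) else 0)" for z :: "'a list \<Rightarrow> real" and s t
  \<comment> \<open>\<open>rep z v\<close>: some expression of \<open>z\<close> as a sum of products gives the value \<open>v\<close>.\<close>
  define rep where "rep z v \<longleftrightarrow> (\<exists>l. set l \<subseteq> F \<times> G \<and> (\<forall>s t. split z s t = (\<Sum>(x, y)\<leftarrow>l. x s * y t)) \<and>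
      v = (\<Sum>(x, y)\<leftarrow>l. u x * \<phi> y))" for z v
  have rep_zero: "v = 0" if r: "rep 0 v" for v
  proof -
    obtain l where l: "set l \<subseteq> F \<times> G" "\<And>s t. split 0 s t = (\<Sum>(x, y)\<leftarrow>l. x s * y t)"
      "v = (\<Sum>(x, y)\<leftarrow>l. u x * \<phi> y)" using r unfolding rep_def by blast
    let ?X = "(\<lambda>a. sel a 0 p ds) ` shuffle_perms p ?n"
    have "(\<Sum>(x, y)\<leftarrow>l. u x * \<phi> y) = 0"
    proof (rule tensor_pairing_vanishes[of ?X, OF _ F(1) G _ _ F(2) l(1)])
      fix x s assume x: "x \<in> F"
      then have x': "x \<in> group_closure (wedge ` {xs. length xs = p \<and> set xs \<subseteq> group_closure (set bs)})"
        using F(3) by blast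
      show "x s \<in> \<int>" if "s \<in> ?X" using that lattice_mvec(1)[OF dual(1) refl dual(2) x'] by blast
      show "x = 0" if "\<And>s. s \<in> ?X \<Longrightarrow> x s = 0"
      proof
        fix s
        have "x s = (\<Sum>a\<in>shuffle_perms p ?n. x (sel a 0 p ds) * wedge (sel a 0 p bs) s)"
          by (rule lattice_mvec(2)[OF dual(1) refl dual(2) x'])
        also have "\<dots> = 0" using that by (intro sum.neutral) auto
        finally show "x s = 0 s" by simp
      qed
    next
      show "(\<Sum>(x, y)\<leftarrow>l. x s * y t) = 0" for s t
        using l(2)[of s t] by (simp add: split_def split: if_splits)
    qed simp
    then show ?thesis using l(3) by simp
  qed
  have rep_diff: "rep (z - z') (v - v')" if r: "rep z v" "rep z' v'" for z z' v v'
  proof -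
    obtain l where l: "set l \<subseteq> F \<times> G" "\<And>s t. split z s t = (\<Sum>(x, y)\<leftarrow>l. x s * y t)"
      "v = (\<Sum>(x, y)\<leftarrow>l. u x * \<phi> y)" using r(1) unfolding rep_def by blast
    obtain l' where l': "set l' \<subseteq> F \<times> G" "\<And>s t. split z' s t = (\<Sum>(x, y)\<leftarrow>l'. x s * y t)"
      "v' = (\<Sum>(x, y)\<leftarrow>l'. u x * \<phi> y)" using r(2) unfolding rep_def by blast
    let ?m = "map (\<lambda>(x, y). (- x, y)) l'"
    have 1: "set (l @ ?m) \<subseteq> F \<times> G" using l(1) l'(1) subgroup_onD(3)[OF F(1)] by auto
    have 2: "(\<Sum>(x, y)\<leftarrow>?m. x s * y t) = - (\<Sum>(x, y)\<leftarrow>l'. x s * y t)" for s t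
      by (induction l') auto
    have 3: "(\<Sum>(x, y)\<leftarrow>?m. u x * \<phi> y) = - (\<Sum>(x, y)\<leftarrow>l'. u x * \<phi> y)"
      using l'(1) additive_on_minus[OF F(1,2)] by (induction l') auto
    have "split (z - z') s t = (\<Sum>(x, y)\<leftarrow>l @ ?m. x s * y t)" for s t
    proof -
      have "split (z - z') s t = split z s t - split z' s t" by (simp add: split_def)
      then show ?thesis unfolding map_append sum_list_append 2 using l(2) l'(2) by simp
    qed
    moreover have "v - v' = (\<Sum>(x, y)\<leftarrow>l @ ?m. u x * \<phi> y)"
      unfolding map_append sum_list_append 3 using l(3) l'(3) by simp
    ultimately show ?thesis unfolding rep_def using 1 by blast
  qed
  have rep_unique: "v = v'" if "rep z v" "rep z v'" for z v v'
    using rep_zero[of "v - v'"] rep_diff[OF that] by simp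
  have rep_wedge: "rep (wedge xs) (\<Sum>a\<in>shuffle_perms p m. of_int (sign a) *
      (u (wedge (sel a 0 p xs)) * \<phi> (wedge (sel a p m xs))))" if xs: "xs \<in> S" for xs
  proof -
    obtain as where as: "set as = shuffle_perms p m" "distinct as"
      using finite_distinct_list[OF finite_shuffle_perms] by blast
    let ?l = "map (\<lambda>a. (pscale (of_int (sign a)) (wedge (sel a 0 p xs)), wedge (sel a p m xs))) as"
    have A: "set ?l \<subseteq> F \<times> G"
      using as(1) S(2,3)[OF xs] subgroup_int_mult[OF F(1)] by auto
    have B: "split (wedge xs) s t = (\<Sum>(x, y)\<leftarrow>?l. x s * y t)" for s t
    proof -
      have e: "(\<Sum>(x, y)\<leftarrow>?l. x s * y t) = (\<Sum>a\<in>shuffle_perms p m.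
          of_int (sign a) * (wedge (sel a 0 p xs) s * wedge (sel a p m xs) t))"
        using as by (simp add: o_def pscale_def mult.assoc sum_list_distinct_conv_sum_set)
      consider "length s = p" "length t = m - p" | "length s = p" "length t \<noteq> m - p" | "length s \<noteq> p"
        by blast
      then show ?thesis
      proof cases
        case 1
        then show ?thesis
          unfolding e using wedge_append[OF S(1)[OF xs] 1 pm] by (simp add: split_def)
      next
        case 2
        then show ?thesis
          unfolding e using S(1)[OF xs] pm by (auto simp: split_def wedge_eq_0_if_length)
      next
        case 3
        then show ?thesis
          unfolding e by (auto simp: split_def wedge_eq_0_if_length)
      qed
    qed
    have C: "(\<Sum>(x, y)\<leftarrow>?l. u x * \<phi> y) = (\<Sum>a\<in>shuffle_perms p m. of_int (sign a) *
      (u (wedge (sel a 0 p xs)) * \<phi> (wedge (sel a p m xs))))"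
    proof -
      have "(\<Sum>(x, y)\<leftarrow>?l. u x * \<phi> y) = (\<Sum>a\<in>shuffle_perms p m.
          u (pscale (of_int (sign a)) (wedge (sel a 0 p xs))) * \<phi> (wedge (sel a p m xs)))"
        using as by (simp add: o_def sum_list_distinct_conv_sum_set)
      also have "\<dots> = (\<Sum>a\<in>shuffle_perms p m. of_int (sign a) *
          (u (wedge (sel a 0 p xs)) * \<phi> (wedge (sel a p m xs))))"
        using additive_on_int_mult[OF F(1,2) S(2)[OF xs]] by (intro sum.cong refl) (simp only: mult.assoc)
      finally show ?thesis .
    qed
    show ?thesis
      unfolding rep_def by (rule exI[of _ ?l]) (intro conjI allI A B C[symmetric])
  qed
  define \<psi> where "\<psi> z = (SOME v. rep z v)" for z
  have \<psi>: "\<psi> z = v" if "rep z v" for z v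
    unfolding \<psi>_def using that by (rule some_equality) (rule rep_unique[OF _ that])
  have "split 0 s t = (\<Sum>(x, y)\<leftarrow>[]. x s * y t)" for s t
    by (simp add: split_def)
  then have r0: "rep 0 0"
    unfolding rep_def by (intro exI[of _ "[]"]) simp
  have ex: "\<exists>v. rep z v" if "z \<in> group_closure (wedge ` S)" for z
    using that
  proof induction
    case (base s)
    then consider "s = 0" | xs where "xs \<in> S" "s = wedge xs" by blast
    then show ?case
    proof cases
      case 1
      then show ?thesis using r0 by blast
    next
      case 2
      then show ?thesis using rep_wedge by blast
    qed
  next
    case (diff s t)
    then show ?case using rep_diff by blast
  qed
  have "additive_on (group_closure (wedge ` S)) \<psi>"
    unfolding additive_on_def
  proof (intro ballI)
    fix z z' assume z: "z \<in> group_closure (wedge ` S)" "z' \<in> group_closure (wedge ` S)"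
    obtain v v' where v: "rep z v" "rep z' v'" using ex z by blast
    have "rep (z - (0 - z')) (v - (0 - v'))" by (intro rep_diff v r0)
    then have "rep (z + z') (v + v')" by simp
    then show "\<psi> (z + z') = \<psi> z + \<psi> z'" using \<psi> v by metis
  qed
  then show ?thesis using that \<psi>[OF rep_wedge] by blast
qed

section \<open>Oriented pure fans\<close>

text \<open>The wedges of these lists generate \<open>F\<^sub>p\<close> of \<open>\<sigma>\<close> over the integers.\<close>

definition cone_lists :: "'a::euclidean_space set \<Rightarrow> 'a set set \<Rightarrow> nat \<Rightarrow> 'a set \<Rightarrow> 'a list set" where
  "cone_lists N \<Sigma> p \<sigma> = {xs. length xs = p \<and> (\<exists>\<gamma>\<in>\<Sigma>. \<sigma> face_of \<gamma> \<and> set xs \<subseteq> cone_lattice N \<gamma>)}"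

lemma FZ_eq_group_closure: "FZ N \<Sigma> p \<sigma> = group_closure (wedge ` cone_lists N \<Sigma> p \<sigma>)"
proof -
  have "(\<Union>\<gamma>\<in>{\<gamma> \<in> \<Sigma>. \<sigma> face_of \<gamma>}. {wedge xs |xs. set xs \<subseteq> cone_lattice N \<gamma> \<and> length xs = p}) =
      wedge ` cone_lists N \<Sigma> p \<sigma>"
    by (auto simp: cone_lists_def)
  then show ?thesis by (simp only: FZ_def ext_power_def group_closure_Union)
qed

lemma subgroup_on_FZ [simp]: "subgroup_on (FZ N \<Sigma> p \<sigma>)"
  by (simp add: FZ_eq_group_closure)

lemma wedge_in_FZ: "xs \<in> cone_lists N \<Sigma> p \<sigma> \<Longrightarrow> wedge xs \<in> FZ N \<Sigma> p \<sigma>"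
  by (auto simp: FZ_eq_group_closure intro: group_closure.base)

lemma cone_lists_mono: "\<tau> face_of \<sigma> \<Longrightarrow> cone_lists N \<Sigma> p \<sigma> \<subseteq> cone_lists N \<Sigma> p \<tau>"
  using face_of_trans by (fastforce simp: cone_lists_def)

lemma FZ_mono:
  assumes "\<tau> face_of \<sigma>"
  shows "FZ N \<Sigma> p \<sigma> \<subseteq> FZ N \<Sigma> p \<tau>"
  unfolding FZ_eq_group_closure[of _ _ _ \<sigma>]
  using cone_lists_mono[OF assms, of N \<Sigma> p] wedge_in_FZ[of _ N \<Sigma> p \<tau>]
  by (intro group_closure_minimal) auto

locale oriented_fan =
  fixes N :: "'a::euclidean_space set" and \<Sigma> :: "'a set set" and d :: nat and b :: "'a set \<Rightarrow> 'a list"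
  assumes lattice: "is_lattice N" and pure: "pure_fan N \<Sigma> d" and orient: "orientation N \<Sigma> b"
begin

lemma fan: "fan N \<Sigma>"
  using pure by (simp add: pure_fan_def)

lemma finite_fan [simp]: "finite \<Sigma>"
  using fan by (simp add: fan_def)

lemma finite_cones [simp]: "finite (cones \<Sigma> q)"
  by (simp add: cones_def)

lemma cone_facts:
  assumes "\<sigma> \<in> \<Sigma>"
  shows "rational_cone N \<sigma>" "0 \<in> \<sigma>" "convex \<sigma>" "polyhedron \<sigma>" "convex_cone \<sigma>"
proof -
  show "rational_cone N \<sigma>" using assms fan by (simp add: fan_def)
  then show "0 \<in> \<sigma>" "convex \<sigma>" "polyhedron \<sigma>" "convex_cone \<sigma>" by (rule rational_cone_facts)+
qed

lemma face_in_fan: "\<sigma> \<in> \<Sigma> \<Longrightarrow> \<tau> face_of \<sigma> \<Longrightarrow> 0 \<in> \<tau> \<Longrightarrow> \<tau> \<in> \<Sigma>"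
  using fan unfolding fan_def by blast

lemma face_refl: "\<sigma> \<in> \<Sigma> \<Longrightarrow> \<sigma> face_of \<sigma>"
  using cone_facts(3) by (rule face_of_refl)

text \<open>Choose a coface of largest dimension; purity makes this dimension \<open>d\<close>.\<close>

lemma maximal_cone_above:
  assumes "\<sigma> \<in> \<Sigma>"
  obtains \<alpha> where "\<alpha> \<in> cones \<Sigma> d" "\<sigma> face_of \<alpha>"
proof -
  let ?A = "{\<gamma> \<in> \<Sigma>. \<sigma> face_of \<gamma>}"
  have "finite ?A" "?A \<noteq> {}" using assms face_refl by auto
  then obtain \<alpha> where \<alpha>: "\<alpha> \<in> ?A" "\<And>\<gamma>. \<gamma> \<in> ?A \<Longrightarrow> dim \<gamma> \<le> dim \<alpha>"
    using finite_imageI[of ?A dim] Max_ge Max_in[of "dim ` ?A"] by (smt (verit) imageE image_eqI image_is_empty)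
  have "\<gamma> = \<alpha>" if "\<gamma> \<in> \<Sigma>" "\<alpha> face_of \<gamma>" for \<gamma>
  proof -
    have "dim \<gamma> \<le> dim \<alpha>" using \<alpha> that face_of_trans by blast
    then show ?thesis using face_eq_if_dim_eq[OF cone_facts(3)[OF that(1)] that(2)] cone_facts(2) \<alpha>(1) by blast
  qed
  then have "dim \<alpha> = d" using pure \<alpha>(1) by (auto simp: pure_fan_def)
  then show ?thesis using that \<alpha>(1) by (auto simp: cones_def)
qed

lemma dim_le:
  assumes "\<sigma> \<in> \<Sigma>"
  shows "dim \<sigma> \<le> d"
proof -
  obtain \<alpha> where "\<alpha> \<in> cones \<Sigma> d" "\<sigma> face_of \<alpha>" using maximal_cone_above[OF assms] .
  then show ?thesis using dim_subset[OF face_of_imp_subset] by (auto simp: cones_def)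
qed

lemma top_cone_maximal:
  assumes "\<alpha> \<in> cones \<Sigma> d" "\<gamma> \<in> \<Sigma>" "\<alpha> face_of \<gamma>"
  shows "\<gamma> = \<alpha>"
proof -
  have "\<alpha> \<in> \<Sigma>" "dim \<gamma> \<le> dim \<alpha>" using assms dim_le by (auto simp: cones_def)
  then show ?thesis
    using face_eq_if_dim_eq[OF cone_facts(3)[OF assms(2)] assms(3)] cone_facts(2) by blast
qed

text \<open>The cones are pointed.\<close>

lemma zero_face:
  assumes "\<sigma> \<in> \<Sigma>"
  shows "{0} face_of \<sigma>"
  unfolding face_of_def
proof (intro conjI ballI impI)
  have pointed: "\<sigma> \<inter> uminus ` \<sigma> = {0}" using cone_facts(1)[OF assms] by (simp add: rational_cone_def)
  show "{0} \<subseteq> \<sigma>" using cone_facts(2)[OF assms] by simp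
  fix a c x assume a: "a \<in> \<sigma>" and c: "c \<in> \<sigma>" and x: "x \<in> {0::'a}" "x \<in> open_segment a c"
  then obtain t where t: "0 < t" "t < 1" "0 = (1 - t) *\<^sub>R a + t *\<^sub>R c" by (auto simp: in_segment)
  have "(1 - t) *\<^sub>R a \<in> \<sigma>" "t *\<^sub>R c \<in> \<sigma>"
    using convex_cone_scaleR[OF cone_facts(5)[OF assms]] a c t by auto
  moreover have "(1 - t) *\<^sub>R a = - (t *\<^sub>R c)" using t(3) by (simp add: eq_neg_iff_add_eq_0)
  ultimately have "(1 - t) *\<^sub>R a \<in> \<sigma> \<inter> uminus ` \<sigma>" by blast
  then have a0: "(1 - t) *\<^sub>R a = 0" using pointed by blast
  then have "t *\<^sub>R c = 0" using t(3) by (simp only: add_0_left)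
  then show "c \<in> {0}" using t(1) by simp
  show "a \<in> {0}" using a0 t(2) by simp
qed simp

lemma vertex: "{0} \<in> \<Sigma>"
proof -
  obtain \<sigma> where "\<sigma> \<in> \<Sigma>" using fan by (auto simp: fan_def)
  then show ?thesis using face_in_fan zero_face by blast
qed

lemma cones_0: "cones \<Sigma> 0 = {{0}}"
proof
  show "cones \<Sigma> 0 \<subseteq> {{0}}"
  proof
    fix \<sigma> assume "\<sigma> \<in> cones \<Sigma> 0"
    then have "\<sigma> \<in> \<Sigma>" "\<sigma> \<subseteq> {0}" by (simp_all add: cones_def)
    then show "\<sigma> \<in> {{0}}" using cone_facts(2) by blast
  qed
qed (use vertex in \<open>simp add: cones_def\<close>)

text \<open>A nonzero vector of a cone spans an unbounded ray in it.\<close>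

lemma compact_cone_iff:
  assumes "\<sigma> \<in> \<Sigma>"
  shows "compact \<sigma> \<longleftrightarrow> \<sigma> = {0}"
proof
  assume "compact \<sigma>"
  then have "bounded \<sigma>" by (rule compact_imp_bounded)
  then obtain B where B: "\<And>x. x \<in> \<sigma> \<Longrightarrow> norm x \<le> B"
    unfolding bounded_iff by blast
  have "x = 0" if x: "x \<in> \<sigma>" for x
  proof (rule ccontr)
    assume x0: "x \<noteq> 0"
    have B0: "B \<ge> 0" using B[OF cone_facts(2)[OF assms]] by simp
    have "((B + 1) / norm x) *\<^sub>R x \<in> \<sigma>"
      using B0 by (intro convex_cone_scaleR[OF cone_facts(5)[OF assms] _ x]) auto
    then have "B + 1 \<le> B" using B[of "((B + 1) / norm x) *\<^sub>R x"] x0 B0 by simp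
    then show False by simp
  qed
  then show "\<sigma> = {0}" using cone_facts(2)[OF assms] by blast
qed simp

lemma top_cone_basis:
  assumes "\<alpha> \<in> cones \<Sigma> d"
  shows "distinct (b \<alpha>)" "independent (set (b \<alpha>))" "length (b \<alpha>) = d"
    "group_closure (set (b \<alpha>)) = cone_lattice N \<alpha>" "set (b \<alpha>) \<subseteq> cone_lattice N \<alpha>" "\<alpha> \<in> \<Sigma>"
proof -
  show \<alpha>: "\<alpha> \<in> \<Sigma>" using assms by (simp add: cones_def)
  show "distinct (b \<alpha>)" "independent (set (b \<alpha>))" "length (b \<alpha>) = d"
    using orientation_basis[OF fan orient \<alpha>] assms by (auto simp: cones_def)
  show g: "group_closure (set (b \<alpha>)) = cone_lattice N \<alpha>" using orient \<alpha> by (simp add: orientation_def)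
  show "set (b \<alpha>) \<subseteq> cone_lattice N \<alpha>" using group_closure_superset g by blast
qed

lemma sel_in_cone_lists:
  assumes "xs \<in> cone_lists N \<Sigma> d \<tau>" "a \<in> shuffle_perms p d" "k \<le> d"
  shows "sel a l k xs \<in> cone_lists N \<Sigma> (k - l) \<tau>"
proof -
  obtain \<gamma> where \<gamma>: "\<gamma> \<in> \<Sigma>" "\<tau> face_of \<gamma>" "set xs \<subseteq> cone_lattice N \<gamma>" "length xs = d"
    using assms(1) by (auto simp: cone_lists_def)
  then have "set (sel a l k xs) \<subseteq> cone_lattice N \<gamma>"
    using set_sel_subset[of a xs k l] shuffle_permutes[OF assms(2)] assms(3) by blast
  then show ?thesis using \<gamma> by (auto simp: cone_lists_def)
qed

lemma basis_in_cone_lists: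
  assumes "\<alpha> \<in> cones \<Sigma> d" "\<tau> face_of \<alpha>"
  shows "b \<alpha> \<in> cone_lists N \<Sigma> d \<tau>"
  using top_cone_basis[OF assms(1)] assms(2) by (auto simp: cone_lists_def)

text \<open>
  Every coface of \<open>\<sigma>\<close> lies in a maximal cone \<open>\<alpha>\<close>, and the wedges of sublists of a basis generate the
  exterior power of the lattice of \<open>\<alpha>\<close>. The bound on \<open>p\<close> ensures that the sublists exist.
\<close>

lemma FZ_finite_generators:
  assumes p: "p \<le> d"
  shows "FZ N \<Sigma> p \<sigma> = group_closure
    (\<Union>\<alpha>\<in>{\<alpha> \<in> cones \<Sigma> d. \<sigma> face_of \<alpha>}. (\<lambda>a. wedge (sel a 0 p (b \<alpha>))) ` shuffle_perms p d)"
    (is "_ = group_closure ?G")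
proof
  show "group_closure ?G \<subseteq> FZ N \<Sigma> p \<sigma>"
  proof (rule group_closure_minimal)
    show "?G \<subseteq> FZ N \<Sigma> p \<sigma>"
      using sel_in_cone_lists[OF basis_in_cone_lists, of _ \<sigma> _ p p 0] p
      by (auto intro!: wedge_in_FZ)
  qed simp
  show "FZ N \<Sigma> p \<sigma> \<subseteq> group_closure ?G"
    unfolding FZ_eq_group_closure
  proof (rule group_closure_minimal)
    show "wedge ` cone_lists N \<Sigma> p \<sigma> \<subseteq> group_closure ?G"
    proof clarify
      fix xs assume "xs \<in> cone_lists N \<Sigma> p \<sigma>"
      then obtain \<gamma> where \<gamma>: "\<gamma> \<in> \<Sigma>" "\<sigma> face_of \<gamma>" "set xs \<subseteq> cone_lattice N \<gamma>" "length xs = p"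
        by (auto simp: cone_lists_def)
      obtain \<alpha> where \<alpha>: "\<alpha> \<in> cones \<Sigma> d" "\<gamma> face_of \<alpha>" using maximal_cone_above[OF \<gamma>(1)] .
      have "cone_lattice N \<gamma> \<subseteq> cone_lattice N \<alpha>"
        using span_mono[OF face_of_imp_subset[OF \<alpha>(2)]] by (auto simp: cone_lattice_def)
      then have xs: "set xs \<subseteq> group_closure (set (b \<alpha>))" using \<gamma>(3) top_cone_basis(4)[OF \<alpha>(1)] by blast
      obtain ds where ds: "dual_lists (b \<alpha>) ds" using dual_lists_exist top_cone_basis(1,2)[OF \<alpha>(1)] by metis
      have "wedge xs \<in> group_closure ((\<lambda>a. wedge (sel a 0 p (b \<alpha>))) ` shuffle_perms p d)"
        by (rule lattice_wedge(2)[OF ds top_cone_basis(3)[OF \<alpha>(1)] p \<gamma>(4) xs])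
      moreover have "(\<lambda>a. wedge (sel a 0 p (b \<alpha>))) ` shuffle_perms p d \<subseteq> ?G"
        using \<alpha>(1) face_of_trans[OF \<gamma>(2) \<alpha>(2)] by blast
      then have "group_closure ((\<lambda>a. wedge (sel a 0 p (b \<alpha>))) ` shuffle_perms p d) \<subseteq> group_closure ?G"
        by (rule group_closure_minimal[OF order_trans[OF _ group_closure_superset]]) simp
      ultimately show "wedge xs \<in> group_closure ?G" by blast
    qed
  qed simp
qed

end

section \<open>The chain complexes\<close>

abbreviation cofaces :: "'a::euclidean_space set set \<Rightarrow> 'a set \<Rightarrow> 'a set set" where
  "cofaces \<Sigma> \<tau> \<equiv> {\<sigma>. \<sigma> \<in> \<Sigma> \<and> \<tau> face_of \<sigma> \<and> dim \<sigma> = Suc (dim \<tau>)}"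

text \<open>Evaluated at a functional \<open>\<phi>\<close> that is additive on \<open>F\<^sub>p(\<tau>)\<close>, the map \<open>\<iota>\<close> disappears.\<close>

lemma BM_boundary_apply:
  "BM_boundary N \<Sigma> b p c \<tau> \<phi> =
    (if \<tau> \<in> \<Sigma> \<and> additive_on (FZ N \<Sigma> p \<tau>) \<phi>
     then \<Sum>\<sigma>\<in>cofaces \<Sigma> \<tau>. of_int (rel_sign b \<tau> \<sigma>) * c \<sigma> \<phi> else 0)"
  by (simp add: BM_boundary_def sum_fun_apply pscale_def iota_def tensor_incl_def)

lemma linear_BM_boundary: "Vector_Spaces.linear cscale cscale (BM_boundary N \<Sigma> b p)"
  by unfold_locales
    (auto simp: fun_eq_iff BM_boundary_apply cscale_def pscale_def distrib_left sum.distrib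
      sum_distrib_left algebra_simps)

lemma subspace_BM_chains: "cs.subspace (BM_chains N \<Sigma> p q)"
  by (auto simp: cs.subspace_def BM_chains_def cscale_def Fk_def
      intro: ps.subspace_add[OF subspace_tensor] ps.subspace_scale[OF subspace_tensor]
        ps.subspace_0[OF subspace_tensor])

lemma subspace_Fk: "ps.subspace (Fk N \<Sigma> p \<sigma>)"
  by (simp add: Fk_def subspace_tensor)

lemma subspace_BM_boundaries: "cs.subspace (BM_boundaries N \<Sigma> b p q)"
proof -
  interpret B: Vector_Spaces.linear cscale cscale "BM_boundary N \<Sigma> b p" by (rule linear_BM_boundary)
  show ?thesis
    unfolding BM_boundaries_def by (rule B.subspace_image[OF subspace_BM_chains])
qed

lemma iota_in_Fk: "\<tau> face_of \<sigma> \<Longrightarrow> t \<in> Fk N \<Sigma> p \<sigma> \<Longrightarrow> iota N \<Sigma> p \<tau> t \<in> Fk N \<Sigma> p \<tau>"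
  unfolding Fk_def iota_def by (rule tensor_incl_in_tensor[OF FZ_mono])

lemma BM_boundary_0: "BM_boundary N \<Sigma> b p 0 = 0"
  by (auto simp: fun_eq_iff BM_boundary_apply)

context oriented_fan
begin

lemma BM_boundary_in_chains:
  assumes "c \<in> BM_chains N \<Sigma> p (Suc q)"
  shows "BM_boundary N \<Sigma> b p c \<in> BM_chains N \<Sigma> p q"
  unfolding BM_chains_def
proof (intro CollectI conjI ballI allI impI)
  fix \<tau> assume \<tau>: "\<tau> \<in> cones \<Sigma> q"
  have "c \<sigma> \<in> Fk N \<Sigma> p \<sigma>" if "\<sigma> \<in> cofaces \<Sigma> \<tau>" for \<sigma>
    using assms that \<tau> by (auto simp: BM_chains_def cones_def)
  then have "(\<Sum>\<sigma>\<in>cofaces \<Sigma> \<tau>. pscale (of_int (rel_sign b \<tau> \<sigma>)) (iota N \<Sigma> p \<tau> (c \<sigma>))) \<in> Fk N \<Sigma> p \<tau>"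
    by (intro ps.subspace_sum ps.subspace_scale subspace_Fk iota_in_Fk) auto
  then show "BM_boundary N \<Sigma> b p c \<tau> \<in> Fk N \<Sigma> p \<tau>"
    using \<tau> by (simp only: BM_boundary_def cones_def mem_Collect_eq if_True)
next
  fix \<tau> assume \<tau>: "\<tau> \<notin> cones \<Sigma> q"
  show "BM_boundary N \<Sigma> b p c \<tau> = 0"
  proof
    fix \<phi>
    have "c \<sigma> = 0" if "\<tau> \<in> \<Sigma>" "\<sigma> \<in> cofaces \<Sigma> \<tau>" for \<sigma>
    proof -
      have "\<sigma> \<notin> cones \<Sigma> (Suc q)" using that \<tau> by (auto simp: cones_def)
      then show ?thesis using assms unfolding BM_chains_def by blast
    qed
    then show "BM_boundary N \<Sigma> b p c \<tau> \<phi> = 0 \<phi>"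
      unfolding BM_boundary_apply by (auto intro!: sum.neutral)
  qed
qed

lemma rel_sign_sum_zero:
  assumes "\<rho> \<in> \<Sigma>" "\<sigma> \<in> \<Sigma>"
  shows "(\<Sum>\<tau> | \<tau> \<in> cofaces \<Sigma> \<rho> \<and> \<tau> face_of \<sigma> \<and> dim \<sigma> = Suc (dim \<tau>).
    rel_sign b \<rho> \<tau> * rel_sign b \<tau> \<sigma>) = 0" (is "sum ?f ?I = 0")
proof (cases "?I = {}")
  case False
  then have \<rho>: "\<rho> face_of \<sigma>" and dim: "dim \<sigma> = Suc (Suc (dim \<rho>))"
    using face_of_trans by auto
  obtain \<tau>1 \<tau>2 where \<tau>: "\<tau>1 \<noteq> \<tau>2"
    "{\<tau>. \<tau> face_of \<sigma> \<and> \<rho> face_of \<tau> \<and> dim \<tau> = Suc (dim \<rho>)} = {\<tau>1, \<tau>2}"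
    by (rule diamond_property[OF cone_facts(4)[OF assms(2)] \<rho> cone_facts(2)[OF assms(1)] dim])
  have "\<tau> \<in> \<Sigma>" if "\<tau> face_of \<sigma>" "\<rho> face_of \<tau>" for \<tau>
    using face_in_fan[OF assms(2) that(1)] face_of_imp_subset[OF that(2)] cone_facts(2)[OF assms(1)] by blast
  then have I: "?I = {\<tau>1, \<tau>2}"
    using dim by (subst \<tau>(2)[symmetric]) auto
  then have "\<tau>1 \<in> ?I" "\<tau>2 \<in> ?I" by blast+
  then have "\<tau>1 \<in> \<Sigma>" "\<rho> face_of \<tau>1" "\<tau>1 face_of \<sigma>" "dim \<tau>1 = Suc (dim \<rho>)"
    "\<tau>2 \<in> \<Sigma>" "\<rho> face_of \<tau>2" "\<tau>2 face_of \<sigma>" "dim \<tau>2 = Suc (dim \<rho>)"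
    by blast+
  then have "?f \<tau>1 + ?f \<tau>2 = 0"
    by (intro rel_sign_cancel[OF fan orient] assms \<tau>(1) dim)
  then show ?thesis unfolding I using \<tau>(1) by simp
next
  case True
  show ?thesis unfolding True by (rule sum.empty)
qed

text \<open>After exchanging the two sums, the coefficient of \<open>c \<sigma>\<close> is the sum in \<open>rel_sign_sum_zero\<close>.\<close>

lemma BM_boundary_boundary: "BM_boundary N \<Sigma> b p (BM_boundary N \<Sigma> b p c) = 0"
proof (intro ext)
  fix \<rho> \<phi>
  show "BM_boundary N \<Sigma> b p (BM_boundary N \<Sigma> b p c) \<rho> \<phi> = 0 \<rho> \<phi>"
  proof (cases "\<rho> \<in> \<Sigma> \<and> additive_on (FZ N \<Sigma> p \<rho>) \<phi>")
    case True
    then have \<rho>: "\<rho> \<in> \<Sigma>" "additive_on (FZ N \<Sigma> p \<rho>) \<phi>" by auto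
    let ?r = "\<lambda>\<tau> \<sigma>. of_int (rel_sign b \<tau> \<sigma>)"
    have e: "BM_boundary N \<Sigma> b p c \<tau> \<phi> = (\<Sum>\<sigma>\<in>cofaces \<Sigma> \<tau>. ?r \<tau> \<sigma> * c \<sigma> \<phi>)" if "\<tau> \<in> cofaces \<Sigma> \<rho>" for \<tau>
      using that additive_on_mono[OF \<rho>(2) FZ_mono[of \<rho> \<tau>]] by (simp add: BM_boundary_apply)
    have "BM_boundary N \<Sigma> b p (BM_boundary N \<Sigma> b p c) \<rho> \<phi> =
        (\<Sum>\<tau>\<in>cofaces \<Sigma> \<rho>. ?r \<rho> \<tau> * BM_boundary N \<Sigma> b p c \<tau> \<phi>)"
      using True by (simp only: BM_boundary_apply[of N \<Sigma> b p "BM_boundary N \<Sigma> b p c"] if_True simp_thms)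
    also have "\<dots> = (\<Sum>\<tau>\<in>cofaces \<Sigma> \<rho>. \<Sum>\<sigma>\<in>cofaces \<Sigma> \<tau>. ?r \<rho> \<tau> * (?r \<tau> \<sigma> * c \<sigma> \<phi>))"
      by (rule sum.cong[OF refl]) (simp only: e sum_distrib_left)
    also have "\<dots> = (\<Sum>\<sigma>\<in>\<Sigma>. \<Sum>\<tau> | \<tau> \<in> cofaces \<Sigma> \<rho> \<and> \<tau> face_of \<sigma> \<and> dim \<sigma> = Suc (dim \<tau>).
        ?r \<rho> \<tau> * (?r \<tau> \<sigma> * c \<sigma> \<phi>))"
      by (rule sum.swap_restrict) auto
    also have "\<dots> = (\<Sum>\<sigma>\<in>\<Sigma>. of_int (\<Sum>\<tau> | \<tau> \<in> cofaces \<Sigma> \<rho> \<and> \<tau> face_of \<sigma> \<and> dim \<sigma> = Suc (dim \<tau>).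
        rel_sign b \<rho> \<tau> * rel_sign b \<tau> \<sigma>) * c \<sigma> \<phi>)"
      by (simp only: of_int_sum of_int_mult sum_distrib_right mult.assoc)
    also have "\<dots> = 0"
      by (rule sum.neutral, rule ballI) (simp only: rel_sign_sum_zero[OF \<rho>(1)] of_int_0 mult_zero_left)
    finally show ?thesis by simp
  qed (auto simp: BM_boundary_apply)
qed

lemma BM_boundaries_subset_cycles: "BM_boundaries N \<Sigma> b p q \<subseteq> BM_cycles N \<Sigma> b p q"
  using BM_boundary_in_chains BM_boundary_boundary by (auto simp: BM_boundaries_def BM_cycles_def)

lemma BM_chains_above: "d < q \<Longrightarrow> BM_chains N \<Sigma> p q = {0}"
proof -
  assume "d < q"
  then have "cones \<Sigma> q = {}" using dim_le by (fastforce simp: cones_def)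
  then show ?thesis by (auto simp: BM_chains_def)
qed

lemma BM_boundaries_top: "BM_boundaries N \<Sigma> b p d = {0}"
  unfolding BM_boundaries_def BM_chains_above[OF lessI] image_insert image_empty BM_boundary_0 ..

lemma BM_boundary_chains_0:
  assumes "c \<in> BM_chains N \<Sigma> p 0"
  shows "BM_boundary N \<Sigma> b p c = 0"
proof (intro ext)
  fix \<tau> \<phi>
  have "c \<sigma> = 0" if "\<sigma> \<in> cofaces \<Sigma> \<tau>" for \<sigma>
  proof -
    have "\<sigma> \<notin> cones \<Sigma> 0" using that by (auto simp: cones_def simp del: dim_eq_0)
    then show ?thesis using assms unfolding BM_chains_def by blast
  qed
  then show "BM_boundary N \<Sigma> b p c \<tau> \<phi> = 0 \<tau> \<phi>"
    unfolding BM_boundary_apply by (auto intro!: sum.neutral)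
qed

lemma Fk_finite_span:
  assumes "p \<le> d"
  obtains G where "finite G" "(Fk N \<Sigma> p \<sigma> :: ('a, 'k::field) tvec set) \<subseteq> ps.span G"
proof (rule that)
  show "(Fk N \<Sigma> p \<sigma> :: ('a, 'k) tvec set) \<subseteq> ps.span ((\<lambda>g. tens (FZ N \<Sigma> p \<sigma>) g 1) `
      (\<Union>\<alpha>\<in>{\<alpha> \<in> cones \<Sigma> d. \<sigma> face_of \<alpha>}. (\<lambda>a. wedge (sel a 0 p (b \<alpha>))) ` shuffle_perms p d))"
    unfolding Fk_def by (rule tensor_finite_span[OF FZ_finite_generators[OF assms]])
qed auto

lemma BM_chains_finite_span:
  assumes "p \<le> d"
  obtains G where "finite G" "(BM_chains N \<Sigma> p q :: ('a, 'k::field) chain set) \<subseteq> cs.span G"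
proof -
  have "\<exists>G. finite G \<and> (Fk N \<Sigma> p \<sigma> :: ('a, 'k) tvec set) \<subseteq> ps.span G" for \<sigma>
    using Fk_finite_span[OF assms] by metis
  then obtain G where G: "\<And>\<sigma>. finite (G \<sigma>)" "\<And>\<sigma>. (Fk N \<Sigma> p \<sigma> :: ('a, 'k) tvec set) \<subseteq> ps.span (G \<sigma>)"
    by metis
  \<comment> \<open>\<open>one \<sigma> t\<close> is the chain with the single coefficient \<open>t\<close>, at \<open>\<sigma>\<close>.\<close>
  define one :: "'a set \<Rightarrow> ('a, 'k) tvec \<Rightarrow> ('a, 'k) chain" where "one \<sigma> t = (\<lambda>\<sigma>'. if \<sigma>' = \<sigma> then t else 0)" for \<sigma> t
  have lin: "Vector_Spaces.linear pscale cscale (one \<sigma>)" for \<sigma>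
    by unfold_locales (auto simp: one_def cscale_def pscale_def fun_eq_iff algebra_simps)
  let ?G = "\<Union>\<sigma>\<in>cones \<Sigma> q. one \<sigma> ` G \<sigma>"
  have "c \<in> cs.span ?G" if c: "c \<in> BM_chains N \<Sigma> p q" for c :: "('a, 'k) chain"
  proof -
    have eq: "c = (\<Sum>\<sigma>\<in>cones \<Sigma> q. one \<sigma> (c \<sigma>))"
    proof
      fix \<tau>
      have "(\<Sum>\<sigma>\<in>cones \<Sigma> q. one \<sigma> (c \<sigma>)) \<tau> = (\<Sum>\<sigma>\<in>cones \<Sigma> q. if \<sigma> = \<tau> then c \<tau> else 0)"
        by (subst sum_fun_apply, rule sum.cong) (auto simp: one_def)
      also have "\<dots> = c \<tau>"
        using c by (simp add: BM_chains_def)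
      finally show "c \<tau> = (\<Sum>\<sigma>\<in>cones \<Sigma> q. one \<sigma> (c \<sigma>)) \<tau>" by simp
    qed
    have mem: "one \<sigma> (c \<sigma>) \<in> cs.span ?G" if \<sigma>: "\<sigma> \<in> cones \<Sigma> q" for \<sigma>
    proof -
      interpret l: Vector_Spaces.linear pscale cscale "one \<sigma>" by (rule lin)
      have "c \<sigma> \<in> ps.span (G \<sigma>)" using c \<sigma> G(2) by (auto simp: BM_chains_def)
      then have "one \<sigma> (c \<sigma>) \<in> cs.span (one \<sigma> ` G \<sigma>)" unfolding l.span_image by blast
      moreover have "cs.span (one \<sigma> ` G \<sigma>) \<subseteq> cs.span ?G" using \<sigma> by (intro cs.span_mono) blast
      ultimately show ?thesis by blast
    qed
    have "(\<Sum>\<sigma>\<in>cones \<Sigma> q. one \<sigma> (c \<sigma>)) \<in> cs.span ?G"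
      by (rule cs.span_sum) (rule mem)
    then show ?thesis unfolding eq[symmetric] .
  qed
  then show ?thesis using G(1) by (intro that[of ?G]) auto
qed

text \<open>
  By rank-nullity, \<open>dim C\<^sub>q\<close> is the dimension of the cycles of degree \<open>q\<close> plus that of the boundaries of
  degree \<open>q - 1\<close>, which by exactness are the cycles of degree \<open>q - 1\<close>; the alternating sum telescopes.
\<close>

lemma dim_top_cycles:
  assumes p: "p \<le> d"
    and vanishing: "\<And>q. q < d \<Longrightarrow>
      BM_cycles N \<Sigma> b p q = (BM_boundaries N \<Sigma> b p q :: ('a, 'k::field) chain set)"
  shows "(-1) ^ d * euler_char cscale (BM_chains N \<Sigma> p :: nat \<Rightarrow> ('a, 'k) chain set) d =
    int (cs.dim (BM_cycles N \<Sigma> b p d :: ('a, 'k) chain set))"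
proof -
  let ?C = "BM_chains N \<Sigma> p :: nat \<Rightarrow> ('a, 'k) chain set"
  let ?z = "\<lambda>q. cs.dim (BM_cycles N \<Sigma> b p q :: ('a, 'k) chain set)"
  let ?r = "\<lambda>q. cs.dim (BM_boundary N \<Sigma> b p ` ?C q)"
  have rn: "cs.dim (?C q) = ?z q + ?r q" for q
  proof -
    obtain G :: "('a, 'k) chain set" where G: "finite G" "?C q \<subseteq> cs.span G"
      using BM_chains_finite_span[OF p] by metis
    show ?thesis
      using rank_nullity_subspace[OF linear_BM_boundary[of N \<Sigma> b p] subspace_BM_chains[of N \<Sigma> p q] G(2,1)]
      unfolding BM_cycles_def .
  qed
  have r0: "?r 0 = 0"
  proof -
    have "BM_boundary N \<Sigma> b p ` ?C 0 \<subseteq> cs.span {}" using BM_boundary_chains_0 by auto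
    then show ?thesis using cs.dim_le_card[of "BM_boundary N \<Sigma> b p ` ?C 0" "{}"] by simp
  qed
  have r: "?r (Suc q) = ?z q" if "q < d" for q
    using vanishing[OF that] by (simp add: BM_boundaries_def)
  have "(-1) ^ n * (\<Sum>q\<le>n. (-1) ^ q * int (cs.dim (?C q))) = int (?z n)" if "n \<le> d" for n
    using that
  proof (induction n)
    case 0
    then show ?case using rn[of 0] r0 by simp
  next
    case (Suc n)
    have IH: "(-1) ^ n * (\<Sum>q\<le>n. (-1) ^ q * int (cs.dim (?C q))) = int (?z n)" using Suc by simp
    have "(-1) ^ Suc n * (\<Sum>q\<le>Suc n. (-1) ^ q * int (cs.dim (?C q))) =
        int (cs.dim (?C (Suc n))) - (-1) ^ n * (\<Sum>q\<le>n. (-1) ^ q * int (cs.dim (?C q)))"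
      by (simp add: algebra_simps flip: power_add mult.assoc)
    then show ?case using IH rn[of "Suc n"] r[of n] Suc.prems by simp
  qed
  then show ?thesis by (simp add: euler_char_def)
qed

section \<open>The cap product in degree zero\<close>

text \<open>
  An element \<open>v\<close> of \<open>F\<^sup>p({0})\<close> is a functional on the tensor product; this is the additive map on
  \<open>F\<^sub>p({0})\<close> over the integers that it corresponds to.
\<close>

abbreviation eval_tens :: "nat \<Rightarrow> (('a, 'k::field) tvec \<Rightarrow> 'k) \<Rightarrow> 'a mvec \<Rightarrow> 'k" where
  "eval_tens p v x \<equiv> v (tens (FZ N \<Sigma> p {0}) x 1)"

text \<open>
  For \<open>q = 0\<close> both sums in the cap product have a single term, as \<open>{0}\<close> is the only cone of dimension \<open>0\<close>
  and \<open>\<alpha>\<close> is its own only coface.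
\<close>

lemma cap_0_eq:
  assumes p: "p \<le> d" and \<alpha>: "\<alpha> \<in> cones \<Sigma> d"
  shows "cap N \<Sigma> b d w p 0 u \<alpha> = pscale (w \<alpha> * (-1) ^ (p * (p - 1) div 2))
    (\<Sum>a\<in>shuffle_perms p d. tens (FZ N \<Sigma> (d - p) \<alpha>) (wedge (sel a p d (b \<alpha>)))
      (of_int (sign a) * eval_tens p (u {0}) (wedge (sel a 0 p (b \<alpha>)))))"
    (is "_ = pscale _ ?S")
proof -
  have \<alpha>\<Sigma>: "\<alpha> \<in> \<Sigma>" using top_cone_basis(6)[OF \<alpha>] .
  have z: "{0} face_of \<alpha>" by (rule zero_face[OF \<alpha>\<Sigma>])
  have I: "{\<beta>. \<beta> \<in> cones \<Sigma> d \<and> {0} face_of \<beta> \<and> \<alpha> face_of \<beta>} = {\<alpha>}"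
    using top_cone_maximal[OF \<alpha>] \<alpha> z face_refl[OF \<alpha>\<Sigma>] by (auto simp: cones_def)
  let ?\<epsilon> = "(-1) ^ (p * (p - 1) div 2) :: 'b"
  have rho: "rho N \<Sigma> p {0} \<alpha> (u {0}) (tens (FZ N \<Sigma> p \<alpha>) x 1) = eval_tens p (u {0}) x"
    if "x \<in> FZ N \<Sigma> p \<alpha>" for x
    by (simp add: rho_def Fk_def iota_def tensor_incl_tens[OF FZ_mono[OF z]] tens_in_tensor[OF that])
  have c: "contract N \<Sigma> p \<alpha> (rho N \<Sigma> p {0} \<alpha> (u {0})) (b \<alpha>) = pscale ?\<epsilon> ?S"
  proof -
    have "contract N \<Sigma> p \<alpha> (rho N \<Sigma> p {0} \<alpha> (u {0})) (b \<alpha>) = pscale ?\<epsilon>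
      (\<Sum>a\<in>shuffle_perms p d. tens (FZ N \<Sigma> (d - p) \<alpha>) (wedge (sel a p d (b \<alpha>)))
        (of_int (sign a) * rho N \<Sigma> p {0} \<alpha> (u {0}) (tens (FZ N \<Sigma> p \<alpha>) (wedge (sel a 0 p (b \<alpha>))) 1)))"
      by (simp only: contract_def Let_def top_cone_basis(3)[OF \<alpha>] shuffle_perms_def)
    also have "\<dots> = pscale ?\<epsilon> ?S"
    proof (intro arg_cong[of _ _ "pscale ?\<epsilon>"] sum.cong refl)
      fix a assume a: "a \<in> shuffle_perms p d"
      have "sel a 0 p (b \<alpha>) \<in> cone_lists N \<Sigma> p \<alpha>"
        using sel_in_cone_lists[OF basis_in_cone_lists[OF \<alpha> face_refl[OF \<alpha>\<Sigma>]] a p, of 0] by simp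
      then show "tens (FZ N \<Sigma> (d - p) \<alpha>) (wedge (sel a p d (b \<alpha>)))
        (of_int (sign a) * rho N \<Sigma> p {0} \<alpha> (u {0}) (tens (FZ N \<Sigma> p \<alpha>) (wedge (sel a 0 p (b \<alpha>))) 1)) =
        tens (FZ N \<Sigma> (d - p) \<alpha>) (wedge (sel a p d (b \<alpha>)))
        (of_int (sign a) * eval_tens p (u {0}) (wedge (sel a 0 p (b \<alpha>))))"
        by (simp only: rho[OF wedge_in_FZ])
    qed
    finally show ?thesis .
  qed
  have mem: "pscale ?\<epsilon> ?S \<in> tensor (FZ N \<Sigma> (d - p) \<alpha>)"
  proof (intro ps.subspace_scale ps.subspace_sum subspace_tensor tens_in_tensor wedge_in_FZ)
    fix a assume a: "a \<in> shuffle_perms p d"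
    show "sel a p d (b \<alpha>) \<in> cone_lists N \<Sigma> (d - p) \<alpha>"
      by (rule sel_in_cone_lists[OF basis_in_cone_lists[OF \<alpha> face_refl[OF \<alpha>\<Sigma>]] a order_refl])
  qed
  have "cap N \<Sigma> b d w p 0 u \<alpha> = pscale (w \<alpha>) (iota N \<Sigma> (d - p) \<alpha>
      (contract N \<Sigma> p \<alpha> (rho N \<Sigma> p {0} \<alpha> (u {0})) (b \<alpha>)))"
    using \<alpha> by (simp add: cap_def cones_0 I del: pscale_def)
  also have "\<dots> = pscale (w \<alpha>) (pscale ?\<epsilon> ?S)"
    unfolding c iota_def tensor_incl_self[OF mem] ..
  finally show ?thesis by (simp only: ps.scale_scale)
qed

lemma cap_0_outside: "\<alpha> \<notin> cones \<Sigma> d \<Longrightarrow> cap N \<Sigma> b d w p 0 u \<alpha> = 0"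
  by (simp add: cap_def)

lemma cap_0_apply:
  assumes "p \<le> d" "\<alpha> \<in> cones \<Sigma> d" "additive_on (FZ N \<Sigma> (d - p) \<alpha>) \<phi>"
  shows "cap N \<Sigma> b d w p 0 u \<alpha> \<phi> = w \<alpha> * (-1) ^ (p * (p - 1) div 2) *
    (\<Sum>a\<in>shuffle_perms p d. of_int (sign a) *
      (eval_tens p (u {0}) (wedge (sel a 0 p (b \<alpha>))) * \<phi> (wedge (sel a p d (b \<alpha>)))))"
  using assms(3) unfolding cap_0_eq[OF assms(1,2)]
  by (simp add: pscale_def sum_fun_apply tens_def mult.assoc)

lemma linear_cap_0:
  assumes p: "p \<le> d"
  shows "Vector_Spaces.linear cscale cscale (cap N \<Sigma> b d (w :: _ \<Rightarrow> 'k::field) p 0)"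
proof unfold_locales
  fix u u' :: "('a, 'k) cochain" and r
  have 0: "cap N \<Sigma> b d w p 0 u \<alpha> \<phi> = 0"
    if "\<alpha> \<in> cones \<Sigma> d" "\<not> additive_on (FZ N \<Sigma> (d - p) \<alpha>) \<phi>" for \<alpha> \<phi> and u :: "('a, 'k) cochain"
    using that(2) unfolding cap_0_eq[OF p that(1)] by (simp add: pscale_def sum_fun_apply tens_def)
  show "cap N \<Sigma> b d w p 0 (u + u') = cap N \<Sigma> b d w p 0 u + cap N \<Sigma> b d w p 0 u'"
  proof (intro ext)
    fix \<alpha> and \<phi> :: "'a mvec \<Rightarrow> 'k"
    consider "\<alpha> \<notin> cones \<Sigma> d" | "\<alpha> \<in> cones \<Sigma> d" "\<not> additive_on (FZ N \<Sigma> (d - p) \<alpha>) \<phi>"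
      | "\<alpha> \<in> cones \<Sigma> d" "additive_on (FZ N \<Sigma> (d - p) \<alpha>) \<phi>" by blast
    then show "cap N \<Sigma> b d w p 0 (u + u') \<alpha> \<phi> = (cap N \<Sigma> b d w p 0 u + cap N \<Sigma> b d w p 0 u') \<alpha> \<phi>"
      by cases (simp_all add: cap_0_outside 0 cap_0_apply[OF p] algebra_simps sum.distrib)
  qed
  show "cap N \<Sigma> b d w p 0 (cscale r u) = cscale r (cap N \<Sigma> b d w p 0 u)"
  proof (intro ext)
    fix \<alpha> and \<phi> :: "'a mvec \<Rightarrow> 'k"
    consider "\<alpha> \<notin> cones \<Sigma> d" | "\<alpha> \<in> cones \<Sigma> d" "\<not> additive_on (FZ N \<Sigma> (d - p) \<alpha>) \<phi>"
      | "\<alpha> \<in> cones \<Sigma> d" "additive_on (FZ N \<Sigma> (d - p) \<alpha>) \<phi>" by blast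
    then show "cap N \<Sigma> b d w p 0 (cscale r u) \<alpha> \<phi> = cscale r (cap N \<Sigma> b d w p 0 u) \<alpha> \<phi>"
      by cases (simp_all add: cap_0_outside 0 cap_0_apply[OF p] cscale_def pscale_def sum_distrib_left mult_ac)
  qed
qed

lemma cap_0_in_chains:
  assumes p: "p \<le> d"
  shows "cap N \<Sigma> b d w p 0 u \<in> BM_chains N \<Sigma> (d - p) d"
  unfolding BM_chains_def
proof (intro CollectI conjI ballI allI impI)
  fix \<alpha> assume \<alpha>: "\<alpha> \<in> cones \<Sigma> d"
  show "cap N \<Sigma> b d w p 0 u \<alpha> \<in> Fk N \<Sigma> (d - p) \<alpha>"
    unfolding cap_0_eq[OF p \<alpha>] Fk_def
  proof (intro ps.subspace_scale ps.subspace_sum subspace_tensor tens_in_tensor wedge_in_FZ)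
    fix a assume a: "a \<in> shuffle_perms p d"
    show "sel a p d (b \<alpha>) \<in> cone_lists N \<Sigma> (d - p) \<alpha>"
      by (rule sel_in_cone_lists[OF basis_in_cone_lists[OF \<alpha> face_refl[OF top_cone_basis(6)[OF \<alpha>]]] a order_refl])
  qed
qed (rule cap_0_outside)

lemma cone_lists_ambient: "cone_lists N \<Sigma> p \<sigma> \<subseteq> {xs. length xs = p \<and> set xs \<subseteq> N}"
  by (auto simp: cone_lists_def cone_lattice_def)

text \<open>
  The maximal cones have dimension \<open>d\<close> and span subspaces of the span of \<open>N\<close>, so the rank of \<open>N\<close> is at
  least \<open>d\<close>.
\<close>

lemma lattice_basis:
  obtains bs ds where "dual_lists bs ds" "group_closure (set bs) = N" "d \<le> length bs"
proof -
  obtain B where B: "independent B" "N = group_closure B" using lattice by (auto simp: is_lattice_def)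
  then have "finite B" using independent_imp_finite by blast
  then obtain bs where bs: "set bs = B" "distinct bs" using finite_distinct_list by blast
  obtain ds where ds: "dual_lists bs ds" using dual_lists_exist[of bs] bs B(1) by blast
  obtain \<alpha> where \<alpha>: "\<alpha> \<in> cones \<Sigma> d" using maximal_cone_above[OF vertex] .
  have "set (b \<alpha>) \<subseteq> N" using top_cone_basis(5)[OF \<alpha>] by (auto simp: cone_lattice_def)
  also have "N \<subseteq> span B" using span_superset[of N] B(2) by (simp add: span_group_closure)
  finally have "card (set (b \<alpha>)) \<le> card B"
    using independent_span_bound[OF \<open>finite B\<close> top_cone_basis(2)[OF \<alpha>]] by blast
  then have "d \<le> length bs"
    using distinct_card[OF top_cone_basis(1)[OF \<alpha>]] distinct_card[OF bs(2)] bs(1) top_cone_basis(3)[OF \<alpha>] by simp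
  then show ?thesis using that ds bs(1) B(2) by blast
qed

text \<open>
  At a cone \<open>\<tau>\<close> of dimension \<open>d - 1\<close> and a functional \<open>\<phi>\<close>, the boundary of the cap product is, up to a
  global sign, the boundary of the fundamental chain at \<open>\<tau>\<close> evaluated at the functional \<open>\<psi>\<close> that
  \<open>comultiplication_functional\<close> attaches to \<open>u\<close> and \<open>\<phi>\<close>. The latter is zero by balancing.
\<close>

lemma cap_0_cycle:
  assumes p: "p \<le> d" and bal: "balanced N \<Sigma> b d (w :: _ \<Rightarrow> 'k::field)"
    and u: "u {0} \<in> Fk_dual N \<Sigma> p {0}"
  shows "cap N \<Sigma> b d w p 0 u \<in> BM_cycles N \<Sigma> b (d - p) d"
proof -
  have "BM_boundary N \<Sigma> b (d - p) (cap N \<Sigma> b d w p 0 u) \<tau> \<phi> = 0" for \<tau> \<phi>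
  proof (cases "\<tau> \<in> \<Sigma> \<and> additive_on (FZ N \<Sigma> (d - p) \<tau>) \<phi>")
    case True
    then have \<tau>: "\<tau> \<in> \<Sigma>" "additive_on (FZ N \<Sigma> (d - p) \<tau>) \<phi>" by auto
    let ?r = "\<lambda>\<sigma>. of_int (rel_sign b \<tau> \<sigma>) :: 'k"
    have "(\<Sum>\<sigma>\<in>cofaces \<Sigma> \<tau>. ?r \<sigma> * cap N \<Sigma> b d w p 0 u \<sigma> \<phi>) = 0"
    proof (cases "Suc (dim \<tau>) = d")
      case False
      then have "\<sigma> \<notin> cones \<Sigma> d" if "\<sigma> \<in> cofaces \<Sigma> \<tau>" for \<sigma> using that by (auto simp: cones_def)
      then show ?thesis by (intro sum.neutral) (simp add: cap_0_outside)
    next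
      case True
      have top: "\<sigma> \<in> cones \<Sigma> d" "\<tau> face_of \<sigma>" if "\<sigma> \<in> cofaces \<Sigma> \<tau>" for \<sigma>
        using that True by (auto simp: cones_def)
      obtain bs ds where bs: "dual_lists bs ds" "group_closure (set bs) = N" "d \<le> length bs"
        by (rule lattice_basis)
      have Fsub: "FZ N \<Sigma> p {0} \<subseteq> group_closure (wedge ` {xs. length xs = p \<and> set xs \<subseteq> group_closure (set bs)})"
        unfolding FZ_eq_group_closure bs(2) using cone_lists_ambient
        by (intro group_closure_minimal order_trans[OF image_mono group_closure_superset]) auto
      have uadd: "additive_on (FZ N \<Sigma> p {0}) (eval_tens p (u {0}))"
        using dual_tens_additive u unfolding Fk_dual_def Fk_def .
      let ?\<kappa> = "\<lambda>xs. \<Sum>a\<in>shuffle_perms p d. of_int (sign a) *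
        (eval_tens p (u {0}) (wedge (sel a 0 p xs)) * \<phi> (wedge (sel a p d xs)))"
      have S1: "length xs = d" if "xs \<in> cone_lists N \<Sigma> d \<tau>" for xs
        using that by (simp add: cone_lists_def)
      have S2: "wedge (sel a 0 p xs) \<in> FZ N \<Sigma> p {0}"
        if "xs \<in> cone_lists N \<Sigma> d \<tau>" "a \<in> shuffle_perms p d" for xs a
        using wedge_in_FZ[OF sel_in_cone_lists[OF that p, of 0]] FZ_mono[OF zero_face[OF \<tau>(1)], of N \<Sigma> p] by auto
      have S3: "wedge (sel a p d xs) \<in> FZ N \<Sigma> (d - p) \<tau>"
        if "xs \<in> cone_lists N \<Sigma> d \<tau>" "a \<in> shuffle_perms p d" for xs a
        by (rule wedge_in_FZ[OF sel_in_cone_lists[OF that order_refl]])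
      obtain \<psi> where \<psi>: "additive_on (group_closure (wedge ` cone_lists N \<Sigma> d \<tau>)) \<psi>"
        "\<And>xs. xs \<in> cone_lists N \<Sigma> d \<tau> \<Longrightarrow> \<psi> (wedge xs) = ?\<kappa> xs"
        using comultiplication_functional[OF bs(1) order_trans[OF p bs(3)] subgroup_on_FZ uadd Fsub
            subgroup_on_FZ \<tau>(2) S1 S2 S3 p] by blast
      have \<psi>add: "additive_on (FZ N \<Sigma> d \<tau>) \<psi>" using \<psi>(1) by (simp only: FZ_eq_group_closure)
      have "BM_boundary N \<Sigma> b d (fundamental_chain N \<Sigma> b d w) \<tau> \<psi> = 0"
        using bal by (simp add: balanced_def BM_cycles_def)
      then have "(\<Sum>\<sigma>\<in>cofaces \<Sigma> \<tau>. ?r \<sigma> * fundamental_chain N \<Sigma> b d w \<sigma> \<psi>) = 0"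
        using \<tau>(1) \<psi>add by (simp only: BM_boundary_apply if_True simp_thms)
      moreover have "fundamental_chain N \<Sigma> b d w \<sigma> \<psi> = w \<sigma> * ?\<kappa> (b \<sigma>)" if "\<sigma> \<in> cofaces \<Sigma> \<tau>" for \<sigma>
      proof -
        have "fundamental_chain N \<Sigma> b d w \<sigma> \<psi> = w \<sigma> * \<psi> (wedge (b \<sigma>))"
          using top[OF that] additive_on_mono[OF \<psi>add FZ_mono[of \<tau> \<sigma>]]
          by (simp add: fundamental_chain_def pscale_def tens_def)
        then show ?thesis using \<psi>(2)[OF basis_in_cone_lists[OF top[OF that]]] by simp
      qed
      ultimately have "(\<Sum>\<sigma>\<in>cofaces \<Sigma> \<tau>. ?r \<sigma> * (w \<sigma> * ?\<kappa> (b \<sigma>))) = 0"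
        by simp
      moreover have "cap N \<Sigma> b d w p 0 u \<sigma> \<phi> = (-1) ^ (p * (p - 1) div 2) * (w \<sigma> * ?\<kappa> (b \<sigma>))"
        if "\<sigma> \<in> cofaces \<Sigma> \<tau>" for \<sigma>
        using cap_0_apply[OF p top(1)[OF that] additive_on_mono[OF \<tau>(2) FZ_mono[OF top(2)[OF that]]], of w u]
        by (simp only: mult_ac)
      ultimately show ?thesis
        by (simp add: mult.left_commute[of "?r _"] flip: sum_distrib_left)
    qed
    then show ?thesis using True by (simp only: BM_boundary_apply if_True simp_thms)
  qed (auto simp: BM_boundary_apply)
  then have "BM_boundary N \<Sigma> b (d - p) (cap N \<Sigma> b d w p 0 u) = 0" by (auto simp: fun_eq_iff)
  then show ?thesis using cap_0_in_chains[OF p] by (simp add: BM_cycles_def)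
qed

text \<open>
  For a maximal cone \<open>\<alpha>\<close> and a shuffle \<open>c\<close>, the coordinate of the contraction belonging to the last
  \<open>d - p\<close> vectors chosen by \<open>c\<close> is, up to a unit, the value of \<open>u\<close> on the wedge of the first \<open>p\<close>. So \<open>u\<close>
  vanishes on the generators from \<open>FZ_finite_generators\<close>.
\<close>

lemma cap_0_injective:
  assumes p: "p \<le> d" and w: "weight_function \<Sigma> d (w :: _ \<Rightarrow> 'k::field)"
    and u: "u {0} \<in> Fk_dual N \<Sigma> p {0}" and 0: "cap N \<Sigma> b d w p 0 u = 0"
  shows "u {0} = 0"
proof -
  have uadd: "additive_on (FZ N \<Sigma> p {0}) (eval_tens p (u {0}))"
    using dual_tens_additive u unfolding Fk_dual_def Fk_def .
  have gen: "eval_tens p (u {0}) (wedge (sel c 0 p (b \<alpha>))) = 0"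
    if \<alpha>: "\<alpha> \<in> cones \<Sigma> d" and c: "c \<in> shuffle_perms p d" for \<alpha> c
  proof -
    have \<alpha>\<Sigma>: "\<alpha> \<in> \<Sigma>" using top_cone_basis(6)[OF \<alpha>] .
    obtain ds where ds: "dual_lists (b \<alpha>) ds" using dual_lists_exist top_cone_basis(1,2)[OF \<alpha>] by metis
    \<comment> \<open>The coordinate of \<open>x\<close> belonging to the vectors \<open>c p, \<dots>, c (d - 1)\<close>. It is an integer, and
      taking the floor only serves to regard it as one, so that it can be mapped to \<open>'k\<close>.\<close>
    define \<phi> where "\<phi> x = (of_int \<lfloor>x (sel c p d ds)\<rfloor> :: 'k)" for x :: "'a mvec"
    have int: "x (sel c p d ds) \<in> \<int>" if "x \<in> FZ N \<Sigma> (d - p) \<alpha>" for x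
      using that unfolding FZ_eq_group_closure
    proof induction
      case (base x)
      have "x (sel c p d ds) \<in> \<int>" if x: "x \<in> wedge ` cone_lists N \<Sigma> (d - p) \<alpha>"
      proof -
        obtain xs \<gamma> where xs: "x = wedge xs" "\<gamma> \<in> \<Sigma>" "\<alpha> face_of \<gamma>" "set xs \<subseteq> cone_lattice N \<gamma>"
          using x by (auto simp: cone_lists_def)
        then have "set xs \<subseteq> group_closure (set (b \<alpha>))"
          using top_cone_maximal[OF \<alpha>] top_cone_basis(4)[OF \<alpha>] by metis
        moreover have "set (sel c p d ds) \<subseteq> set ds"
          using set_sel_subset[of c ds d p] shuffle_permutes[OF c] ds top_cone_basis(3)[OF \<alpha>]
          by (auto simp: dual_lists_def)
        ultimately show ?thesis
          unfolding xs(1) using dual_lists_Ints[OF ds] by (intro wedge_Ints) blast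
      qed
      then show ?case using base by auto
    qed simp
    have \<phi>: "additive_on (FZ N \<Sigma> (d - p) \<alpha>) \<phi>"
      unfolding additive_on_def \<phi>_def
    proof (intro ballI)
      fix x y assume "x \<in> FZ N \<Sigma> (d - p) \<alpha>" "y \<in> FZ N \<Sigma> (d - p) \<alpha>"
      then obtain m n where "x (sel c p d ds) = of_int m" "y (sel c p d ds) = of_int n"
        using int Ints_cases by metis
      then show "of_int \<lfloor>(x + y) (sel c p d ds)\<rfloor> =
          (of_int \<lfloor>x (sel c p d ds)\<rfloor> + of_int \<lfloor>y (sel c p d ds)\<rfloor> :: 'k)"
        by (simp flip: of_int_add)
    qed
    have "(\<Sum>a\<in>shuffle_perms p d. of_int (sign a) *
        (eval_tens p (u {0}) (wedge (sel a 0 p (b \<alpha>))) * \<phi> (wedge (sel a p d (b \<alpha>))))) =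
      (\<Sum>a\<in>shuffle_perms p d. if a = c then of_int (sign c) * eval_tens p (u {0}) (wedge (sel c 0 p (b \<alpha>))) else 0)"
      by (rule sum.cong[OF refl])
        (simp add: \<phi>_def wedge_dual_shuffles(2)[OF ds top_cone_basis(3)[OF \<alpha>] p _ c])
    also have "\<dots> = of_int (sign c) * eval_tens p (u {0}) (wedge (sel c 0 p (b \<alpha>)))"
      using c by simp
    finally have "w \<alpha> * (-1) ^ (p * (p - 1) div 2) *
        (of_int (sign c) * eval_tens p (u {0}) (wedge (sel c 0 p (b \<alpha>)))) = 0"
      using cap_0_apply[OF p \<alpha> \<phi>, of w u] 0 by simp
    moreover have "w \<alpha> \<noteq> 0" using w \<alpha> by (simp add: weight_function_def)
    moreover have "(of_int (sign c) :: 'k) \<noteq> 0" by (simp add: sign_def)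
    ultimately show ?thesis by simp
  qed
  have "eval_tens p (u {0}) x = 0" if x: "x \<in> FZ N \<Sigma> p {0}" for x
  proof -
    let ?G = "\<Union>\<alpha>\<in>{\<alpha> \<in> cones \<Sigma> d. {0} face_of \<alpha>}. (\<lambda>a. wedge (sel a 0 p (b \<alpha>))) ` shuffle_perms p d"
    have "additive_on (group_closure ?G) (eval_tens p (u {0}))" "x \<in> group_closure ?G"
      using uadd x FZ_finite_generators[OF p, of "{0}"] by simp_all
    moreover have "eval_tens p (u {0}) y = 0" if "y \<in> ?G" for y
      using that gen by blast
    ultimately show ?thesis
      using additive_on_zero_group_closure[where \<phi> = "eval_tens p (u {0})" and S = ?G] by blast
  qed
  then show ?thesis
    using dual_tensor_eq_0 u unfolding Fk_dual_def Fk_def by blast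
qed

end

section \<open>The duality criterion\<close>

lemma cap_zero: "cap N \<Sigma> b d w p q 0 = 0"
proof -
  have r: "rho N \<Sigma> p \<gamma> \<alpha> 0 = 0" for \<gamma> \<alpha>
    by (auto simp: rho_def fun_eq_iff)
  have c: "contract N \<Sigma> p \<alpha> 0 ys = 0" for \<alpha> ys
    by (auto simp: contract_def Let_def fun_eq_iff pscale_def sum_fun_apply tens_def intro!: sum.neutral)
  have i: "pscale x (iota N \<Sigma> (d - p) \<tau> 0) = 0" for x \<tau>
    by (auto simp: iota_def tensor_incl_def fun_eq_iff pscale_def)
  have "cap N \<Sigma> b d w p q 0 \<tau> = 0" for \<tau>
    by (simp only: cap_def zero_fun_apply r c i sum.neutral_const if_cancel)
  then show ?thesis by (simp add: fun_eq_iff)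
qed

lemma subspace_cochains: "cs.subspace (cochains N \<Sigma> p q)"
  by (auto simp: cs.subspace_def cochains_def cscale_def Fk_dual_def
      intro: ps.subspace_add[OF dual_subspace] ps.subspace_scale[OF dual_subspace]
        ps.subspace_0[OF dual_subspace])

lemma quotient_space_singleD:
  assumes "quotient_space Z B = {B}" "0 \<in> B"
  shows "Z \<subseteq> B"
proof
  fix z assume "z \<in> Z"
  then have "z +o B = B" using assms(1) by (auto simp: quotient_space_def)
  then show "z \<in> B" using assms(2) by (force simp: elt_set_plus_def)
qed

context oriented_fan
begin

text \<open>The only compact cone has dimension \<open>0\<close>, so it has no facets.\<close>

lemma coboundary_zero: "coboundary N \<Sigma> b p c = 0"
proof
  fix \<sigma>
  have "coboundary N \<Sigma> b p c \<sigma> = 0" if "\<sigma> \<in> \<Sigma>" "compact \<sigma>"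
  proof -
    have "\<sigma> = {0}" using that compact_cone_iff by blast
    then have "{\<tau>. \<tau> \<in> \<Sigma> \<and> compact \<tau> \<and> \<tau> face_of \<sigma> \<and> dim \<sigma> = Suc (dim \<tau>)} = {}" by auto
    then show ?thesis by (simp only: coboundary_def sum.empty if_cancel)
  qed
  then show "coboundary N \<Sigma> b p c \<sigma> = 0 \<sigma>"
    by (cases "\<sigma> \<in> \<Sigma> \<and> compact \<sigma>") (auto simp: coboundary_def)
qed

lemma cocycles_eq: "cocycles N \<Sigma> b p q = cochains N \<Sigma> p q"
  by (simp only: cocycles_def coboundary_zero simp_thms Collect_mem_eq)

lemma coboundaries_eq: "coboundaries N \<Sigma> b p q = {0 :: ('a, 'k::field) cochain}"
proof (cases q)
  case (Suc r)
  have "coboundary N \<Sigma> b p ` (cochains N \<Sigma> p r :: ('a, 'k) cochain set) = (\<lambda>_. 0) ` (cochains N \<Sigma> p r :: ('a, 'k) cochain set)"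
    by (rule image_cong[OF refl]) (rule coboundary_zero)
  also have "\<dots> = {0}"
    by (rule image_constant[OF cs.subspace_0[OF subspace_cochains]])
  finally show ?thesis by (simp only: Suc coboundaries_def nat.case)
qed (simp only: coboundaries_def nat.case)

lemma cochains_positive:
  assumes "0 < q"
  shows "cochains N \<Sigma> p q = {0}"
proof -
  have "\<not> (\<sigma> \<in> cones \<Sigma> q \<and> compact \<sigma>)" for \<sigma>
  proof
    assume \<sigma>: "\<sigma> \<in> cones \<Sigma> q \<and> compact \<sigma>"
    then have "\<sigma> = {0}" "dim \<sigma> = q" using compact_cone_iff by (auto simp: cones_def)
    then show False using assms by simp
  qed
  then show ?thesis by (auto simp: cochains_def)
qed

text \<open>Both quotients consist of a single coset.\<close>

lemma cap_iso_positive_degree: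
  fixes w :: "'a set \<Rightarrow> 'k::field"
  assumes "0 < q"
    and "(BM_homology N \<Sigma> b (d - p) (d - q) :: ('a, 'k) chain set set) = {BM_boundaries N \<Sigma> b (d - p) (d - q)}"
  shows "cap_iso N \<Sigma> b d w p q"
  unfolding cap_iso_def cocycles_eq coboundaries_eq cochains_positive[OF assms(1)]
proof (rule quotient_iso_one_coset)
  show "quotient_space {0} {0} = {{0 :: ('a, 'k) cochain}}"
    by (simp add: quotient_space_zero)
  show "quotient_space (BM_cycles N \<Sigma> b (d - p) (d - q) :: ('a, 'k) chain set) (BM_boundaries N \<Sigma> b (d - p) (d - q)) =
      {BM_boundaries N \<Sigma> b (d - p) (d - q)}"
    using assms(2) by (simp only: BM_homology_def)
  show "induced_map (cap N \<Sigma> b d w p q) (BM_boundaries N \<Sigma> b (d - p) (d - q)) {0} =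
      BM_boundaries N \<Sigma> b (d - p) (d - q)"
    by (simp add: induced_map_def cap_zero)
qed (simp_all add: vector_space_cscale subspace_BM_boundaries cs.subspace_single_0)

lemma cap_iso_degree_0_iff_bij:
  assumes "p \<le> d"
  shows "cap_iso N \<Sigma> b d w p 0 \<longleftrightarrow>
    bij_betw (cap N \<Sigma> b d w p 0) (cochains N \<Sigma> p 0) (BM_cycles N \<Sigma> b (d - p) d)"
  unfolding cap_iso_def cocycles_eq coboundaries_eq diff_zero BM_boundaries_top
  by (rule quotient_iso_trivial_boundaries[OF vector_space_cscale vector_space_cscale linear_cap_0[OF assms]])

lemma dim_cochains_0:
  "cs.dim (cochains N \<Sigma> p 0 :: ('a, 'k::field) cochain set) =
    ps.dim (Fk_dual N \<Sigma> p {0} :: (('a, 'k) tvec \<Rightarrow> 'k) set)"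
proof -
  define E :: "(('a, 'k) tvec \<Rightarrow> 'k) \<Rightarrow> ('a, 'k) cochain" where "E v = (\<lambda>\<sigma>. if \<sigma> = {0} then v else 0)" for v
  have lin: "Vector_Spaces.linear pscale cscale E"
    by unfold_locales (auto simp: E_def cscale_def pscale_def fun_eq_iff algebra_simps)
  have c: "\<sigma> \<in> cones \<Sigma> 0 \<and> compact \<sigma> \<longleftrightarrow> \<sigma> = {0}" for \<sigma> :: "'a set"
    unfolding cones_0 by auto
  have "cochains N \<Sigma> p 0 = E ` Fk_dual N \<Sigma> p {0}"
  proof
    show "E ` Fk_dual N \<Sigma> p {0} \<subseteq> cochains N \<Sigma> p 0"
      unfolding cochains_def c by (auto simp: E_def)
    show "cochains N \<Sigma> p 0 \<subseteq> E ` Fk_dual N \<Sigma> p {0}"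
    proof
      fix u :: "('a, 'k) cochain" assume "u \<in> cochains N \<Sigma> p 0"
      then have "u {0} \<in> Fk_dual N \<Sigma> p {0}" "u = E (u {0})"
        unfolding cochains_def c by (auto simp: E_def)
      then show "u \<in> E ` Fk_dual N \<Sigma> p {0}" by blast
    qed
  qed
  moreover have "inj_on E (Fk_dual N \<Sigma> p {0})"
  proof (rule inj_onI)
    fix v v' assume "E v = E v'"
    then have "E v {0} = E v' {0}" by simp
    then show "v = v'" by (simp add: E_def)
  qed
  moreover have "ps.subspace (Fk_dual N \<Sigma> p {0} :: (('a, 'k) tvec \<Rightarrow> 'k) set)"
    unfolding Fk_dual_def by (rule dual_subspace)
  ultimately show ?thesis using dim_image_injective[OF lin] by simp
qed

text \<open>
  The cap product is an injective linear map of the space of cochains into the finite dimensional space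
  of cycles, so it is onto iff the dimensions agree.
\<close>

lemma cap_iso_degree_0_iff_dim:
  assumes p: "p \<le> d" and bal: "balanced N \<Sigma> b d (w :: _ \<Rightarrow> 'k::field)"
  shows "cap_iso N \<Sigma> b d w p 0 \<longleftrightarrow>
    cs.dim (BM_cycles N \<Sigma> b (d - p) d :: ('a, 'k) chain set) =
    ps.dim (Fk_dual N \<Sigma> p {0} :: (('a, 'k) tvec \<Rightarrow> 'k) set)"
proof -
  let ?f = "cap N \<Sigma> b d w p 0" and ?C = "cochains N \<Sigma> p 0 :: ('a, 'k) cochain set"
    and ?Z = "BM_cycles N \<Sigma> b (d - p) d :: ('a, 'k) chain set"
  interpret f: Vector_Spaces.linear cscale cscale ?f by (rule linear_cap_0[OF p])
  have C: "u {0} \<in> Fk_dual N \<Sigma> p {0}" "\<sigma> \<noteq> {0} \<Longrightarrow> u \<sigma> = 0" if "u \<in> ?C" for u \<sigma>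
    using that cones_0 by (auto simp: cochains_def)
  have inj: "inj_on ?f ?C"
  proof (rule inj_onI)
    fix u u' assume u: "u \<in> ?C" "u' \<in> ?C" "?f u = ?f u'"
    have d: "u - u' \<in> ?C" using cs.subspace_diff[OF subspace_cochains u(1,2)] .
    have "?f (u - u') = 0" using u(3) by (simp only: f.diff diff_self)
    then have "(u - u') {0} = 0"
      using cap_0_injective[where u = "u - u'" and w = w, OF p _ C(1)[OF d]] bal
      by (simp only: balanced_def)
    then have "(u - u') \<sigma> = 0" for \<sigma> using C(2)[OF d] by (cases "\<sigma> = {0}") auto
    then have "u \<sigma> - u' \<sigma> = 0" for \<sigma> by (simp only: minus_apply)
    then show "u = u'" by (intro ext[of u u']) (simp only: right_minus_eq)
  qed
  have dimC: "cs.dim (?f ` ?C) = ps.dim (Fk_dual N \<Sigma> p {0} :: (('a, 'k) tvec \<Rightarrow> 'k) set)"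
    using dim_image_injective[OF f.linear_axioms subspace_cochains inj] dim_cochains_0 by metis
  have sub: "?f ` ?C \<subseteq> ?Z" using cap_0_cycle[OF p bal] C(1) by blast
  have "cs.subspace (?f ` ?C)" by (rule f.subspace_image[OF subspace_cochains])
  moreover obtain G :: "('a, 'k) chain set" where G: "finite G" "BM_chains N \<Sigma> (d - p) d \<subseteq> cs.span G"
    using BM_chains_finite_span[of "d - p"] by (metis diff_le_self)
  moreover have "?Z \<subseteq> cs.span G" using G(2) by (auto simp: BM_cycles_def)
  ultimately have "?f ` ?C = ?Z" if "cs.dim ?Z = cs.dim (?f ` ?C)"
    using cs.subspace_dim_eq[of "?f ` ?C" ?Z G] sub that by simp
  then show ?thesis
    unfolding cap_iso_degree_0_iff_bij[OF p] bij_betw_def using inj dimC by metis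
qed

end

theorem proposition4p6:
  fixes N :: "'a::euclidean_space set"
    and \<Sigma> :: "'a set set"
    and d :: nat
    and b :: "'a set \<Rightarrow> 'a list"
    and w :: "'a set \<Rightarrow> 'k::field"
  assumes "is_lattice N"
    and "pure_fan N \<Sigma> d"
    and "orientation N \<Sigma> b"
    and "balanced N \<Sigma> b d w"
    and "\<And>p q. q \<noteq> d \<Longrightarrow>
           (BM_homology N \<Sigma> b p q :: ('a, 'k) chain set set) = {BM_boundaries N \<Sigma> b p q}"
  shows "(\<forall>p\<le>d. (\<forall>q\<le>d. cap_iso N \<Sigma> b d w p q) \<longleftrightarrow>
            (-1) ^ d * euler_char cscale (BM_chains N \<Sigma> (d - p) :: nat \<Rightarrow> ('a, 'k) chain set) d
              = int (vector_space.dim pscale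
                       (Fk_dual N \<Sigma> p {0} :: (('a, 'k) tvec \<Rightarrow> 'k) set))) \<and>
         (tropical_Poincare_duality N \<Sigma> b d w \<longleftrightarrow>
            (\<forall>p\<le>d. (-1) ^ d * euler_char cscale (BM_chains N \<Sigma> (d - p) :: nat \<Rightarrow> ('a, 'k) chain set) d
              = int (vector_space.dim pscale
                       (Fk_dual N \<Sigma> p {0} :: (('a, 'k) tvec \<Rightarrow> 'k) set))))"
proof -
  interpret oriented_fan N \<Sigma> d b
    using assms(1-3) by unfold_locales
  have exact: "BM_cycles N \<Sigma> b p q = (BM_boundaries N \<Sigma> b p q :: ('a, 'k) chain set)" if "q < d" for p q
  proof -
    have "BM_homology N \<Sigma> b p q = {BM_boundaries N \<Sigma> b p q :: ('a, 'k) chain set}"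
      using that by (intro assms(5)) simp
    then have "BM_cycles N \<Sigma> b p q \<subseteq> (BM_boundaries N \<Sigma> b p q :: ('a, 'k) chain set)"
      unfolding BM_homology_def by (rule quotient_space_singleD) (rule cs.subspace_0[OF subspace_BM_boundaries])
    then show ?thesis using BM_boundaries_subset_cycles by blast
  qed
  have main: "(\<forall>q\<le>d. cap_iso N \<Sigma> b d w p q) \<longleftrightarrow>
      (-1) ^ d * euler_char cscale (BM_chains N \<Sigma> (d - p) :: nat \<Rightarrow> ('a, 'k) chain set) d
        = int (vector_space.dim pscale (Fk_dual N \<Sigma> p {0} :: (('a, 'k) tvec \<Rightarrow> 'k) set))" if p: "p \<le> d" for p
  proof -
    have pos: "cap_iso N \<Sigma> b d w p q" if "0 < q" "q \<le> d" for q
      by (rule cap_iso_positive_degree[OF that(1) assms(5)]) (use that in simp)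
    have "(\<forall>q\<le>d. cap_iso N \<Sigma> b d w p q) \<longleftrightarrow> cap_iso N \<Sigma> b d w p 0"
      using pos by (metis gr0I le0)
    also have "\<dots> \<longleftrightarrow> cs.dim (BM_cycles N \<Sigma> b (d - p) d :: ('a, 'k) chain set) =
        ps.dim (Fk_dual N \<Sigma> p {0} :: (('a, 'k) tvec \<Rightarrow> 'k) set)"
      by (rule cap_iso_degree_0_iff_dim[OF p assms(4)])
    also have "\<dots> \<longleftrightarrow> (-1) ^ d * euler_char cscale (BM_chains N \<Sigma> (d - p) :: nat \<Rightarrow> ('a, 'k) chain set) d
        = int (vector_space.dim pscale (Fk_dual N \<Sigma> p {0} :: (('a, 'k) tvec \<Rightarrow> 'k) set))"
      using dim_top_cycles[of "d - p", OF _ exact] by simp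
    finally show ?thesis .
  qed
  then show ?thesis
    unfolding tropical_Poincare_duality_def by blast
qed

end
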